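(* Let $n\ge2$, let $G$ be a finite abelian group of order $n$ with identity $e$, let $\alpha$ be a unital partial action of $G$ on a commutative ring $S$, and let $S\supseteq R$ be a partial $n$-kummerian extension, with $\omega\in R$ as in the definition of an $n$-kummerian ring and $\hat G=\operatorname{Hom}(G,\langle\omega\rangle)$. Then: (1) For any $g\in G$ with $g\ne e$, $\sum_{\chi\in\hat G}\chi(g)=0$. (2) The set $\hat G_{\rm par}=\{\chi_p:\chi\in\hat G\}$ is a subgroup of $Z^1(G,\alpha,S)$. Moreover: (a) the map $\mu_p:\hat G\to\hat G_{\rm par}$, $\chi\mapsto\chi_p$, is a group epimorphism with $\ker\mu_p=\{\chi\in\hat G:\chi(g)=1\text{ for every } g\in G\text{ with }1_g\ne0\}$; in particular, if $1_g\neq0$ for all $g\in G$, the groups $\hat G$ and $\hat G_{\rm par}$ are isomorphic; (b) the map $\hat G_{\rm par}\to\operatorname{Inv}_R(S)$, $\chi_p\mapsto Q_{\chi_p}$, is a group homomorphism. (3) One has $S=\sum_{\chi\in\hat G}Q_{\chi_p}$, and this sum (indexed by $\chi\in\hat G$) is direct if and only if $S\supseteq R$ is a (global) Galois extension. (4) Let $(T,\beta)$ be a globalization of $(S,\alpha)$. For any $\chi\in\hat G$ we have $Q_{\psi_\chi}1_S\subseteq Q_{\chi_p}$.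
   Context: Partial actions. Let $k$ be a commutative ring and $S$ a commutative unital $k$-algebra. A unital partial action $\alpha$ of a finite group $G$ on $S$ is a family of $k$-algebra isomorphisms $\alpha_g:S_{g^{-1}}\to S_g$ ($g\in G$), where each $S_g$ is an ideal of $S$ having an identity element $1_g$ (so $S_g=S1_g$), such that (i) $S_e=S$ and $\alpha_e=\mathrm{id}_S$; (ii) $\alpha_g(S_{g^{-1}}\cap S_h)=S_g\cap S_{gh}$ for all $g,h\in G$; (iii) $\alpha_g(\alpha_h(x))=\alpha_{gh}(x)$ for all $g,h\in G$, $x\in S_{h^{-1}}\cap S_{(gh)^{-1}}$. It is global if $\alpha_{gh}=\alpha_g\circ\alpha_h$ for all $g,h$ (so $S_g=S$ for all $g$). Put $S^\alpha=\{a\in S:\alpha_g(a1_{g^{-1}})=a1_g\ \forall g\in G\}$. For a subring $R\subseteq S$ with $1_R=1_S$, $S\supseteq R$ is a partial Galois extension (with group $G$) if $R=S^\alpha$ and there are $l\in\mathbb N$ and $x_i,y_i\in S$ ($1\le i\le l$) with $\sum_{i=1}^l x_i\alpha_g(y_i1_{g^{-1}})=\delta_{e,g}$ for all $g\in G$; it is a (global) Galois extension if moreover $\alpha$ is global. For $n\ge2$, a commutative ring $R$ is $n$-kummerian if there is $\omega\in\mathcal U(R)$ with $\omega^n=1$ and $1-\omega^i\in\mathcal U(R)$ for $1\le i\le n-1$. A partial Galois extension $S\supseteq R$ with group $G$ is partial $n$-kummerian if $G$ is abelian of order $n$ and $R$ is $n$-kummerian. Cocycles. $Z^1(G,\alpha,S)$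 is the abelian group, under pointwise product, of functions $f:G\to S$ with $f(g)\in\mathcal U(S_g)$ for all $g$ and $f(gh)1_g=f(g)\alpha_g(f(h)1_{g^{-1}})$ for all $g,h\in G$; its identity is $g\mapsto1_g$. For $f\in Z^1(G,\alpha,S)$, $Q_f=\{a\in S:\alpha_g(a1_{g^{-1}})=f(g)a\ \forall g\in G\}$. For $\chi\in\hat G$, $\chi_p:G\to S$ is $\chi_p(g)=\chi(g)1_g$; $\hat G$ is a group under pointwise product. For $R$-submodules $X,Y$ of $S$, $XY$ is the set of finite sums of products $xy$, $x\in X$, $y\in Y$; $\operatorname{Inv}_R(S)$ is the group (under this product, identity $R$) of $R$-submodules $X$ of $S$ for which there is an $R$-submodule $Y$ of $S$ with $XY=R$. Globalization. A globalization $(T,\beta)$ of $(S,\alpha)$ is a (commutative, unital) ring $T$ with a global action $\beta$ of $G$ such that $S$ is (identified with) an ideal of $T$, $S_g=S\cap\beta_g(S)$ and $\alpha_g=\beta_g|_{S_{g^{-1}}}$ for all $g$, and $T=\sum_{g\in G}\beta_g(S)$; $T^G$ is the ring of $\beta$-invariants. The map $T^G\to R$, $x\mapsto x1_S$, is a ring isomorphism with inverse denoted $\psi:R\to T^G$. For $\chi\in\hat G$, $\psi_\chi=\psi\circ\chi:G\to\langle\psi(\omega)\rangle\subseteq T^G$, and $Q_{\psi_\chi}=\{b\in T:\beta_g(b)=\psi_\chi(g)b\ \forall g\in G\}$. *)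

theory Defs
  imports "HOL-Algebra.Algebra"
begin

section \<open>Unital partial actions\<close>

definition ideal_ident :: "('a, 'm) ring_scheme \<Rightarrow> 'a set \<Rightarrow> 'a" where
  "ideal_ident S I = (THE u. u \<in> I \<and> (\<forall>x\<in>I. u \<otimes>\<^bsub>S\<^esub> x = x))"

definition unital_ideal :: "('a, 'm) ring_scheme \<Rightarrow> 'a set \<Rightarrow> bool" where
  "unital_ideal S I \<longleftrightarrow> ideal I S \<and> (\<exists>u\<in>I. \<forall>x\<in>I. u \<otimes>\<^bsub>S\<^esub> x = x)"

definition ideal_ring :: "('a, 'm) ring_scheme \<Rightarrow> 'a set \<Rightarrow> ('a, 'm) ring_scheme" where
  "ideal_ring S I = S\<lparr>carrier := I, one := ideal_ident S I\<rparr>"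

text \<open>The ideals \<open>S\<^sub>g\<close> are given by a family \<open>D\<close>, so that \<open>\<alpha> g\<close> maps
  \<open>D (g\<inverse>)\<close> onto \<open>D g\<close>; the values of \<open>\<alpha> g\<close> outside \<open>D (g\<inverse>)\<close> are irrelevant.\<close>

definition partial_ring_action ::
  "('g, 'l) monoid_scheme \<Rightarrow> ('a, 'm) ring_scheme \<Rightarrow> ('g \<Rightarrow> 'a set) \<Rightarrow> ('g \<Rightarrow> 'a \<Rightarrow> 'a) \<Rightarrow> bool" where
  "partial_ring_action G S D \<alpha> \<longleftrightarrow>
     group G \<and> finite (carrier G) \<and> cring S \<and>
     (\<forall>g\<in>carrier G. unital_ideal S (D g)) \<and>
     (\<forall>g\<in>carrier G. \<alpha> g \<in> ring_iso (ideal_ring S (D (inv\<^bsub>G\<^esub> g))) (ideal_ring S (D g))) \<and>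
     D \<one>\<^bsub>G\<^esub> = carrier S \<and> (\<forall>x\<in>carrier S. \<alpha> \<one>\<^bsub>G\<^esub> x = x) \<and>
     (\<forall>g\<in>carrier G. \<forall>h\<in>carrier G.
        \<alpha> g ` (D (inv\<^bsub>G\<^esub> g) \<inter> D h) = D g \<inter> D (g \<otimes>\<^bsub>G\<^esub> h)) \<and>
     (\<forall>g\<in>carrier G. \<forall>h\<in>carrier G. \<forall>x \<in> D (inv\<^bsub>G\<^esub> h) \<inter> D (inv\<^bsub>G\<^esub> (g \<otimes>\<^bsub>G\<^esub> h)).
        \<alpha> g (\<alpha> h x) = \<alpha> (g \<otimes>\<^bsub>G\<^esub> h) x)"

definition unital_partial_action ::
  "('k, 'n) ring_scheme \<Rightarrow> ('g, 'l) monoid_scheme \<Rightarrow> ('k, 'a, 'm) module_scheme \<Rightarrow>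
   ('g \<Rightarrow> 'a set) \<Rightarrow> ('g \<Rightarrow> 'a \<Rightarrow> 'a) \<Rightarrow> bool" where
  "unital_partial_action k G S D \<alpha> \<longleftrightarrow>
     algebra k S \<and> partial_ring_action G S D \<alpha> \<and>
     (\<forall>g\<in>carrier G. \<forall>c\<in>carrier k. \<forall>x \<in> D (inv\<^bsub>G\<^esub> g). \<alpha> g (c \<odot>\<^bsub>S\<^esub> x) = c \<odot>\<^bsub>S\<^esub> \<alpha> g x)"

text \<open>The condition \<open>\<alpha>\<^bsub>gh\<^esub> = \<alpha>\<^sub>g \<circ> \<alpha>\<^sub>h\<close> is an equality of partial maps, domains included;
  this forces \<open>D g = carrier S\<close> for all \<open>g\<close>.\<close>

definition global_partial_action ::
  "('g, 'l) monoid_scheme \<Rightarrow> ('g \<Rightarrow> 'a set) \<Rightarrow> ('g \<Rightarrow> 'a \<Rightarrow> 'a) \<Rightarrow> bool" where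
  "global_partial_action G D \<alpha> \<longleftrightarrow>
     (let a = (\<lambda>g. (Some \<circ> \<alpha> g) |` D (inv\<^bsub>G\<^esub> g))
      in \<forall>g\<in>carrier G. \<forall>h\<in>carrier G. a (g \<otimes>\<^bsub>G\<^esub> h) = a g \<circ>\<^sub>m a h)"

definition partial_invariants ::
  "('g, 'l) monoid_scheme \<Rightarrow> ('a, 'm) ring_scheme \<Rightarrow> ('g \<Rightarrow> 'a set) \<Rightarrow> ('g \<Rightarrow> 'a \<Rightarrow> 'a) \<Rightarrow> 'a set" where
  "partial_invariants G S D \<alpha> =
     {a \<in> carrier S. \<forall>g\<in>carrier G.
        \<alpha> g (a \<otimes>\<^bsub>S\<^esub> ideal_ident S (D (inv\<^bsub>G\<^esub> g))) = a \<otimes>\<^bsub>S\<^esub> ideal_ident S (D g)}"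

section \<open>Partial Galois and partial kummerian extensions\<close>

definition partial_galois_extension ::
  "('k, 'n) ring_scheme \<Rightarrow> ('g, 'l) monoid_scheme \<Rightarrow> ('k, 'a, 'm) module_scheme \<Rightarrow>
   ('g \<Rightarrow> 'a set) \<Rightarrow> ('g \<Rightarrow> 'a \<Rightarrow> 'a) \<Rightarrow> 'a set \<Rightarrow> bool" where
  "partial_galois_extension k G S D \<alpha> R \<longleftrightarrow>
     unital_partial_action k G S D \<alpha> \<and> subring R S \<and> R = partial_invariants G S D \<alpha> \<and>
     (\<exists>(l::nat) x y. x \<in> {1..l} \<rightarrow> carrier S \<and> y \<in> {1..l} \<rightarrow> carrier S \<and>
        (\<forall>g\<in>carrier G.
           (\<Oplus>\<^bsub>S\<^esub>i\<in>{1..l}. x i \<otimes>\<^bsub>S\<^esub> \<alpha> g (y i \<otimes>\<^bsub>S\<^esub> ideal_ident S (D (inv\<^bsub>G\<^esub> g)))) =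
           (if g = \<one>\<^bsub>G\<^esub> then \<one>\<^bsub>S\<^esub> else \<zero>\<^bsub>S\<^esub>)))"

definition galois_extension ::
  "('k, 'n) ring_scheme \<Rightarrow> ('g, 'l) monoid_scheme \<Rightarrow> ('k, 'a, 'm) module_scheme \<Rightarrow>
   ('g \<Rightarrow> 'a set) \<Rightarrow> ('g \<Rightarrow> 'a \<Rightarrow> 'a) \<Rightarrow> 'a set \<Rightarrow> bool" where
  "galois_extension k G S D \<alpha> R \<longleftrightarrow>
     partial_galois_extension k G S D \<alpha> R \<and> global_partial_action G D \<alpha>"

definition kummerian_root :: "nat \<Rightarrow> ('a, 'm) ring_scheme \<Rightarrow> 'a \<Rightarrow> bool" where
  "kummerian_root n R \<omega> \<longleftrightarrow>
     \<omega> \<in> Units R \<and> \<omega> [^]\<^bsub>R\<^esub> n = \<one>\<^bsub>R\<^esub> \<and>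
     (\<forall>i\<in>{1..n-1}. \<one>\<^bsub>R\<^esub> \<ominus>\<^bsub>R\<^esub> \<omega> [^]\<^bsub>R\<^esub> i \<in> Units R)"

definition kummerian_ring :: "nat \<Rightarrow> ('a, 'm) ring_scheme \<Rightarrow> bool" where
  "kummerian_ring n R \<longleftrightarrow> n \<ge> 2 \<and> cring R \<and> (\<exists>\<omega>. kummerian_root n R \<omega>)"

definition partial_kummerian_extension ::
  "nat \<Rightarrow> ('k, 'n) ring_scheme \<Rightarrow> ('g, 'l) monoid_scheme \<Rightarrow> ('k, 'a, 'm) module_scheme \<Rightarrow>
   ('g \<Rightarrow> 'a set) \<Rightarrow> ('g \<Rightarrow> 'a \<Rightarrow> 'a) \<Rightarrow> 'a set \<Rightarrow> bool" where
  "partial_kummerian_extension n k G S D \<alpha> R \<longleftrightarrow>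
     partial_galois_extension k G S D \<alpha> R \<and> comm_group G \<and> order G = n \<and>
     kummerian_ring n (S\<lparr>carrier := R\<rparr>)"

section \<open>Characters and cocycles\<close>

text \<open>Characters and cocycles are taken extensional, so that each of them is represented by
  exactly one HOL function; sums indexed by characters depend on this.\<close>

definition char_group ::
  "('g, 'l) monoid_scheme \<Rightarrow> ('a, 'm) ring_scheme \<Rightarrow> 'a \<Rightarrow> ('g \<Rightarrow> 'a) monoid" where
  "char_group G R \<omega> =
     \<lparr>carrier = hom G (subgroup_generated (units_of R) {\<omega>}) \<inter> extensional (carrier G),
      monoid.mult = (\<lambda>\<chi> \<eta>. \<lambda>g\<in>carrier G. \<chi> g \<otimes>\<^bsub>R\<^esub> \<eta> g),
      one = (\<lambda>g\<in>carrier G. \<one>\<^bsub>R\<^esub>)\<rparr>"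

definition cocycle_group ::
  "('g, 'l) monoid_scheme \<Rightarrow> ('a, 'm) ring_scheme \<Rightarrow> ('g \<Rightarrow> 'a set) \<Rightarrow> ('g \<Rightarrow> 'a \<Rightarrow> 'a) \<Rightarrow>
   ('g \<Rightarrow> 'a) monoid" where
  "cocycle_group G S D \<alpha> =
     \<lparr>carrier = {f \<in> extensional (carrier G).
        (\<forall>g\<in>carrier G. f g \<in> Units (ideal_ring S (D g))) \<and>
        (\<forall>g\<in>carrier G. \<forall>h\<in>carrier G.
           f (g \<otimes>\<^bsub>G\<^esub> h) \<otimes>\<^bsub>S\<^esub> ideal_ident S (D g) =
           f g \<otimes>\<^bsub>S\<^esub> \<alpha> g (f h \<otimes>\<^bsub>S\<^esub> ideal_ident S (D (inv\<^bsub>G\<^esub> g))))},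
      monoid.mult = (\<lambda>f f'. \<lambda>g\<in>carrier G. f g \<otimes>\<^bsub>S\<^esub> f' g),
      one = (\<lambda>g\<in>carrier G. ideal_ident S (D g))\<rparr>"

definition par_char ::
  "('g, 'l) monoid_scheme \<Rightarrow> ('a, 'm) ring_scheme \<Rightarrow> ('g \<Rightarrow> 'a set) \<Rightarrow> ('g \<Rightarrow> 'a) \<Rightarrow> 'g \<Rightarrow> 'a" where
  "par_char G S D \<chi> = (\<lambda>g\<in>carrier G. \<chi> g \<otimes>\<^bsub>S\<^esub> ideal_ident S (D g))"

definition cocycle_module ::
  "('g, 'l) monoid_scheme \<Rightarrow> ('a, 'm) ring_scheme \<Rightarrow> ('g \<Rightarrow> 'a set) \<Rightarrow> ('g \<Rightarrow> 'a \<Rightarrow> 'a) \<Rightarrow>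
   ('g \<Rightarrow> 'a) \<Rightarrow> 'a set" where
  "cocycle_module G S D \<alpha> f =
     {a \<in> carrier S. \<forall>g\<in>carrier G.
        \<alpha> g (a \<otimes>\<^bsub>S\<^esub> ideal_ident S (D (inv\<^bsub>G\<^esub> g))) = f g \<otimes>\<^bsub>S\<^esub> a}"

section \<open>Invertible submodules and sums of submodules\<close>

text \<open>The library predicate \<open>subalgebra R M S\<close> says only that \<open>M\<close> is an additive subgroup of \<open>S\<close>
  closed under multiplication by \<open>R\<close>, i.e. an \<open>R\<close>-submodule of \<open>S\<close>. Likewise \<open>ideal_prod S M N\<close>
  is, for arbitrary sets, the set of nonempty finite sums of products \<open>x y\<close>; for submodules the
  empty sum is the product \<open>0 0\<close>.\<close>

definition invertible_submodules :: "('a, 'm) ring_scheme \<Rightarrow> 'a set \<Rightarrow> 'a set monoid" where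
  "invertible_submodules S R =
     \<lparr>carrier = {M. subalgebra R M S \<and> (\<exists>N. subalgebra R N S \<and> ideal_prod S M N = R)},
      monoid.mult = ideal_prod S,
      one = R\<rparr>"

text \<open>Sum and directness of a finite family of additive subgroups; the latter is injectivity of the
  summation map on the direct sum (equal to the product, as the index set is finite).\<close>

definition family_sum :: "('a, 'm) ring_scheme \<Rightarrow> 'i set \<Rightarrow> ('i \<Rightarrow> 'a set) \<Rightarrow> 'a set" where
  "family_sum S I M = (\<lambda>m. \<Oplus>\<^bsub>S\<^esub>i\<in>I. m i) ` (\<Pi>\<^sub>E i\<in>I. M i)"

definition family_sum_direct :: "('a, 'm) ring_scheme \<Rightarrow> 'i set \<Rightarrow> ('i \<Rightarrow> 'a set) \<Rightarrow> bool" where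
  "family_sum_direct S I M \<longleftrightarrow> inj_on (\<lambda>m. \<Oplus>\<^bsub>S\<^esub>i\<in>I. m i) (\<Pi>\<^sub>E i\<in>I. M i)"

section \<open>Globalization\<close>

text \<open>The map \<open>\<iota>\<close> identifies \<open>S\<close> with an ideal of \<open>T\<close>; the identity of \<open>S\<close> need not be sent to
  that of \<open>T\<close>.\<close>

definition globalization ::
  "('g, 'l) monoid_scheme \<Rightarrow> ('a, 'm) ring_scheme \<Rightarrow> ('g \<Rightarrow> 'a set) \<Rightarrow> ('g \<Rightarrow> 'a \<Rightarrow> 'a) \<Rightarrow>
   ('b, 'p) ring_scheme \<Rightarrow> ('g \<Rightarrow> 'b \<Rightarrow> 'b) \<Rightarrow> ('a \<Rightarrow> 'b) \<Rightarrow> bool" where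
  "globalization G S D \<alpha> T \<beta> \<iota> \<longleftrightarrow>
     partial_ring_action G T (\<lambda>_. carrier T) \<beta> \<and> global_partial_action G (\<lambda>_. carrier T) \<beta> \<and>
     unital_ideal T (\<iota> ` carrier S) \<and> \<iota> \<in> ring_iso S (ideal_ring T (\<iota> ` carrier S)) \<and>
     (\<forall>g\<in>carrier G. \<iota> ` D g = \<iota> ` carrier S \<inter> \<beta> g ` \<iota> ` carrier S) \<and>
     (\<forall>g\<in>carrier G. \<forall>x \<in> D (inv\<^bsub>G\<^esub> g). \<iota> (\<alpha> g x) = \<beta> g (\<iota> x)) \<and>
     carrier T = family_sum T (carrier G) (\<lambda>g. \<beta> g ` \<iota> ` carrier S)"

definition invariants ::
  "('g, 'l) monoid_scheme \<Rightarrow> ('b, 'p) ring_scheme \<Rightarrow> ('g \<Rightarrow> 'b \<Rightarrow> 'b) \<Rightarrow> 'b set" where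
  "invariants G T \<beta> = {t \<in> carrier T. \<forall>g\<in>carrier G. \<beta> g t = t}"

text \<open>\<open>\<psi>\<close> is the inverse of the bijection \<open>x \<mapsto> x 1\<^sub>S\<close> from the invariants of \<open>T\<close> to those of \<open>S\<close>.\<close>

definition invariants_lift ::
  "('g, 'l) monoid_scheme \<Rightarrow> ('a, 'm) ring_scheme \<Rightarrow> ('b, 'p) ring_scheme \<Rightarrow> ('g \<Rightarrow> 'b \<Rightarrow> 'b) \<Rightarrow>
   ('a \<Rightarrow> 'b) \<Rightarrow> 'a \<Rightarrow> 'b" where
  "invariants_lift G S T \<beta> \<iota> =
     inv_into (invariants G T \<beta>) (\<lambda>x. inv_into (carrier S) \<iota> (x \<otimes>\<^bsub>T\<^esub> \<iota> \<one>\<^bsub>S\<^esub>))"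

definition lifted_char_module ::
  "('g, 'l) monoid_scheme \<Rightarrow> ('a, 'm) ring_scheme \<Rightarrow> ('b, 'p) ring_scheme \<Rightarrow> ('g \<Rightarrow> 'b \<Rightarrow> 'b) \<Rightarrow>
   ('a \<Rightarrow> 'b) \<Rightarrow> ('g \<Rightarrow> 'a) \<Rightarrow> 'b set" where
  "lifted_char_module G S T \<beta> \<iota> \<chi> =
     {b \<in> carrier T. \<forall>g\<in>carrier G. \<beta> g b = invariants_lift G S T \<beta> \<iota> (\<chi> g) \<otimes>\<^bsub>T\<^esub> b}"

end

theory Submission
  imports Defs "HOL-Number_Theory.Cong"
begin

text \<open>Each partial isomorphism \<open>\<alpha>\<^sub>g\<close> extends to a total map \<open>A\<^sub>g a = \<alpha>\<^sub>g (a 1\<^bsub>g\<inverse>\<^esub>)\<close> of \<open>S\<close>, and the axioms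
of a unital partial action turn into identities between total maps: \<open>A\<^sub>g\<close> is additive and
multiplicative, \<open>A\<^sub>g 1 = 1\<^sub>g\<close>, \<open>A\<^sub>e = id\<close> and \<open>A\<^sub>g A\<^sub>h a = A\<^bsub>gh\<^esub> a 1\<^sub>g\<close>
(\<open>act_act\<close>). Invariants, cocycles and the modules \<open>Q\<^sub>f\<close> are all described by these maps, so
that one can average over \<open>G\<close> as for a global action. Two ingredients make averaging effective.

The first is arithmetic. Every character of a subgroup of \<open>G\<close> with values in
\<open>\<int>/n\<close> extends to \<open>G\<close>, because \<open>n\<close> is the order of \<open>G\<close>; hence characters with values in
\<open>\<langle>\<omega>\<rangle>\<close> separate the points of \<open>G\<close> (\<open>separating_residue_character\<close>). As the differences
\<open>1 - \<omega>\<^sup>i\<close> are units, the usual translation argument gives the two orthogonality relations over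
the ring \<open>R\<close>, and \<open>1 + x + \<dots> + x\<^bsup>n-1\<^esup> = \<Prod>(x - \<omega>\<^sup>i)\<close> at \<open>x = 1\<close> shows that \<open>n\<close> is a
unit (\<open>root_order_unit\<close>). Inverting \<open>n\<close>
decomposes any \<open>a\<close> as \<open>n\<inverse> \<Sum>\<^sub>\<chi> t\<^sub>\<chi> a\<close>, where the twisted trace
\<open>t\<^sub>\<chi> a = \<Sum>\<^sub>g \<chi>(g\<inverse>) A\<^sub>g a\<close> lies in \<open>Q\<^sub>\<chi>\<close>; this is \<open>S = \<Sum> Q\<^sub>\<chi>\<close>.

The second is the Galois condition. It makes \<open>x\<^sub>i\<close> and \<open>tr (y\<^sub>i \<cdot>)\<close> a dual basis of \<open>S\<close> over
\<open>R\<close>, so \<open>S\<close> is finitely generated with \<open>S = tr(S) S\<close>, and Nakayama's argument gives an element \<open>c\<close>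
of trace 1 (\<open>trace_surj\<close>). Since \<open>\<Sum>\<^sub>i A\<^sub>g x\<^sub>i A\<^sub>h y\<^sub>i = \<delta>\<^bsub>g,h\<^esub> 1\<^sub>g\<close>, one then finds
\<open>\<Sum>\<^sub>i t\<^sub>\<chi>(c x\<^sub>i) t\<^bsub>\<chi>\<inverse>\<^esub>(y\<^sub>i) = 1\<close> (\<open>twisted_traces_generate_one\<close>). Thus \<open>Q\<^sub>\<chi>\<close> and
\<open>Q\<^bsub>\<chi>\<inverse>\<^esub>\<close> are inverse to each other, and \<open>Q\<^sub>\<chi> Q\<^sub>\<eta> = Q\<^bsub>\<chi>\<eta>\<^esub>\<close> follows formally.

For directness, a global action allows each component to be recovered from the sum by a
twisted trace. Conversely, if the sum is direct, then for each \<open>h\<close> there is an \<open>R\<close>-linear map \<open>L\<close> of \<open>S\<close>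
that acts on every \<open>Q\<^sub>\<chi>\<close> as the scalar \<open>\<chi>(h)\<close>. Expressing \<open>L\<close> by the dual basis gives
elements \<open>C\<^sub>g = \<Sum>\<^sub>i L(x\<^sub>i) A\<^sub>g y\<^sub>i\<close> of \<open>S\<^sub>g\<close> with \<open>\<Sum>\<^sub>g \<chi>(g) C\<^sub>g = \<chi>(h)\<close> for all
\<open>\<chi>\<close>, and orthogonality forces \<open>C\<^sub>h = 1\<close>; as \<open>C\<^sub>h\<close> lies in \<open>S\<^sub>h\<close>, this ideal is all of \<open>S\<close>
(\<open>direct_imp_global\<close>).

For a globalization, \<open>r \<in> R\<close> is lifted to \<open>T\<^sup>G\<close> by gluing the translates \<open>\<beta>\<^sub>g r\<close> along the ideals
\<open>\<beta>\<^sub>g(S)\<close>, on whose intersections they agree (\<open>glue_translates\<close>); hence \<open>\<psi>(r) 1\<^sub>S = r\<close>,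
and the eigenvalue equation in \<open>T\<close> restricts to the one in \<open>S\<close>.\<close>

section \<open>Sums and monic polynomials in a commutative ring\<close>

lemma (in abelian_monoid) finsum_swap:
  assumes "finite A" "finite B" "\<And>i j. i \<in> A \<Longrightarrow> j \<in> B \<Longrightarrow> f i j \<in> carrier G"
  shows "(\<Oplus>i\<in>A. \<Oplus>j\<in>B. f i j) = (\<Oplus>j\<in>B. \<Oplus>i\<in>A. f i j)"
  using assms
proof (induction A rule: finite_induct)
  case empty
  then show ?case by simp
next
  case (insert a A)
  then have f: "\<And>i j. i \<in> A \<Longrightarrow> j \<in> B \<Longrightarrow> f i j \<in> carrier G" "\<And>j. j \<in> B \<Longrightarrow> f a j \<in> carrier G"
    by auto
  have "(\<Oplus>i\<in>insert a A. \<Oplus>j\<in>B. f i j) = (\<Oplus>j\<in>B. f a j) \<oplus> (\<Oplus>j\<in>B. \<Oplus>i\<in>A. f i j)"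
    using insert f by (simp add: Pi_def)
  also have "\<dots> = (\<Oplus>j\<in>B. f a j \<oplus> (\<Oplus>i\<in>A. f i j))"
    using f insert.hyps by (simp add: Pi_def)
  also have "\<dots> = (\<Oplus>j\<in>B. \<Oplus>i\<in>insert a A. f i j)"
    using f insert.hyps insert.prems by (intro finsum_cong') (auto simp: Pi_def)
  finally show ?case .
qed

lemma (in abelian_monoid) finsum_delta:
  assumes "finite A" "a \<in> A" "f a \<in> carrier G"
  shows "(\<Oplus>i\<in>A. if i = a then f i else \<zero>) = f a"
proof -
  have "(\<Oplus>i\<in>A. if i = a then f i else \<zero>) = (\<Oplus>i\<in>insert a (A - {a}). if i = a then f i else \<zero>)"
    using assms(2) by (simp add: insert_absorb)
  also have "\<dots> = f a \<oplus> (\<Oplus>i\<in>A - {a}. if i = a then f i else \<zero>)"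
    using assms by (subst finsum_insert) (auto simp: Pi_def)
  also have "(\<Oplus>i\<in>A - {a}. if i = a then f i else \<zero>) = \<zero>"
    by (rule add.finprod_one_eqI) auto
  finally show ?thesis using assms by simp
qed

text \<open>The coefficients of degree less than \<open>length cs\<close> are listed from the constant term upwards; the
leading coefficient 1 is not listed, so the list alone determines a monic polynomial.\<close>

definition monic_eval :: "('a, 'm) ring_scheme \<Rightarrow> 'a list \<Rightarrow> 'a \<Rightarrow> 'a" where
  "monic_eval R cs x = foldr (\<lambda>c v. c \<oplus>\<^bsub>R\<^esub> x \<otimes>\<^bsub>R\<^esub> v) cs \<one>\<^bsub>R\<^esub>"

context cring begin

lemma monic_eval_Nil [simp]: "monic_eval R [] x = \<one>"
  and monic_eval_Cons [simp]: "monic_eval R (c # cs) x = c \<oplus> x \<otimes> monic_eval R cs x"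
  by (simp_all add: monic_eval_def)

lemma monic_eval_closed [simp]:
  "set cs \<subseteq> carrier R \<Longrightarrow> x \<in> carrier R \<Longrightarrow> monic_eval R cs x \<in> carrier R"
  by (induction cs) auto

text \<open>Synthetic division by \<open>x - b\<close>. The quotient is again monic, so that roots can be split off one
after the other.\<close>

lemma monic_eval_diff:
  assumes "set cs \<subseteq> carrier R" "length cs = Suc d" "b \<in> carrier R"
  shows "\<exists>ds. set ds \<subseteq> carrier R \<and> length ds = d \<and>
    (\<forall>x\<in>carrier R. monic_eval R cs x \<ominus> monic_eval R cs b = (x \<ominus> b) \<otimes> monic_eval R ds x)"
  using assms
proof (induction cs arbitrary: d)
  case Nil
  then show ?case by simp
next
  case (Cons c cs)
  show ?case
  proof (cases cs)
    case Nil
    have "monic_eval R (c # cs) x \<ominus> monic_eval R (c # cs) b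
        = (x \<ominus> b) \<otimes> monic_eval R [] x" if "x \<in> carrier R" for x
      using that Nil Cons.prems by simp algebra
    then show ?thesis using Nil Cons.prems by (intro exI[of _ "[]"]) auto
  next
    case (Cons c' cs')
    then obtain d' where d: "d = Suc d'" "length cs = Suc d'" using Cons.prems by auto
    obtain ds where ds: "set ds \<subseteq> carrier R" "length ds = d'"
      "\<And>x. x\<in>carrier R \<Longrightarrow> monic_eval R cs x \<ominus> monic_eval R cs b = (x \<ominus> b) \<otimes> monic_eval R ds x"
      using Cons.IH[of d'] Cons.prems d by auto
    have "monic_eval R (c # cs) x \<ominus> monic_eval R (c # cs) b
        = (x \<ominus> b) \<otimes> monic_eval R (monic_eval R cs b # ds) x" if x: "x \<in> carrier R" for x
    proof -
      have cl: "c \<in> carrier R" "b \<in> carrier R" "x \<in> carrier R" "monic_eval R cs x \<in> carrier R"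
        "monic_eval R cs b \<in> carrier R" "monic_eval R ds x \<in> carrier R"
        using Cons.prems x ds by auto
      have "monic_eval R (c # cs) x \<ominus> monic_eval R (c # cs) b
          = (x \<ominus> b) \<otimes> monic_eval R cs b \<oplus> x \<otimes> (monic_eval R cs x \<ominus> monic_eval R cs b)"
        using cl by simp algebra
      also have "\<dots> = (x \<ominus> b) \<otimes> monic_eval R (monic_eval R cs b # ds) x"
        unfolding ds(3)[OF x] using cl by simp algebra
      finally show ?thesis .
    qed
    then show ?thesis using ds d Cons.prems
      by (intro exI[of _ "monic_eval R cs b # ds"]) auto
  qed
qed

text \<open>A monic polynomial of degree \<open>d\<close> with \<open>d\<close> roots whose pairwise differences are units is the product
of the corresponding linear factors: dividing by one factor, the other roots remain roots of the
quotient because the differences can be cancelled. So its value is a unit wherever all these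
factors are.\<close>

lemma monic_eval_unit:
  assumes "set cs \<subseteq> carrier R" "length cs = length as" "set as \<subseteq> carrier R"
    and "\<And>a. a \<in> set as \<Longrightarrow> monic_eval R cs a = \<zero>"
    and "sorted_wrt (\<lambda>a b. b \<ominus> a \<in> Units R) as"
    and "x \<in> carrier R" "\<And>a. a \<in> set as \<Longrightarrow> x \<ominus> a \<in> Units R"
  shows "monic_eval R cs x \<in> Units R"
  using assms
proof (induction as arbitrary: cs)
  case Nil
  then show ?case by simp
next
  case (Cons b as)
  then have b: "b \<in> carrier R" "monic_eval R cs b = \<zero>" by auto
  obtain ds where ds: "set ds \<subseteq> carrier R" "length ds = length as"
      "\<And>x. x\<in>carrier R \<Longrightarrow> monic_eval R cs x \<ominus> monic_eval R cs b = (x \<ominus> b) \<otimes> monic_eval R ds x"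
    using monic_eval_diff[of cs "length as" b] Cons.prems by auto
  have ev: "monic_eval R cs y = (y \<ominus> b) \<otimes> monic_eval R ds y" if "y \<in> carrier R" for y
    using ds(3)[OF that] that b Cons.prems by (simp add: a_minus_def)
  have "monic_eval R ds a = \<zero>" if a: "a \<in> set as" for a
  proof -
    have "a \<ominus> b \<in> Units R" "a \<in> carrier R" using Cons.prems a by auto
    moreover from this have "(a \<ominus> b) \<otimes> monic_eval R ds a = \<zero>"
      using ev[of a] Cons.prems(4)[of a] a by simp
    then have "(a \<ominus> b) \<otimes> monic_eval R ds a = (a \<ominus> b) \<otimes> \<zero>"
      using \<open>a \<ominus> b \<in> Units R\<close> by (simp add: Units_closed)
    ultimately show ?thesis using ds by (metis Units_l_cancel monic_eval_closed zero_closed)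
  qed
  then have "monic_eval R ds x \<in> Units R" using Cons ds by auto
  then show ?case using ev Cons.prems by auto
qed

lemma monic_eval_ones:
  assumes "x \<in> carrier R"
  shows "(x \<ominus> \<one>) \<otimes> monic_eval R (replicate m \<one>) x = x [^] Suc m \<ominus> \<one>"
proof (induction m)
  case 0
  then show ?case using assms by simp
next
  case (Suc m)
  have cl: "monic_eval R (replicate m \<one>) x \<in> carrier R" "x [^] Suc m \<in> carrier R"
    using assms by (auto intro!: monic_eval_closed)
  have "(x \<ominus> \<one>) \<otimes> monic_eval R (replicate (Suc m) \<one>) x
     = (x \<ominus> \<one>) \<oplus> x \<otimes> ((x \<ominus> \<one>) \<otimes> monic_eval R (replicate m \<one>) x)"
    using assms cl by simp algebra
  also have "\<dots> = x [^] Suc (Suc m) \<ominus> \<one>"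
    unfolding Suc nat_pow_Suc2[OF assms, of "Suc m"] using assms cl by algebra
  finally show ?case .
qed

lemma monic_eval_ones_one: "monic_eval R (replicate m \<one>) \<one> = add_pow R (Suc m) \<one>"
  by (induction m) (auto simp: add.nat_pow_Suc2 a_comm)

lemma unit_of_finite_order:
  assumes w: "w \<in> carrier R" "w [^] (n::nat) = \<one>" and n: "n > 0"
  shows "w \<in> Units R"
proof -
  have "w [^] (n - 1) \<otimes> w = \<one>" using w n nat_pow_Suc[of w "n - 1"] by simp
  moreover from this have "w \<otimes> w [^] (n - 1) = \<one>"
    using m_comm[OF nat_pow_closed[OF w(1)] w(1)] by simp
  ultimately show ?thesis
    using w(1) nat_pow_closed[OF w(1), of "n - 1"] unfolding Units_def by blast
qed

text \<open>Over a field this says that the characteristic does not divide \<open>n\<close>. In general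
\<open>1 + x + \<dots> + x\<^bsup>n-1\<^esup>\<close> has the \<open>n - 1\<close> roots \<open>w, \<dots>, w\<^bsup>n-1\<^esup>\<close> with unit differences, so its
value \<open>n\<close> at 1 is a product of units.\<close>

lemma root_order_unit:
  fixes n :: nat
  assumes w: "w \<in> carrier R" "w [^] n = \<one>" and n: "n > 0"
    and u: "\<And>i. 0 < i \<Longrightarrow> i < n \<Longrightarrow> \<one> \<ominus> w [^] i \<in> Units R"
  shows "add_pow R n \<one> \<in> Units R"
proof -
  have w': "w \<in> Units R" by (rule unit_of_finite_order[OF w n])
  define as where "as = map (\<lambda>i. w [^] i) [1..<n]"
  have minus: "a \<ominus> b \<in> Units R" if "b \<ominus> a \<in> Units R" "a \<in> carrier R" "b \<in> carrier R" for a b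
  proof -
    have "a \<ominus> b = (\<ominus> \<one>) \<otimes> (b \<ominus> a)" using that(2,3) by algebra
    then show ?thesis using that(1) by (simp add: Units_minus_one_closed)
  qed
  have "monic_eval R (replicate (n-1) \<one>) \<one> \<in> Units R"
  proof (rule monic_eval_unit[where as = as])
    show "set as \<subseteq> carrier R" using w by (auto simp: as_def)
    show "\<one> \<ominus> a \<in> Units R" if "a \<in> set as" for a using that u by (auto simp: as_def)
    show "monic_eval R (replicate (n - 1) \<one>) a = \<zero>" if a: "a \<in> set as" for a
    proof -
      have ac: "a \<in> carrier R" using a w by (auto simp: as_def)
      obtain i where i: "a = w [^] i" "0 < i" "i < n"
        using a unfolding as_def set_map by fastforce
      then have "a [^] n = (w [^] n) [^] i" using w by (metis nat_pow_pow mult.commute)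
      then have "a [^] Suc (n - 1) = \<one>" using w n by simp
      then have "(a \<ominus> \<one>) \<otimes> monic_eval R (replicate (n - 1) \<one>) a = (a \<ominus> \<one>) \<otimes> \<zero>"
        using monic_eval_ones[OF ac, of "n-1"] ac by (simp add: a_minus_def r_neg)
      moreover have "a \<ominus> \<one> \<in> Units R"
        using minus[OF _ ac one_closed] u[OF i(2,3)] i(1) by simp
      moreover have "monic_eval R (replicate (n - 1) \<one>) a \<in> carrier R"
        using ac by (intro monic_eval_closed) auto
      ultimately show ?thesis using Units_l_cancel zero_closed by blast
    qed
    have "w [^] j \<ominus> w [^] i \<in> Units R" if ij: "0 < i" "i < j" "j < n" for i j
    proof -
      have "w [^] j = w [^] i \<otimes> w [^] (j - i)" using w(1) ij by (simp add: nat_pow_mult)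
      then have "w [^] i \<ominus> w [^] j = w [^] i \<otimes> (\<one> \<ominus> w [^] (j - i))" 
        using w(1) by (simp add: a_minus_def r_distr r_minus)
      then have "w [^] i \<ominus> w [^] j \<in> Units R" using u[of "j-i"] ij w' by (simp add: Units_pow_closed)
      then show ?thesis using minus w(1) by simp
    qed
    then show "sorted_wrt (\<lambda>a b. b \<ominus> a \<in> Units R) as"
      unfolding as_def sorted_wrt_map
      by (intro sorted_wrt_mono_rel[OF _ sorted_wrt_upt]) auto
  qed (auto simp: as_def)
  then show ?thesis using n by (simp add: monic_eval_ones_one)
qed

text \<open>Nakayama's lemma in the form \<open>M = I M \<Longrightarrow> (1 - i) M = 0\<close> for some \<open>i \<in> I\<close>. Instead of a determinant,
the generators are eliminated one by one. The unit factor \<open>u\<close> on the left of the relations is what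
survives elimination: solving the relation for \<open>x k\<close> multiplies the others by
\<open>u - a k k\<close>, which is again congruent to 1 modulo \<open>I\<close>.\<close>

lemma annihilator_of_generators:
  assumes I: "I \<subseteq> carrier R" "\<zero> \<in> I" "\<And>a b. a \<in> I \<Longrightarrow> b \<in> I \<Longrightarrow> a \<oplus> b \<in> I"
      "\<And>a. a \<in> I \<Longrightarrow> \<ominus> a \<in> I" "\<And>a b. a \<in> I \<Longrightarrow> b \<in> I \<Longrightarrow> a \<otimes> b \<in> I"
    and F: "finite F" "\<And>i. i \<in> F \<Longrightarrow> x i \<in> carrier R"
    and a: "\<And>i j. i \<in> F \<Longrightarrow> j \<in> F \<Longrightarrow> a j i \<in> I"
    and u: "u \<in> carrier R" "\<one> \<ominus> u \<in> I"
    and rel: "\<And>j. j \<in> F \<Longrightarrow> u \<otimes> x j = (\<Oplus>i\<in>F. a j i \<otimes> x i)"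
  shows "\<exists>v\<in>carrier R. \<one> \<ominus> v \<in> I \<and> (\<forall>j\<in>F. v \<otimes> x j = \<zero>)"
  using F a u rel
proof (induction F arbitrary: a u rule: finite_induct)
  case empty
  show ?case using I by (intro bexI[of _ \<one>]) (auto simp: a_minus_def r_neg)
next
  case (insert k F)
  have Ic: "a \<in> carrier R" if "a \<in> I" for a using that I by auto
  have one_closed_mult: "p \<otimes> c \<in> I" if "p \<in> carrier R" "\<one> \<ominus> p \<in> I" "c \<in> I" for p c
  proof -
    have "p \<otimes> c = c \<oplus> \<ominus> ((\<one> \<ominus> p) \<otimes> c)" using that Ic by algebra
    then show ?thesis using that I by auto
  qed
  have one_mult: "\<one> \<ominus> p \<otimes> q \<in> I" if "p \<in> carrier R" "\<one> \<ominus> p \<in> I" "q \<in> carrier R" "\<one> \<ominus> q \<in> I" for p q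
  proof -
    have "\<one> \<ominus> p \<otimes> q = (\<one> \<ominus> p) \<oplus> p \<otimes> (\<one> \<ominus> q)" using that by algebra
    then show ?thesis using that I one_closed_mult by auto
  qed
  have xc: "\<And>i. i \<in> F \<Longrightarrow> x i \<in> carrier R" "x k \<in> carrier R" using insert by auto
  have ac: "\<And>i j. i \<in> insert k F \<Longrightarrow> j \<in> insert k F \<Longrightarrow> a j i \<in> carrier R" using insert.prems(2) Ic by auto
  define w where "w = u \<ominus> a k k"
  have w: "w \<in> carrier R" "\<one> \<ominus> w \<in> I"
  proof -
    show wc: "w \<in> carrier R" using insert.prems ac by (auto simp: w_def)
    have "\<one> \<ominus> w = (\<one> \<ominus> u) \<oplus> a k k" unfolding w_def using insert.prems ac[of k k] by simp algebra
    then show "\<one> \<ominus> w \<in> I" using insert.prems I by auto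
  qed
  define r where "r j = (\<Oplus>i\<in>F. a j i \<otimes> x i)" for j
  have rc: "r j \<in> carrier R" if "j \<in> insert k F" for j unfolding r_def using that ac xc by (auto intro!: finsum_closed)
  have rel: "u \<otimes> x j = a j k \<otimes> x k \<oplus> r j" if "j \<in> insert k F" for j
    using insert.prems(5)[OF that] insert.hyps xc ac that by (simp add: r_def Pi_def)
  have wk: "w \<otimes> x k = r k"
  proof -
    have cl: "u \<in> carrier R" "a k k \<in> carrier R" "x k \<in> carrier R" "r k \<in> carrier R"
      using insert.prems ac[of k k] xc rc[of k] by auto
    have "w \<otimes> x k = u \<otimes> x k \<ominus> a k k \<otimes> x k" unfolding w_def using cl by algebra
    also have "\<dots> = a k k \<otimes> x k \<oplus> r k \<ominus> a k k \<otimes> x k" using rel[of k] by simp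
    finally show ?thesis using cl by algebra
  qed
  have "\<exists>v\<in>carrier R. \<one> \<ominus> v \<in> I \<and> (\<forall>j\<in>F. v \<otimes> x j = \<zero>)"
  proof (rule insert.IH[of "\<lambda>j i. w \<otimes> a j i \<oplus> a j k \<otimes> a k i" "w \<otimes> u"])
    show "w \<otimes> u \<in> carrier R" "\<one> \<ominus> w \<otimes> u \<in> I" using w insert.prems one_mult by auto
    show "w \<otimes> a j i \<oplus> a j k \<otimes> a k i \<in> I" if "i \<in> F" "j \<in> F" for i j
      using that insert.prems(2) I w one_closed_mult by auto
    fix j assume j: "j \<in> F"
    have "(w \<otimes> u) \<otimes> x j = w \<otimes> (u \<otimes> x j)" using w insert.prems j by (simp add: m_assoc)
    also have "\<dots> = w \<otimes> r j \<oplus> a j k \<otimes> (w \<otimes> x k)"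
      using rel[of j] w j ac[of k j] xc rc[of j] by simp algebra
    also have "\<dots> = (\<Oplus>i\<in>F. w \<otimes> (a j i \<otimes> x i)) \<oplus> (\<Oplus>i\<in>F. a j k \<otimes> (a k i \<otimes> x i))"
      unfolding wk r_def using w j ac xc insert.hyps by (simp add: finsum_rdistr Pi_def)
    also have "\<dots> = (\<Oplus>i\<in>F. w \<otimes> (a j i \<otimes> x i) \<oplus> a j k \<otimes> (a k i \<otimes> x i))"
      using w j ac xc by (simp add: Pi_def)
    also have "\<dots> = (\<Oplus>i\<in>F. (w \<otimes> a j i \<oplus> a j k \<otimes> a k i) \<otimes> x i)"
      using w j ac xc by (intro finsum_cong') (auto simp: l_distr m_assoc)
    finally show "(w \<otimes> u) \<otimes> x j = (\<Oplus>i\<in>F. (w \<otimes> a j i \<oplus> a j k \<otimes> a k i) \<otimes> x i)" .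
  qed (use insert in auto)
  then obtain v where v: "v \<in> carrier R" "\<one> \<ominus> v \<in> I" "\<And>j. j \<in> F \<Longrightarrow> v \<otimes> x j = \<zero>" by auto
  have "(v \<otimes> w) \<otimes> x j = \<zero>" if j: "j \<in> insert k F" for j
  proof (cases "j = k")
    case True
    have "(v \<otimes> w) \<otimes> x k = v \<otimes> r k" using v w xc wk by (simp add: m_assoc)
    also have "\<dots> = (\<Oplus>i\<in>F. v \<otimes> (a k i \<otimes> x i))"
      unfolding r_def using v ac xc insert.hyps by (simp add: finsum_rdistr Pi_def)
    also have "\<dots> = \<zero>"
      using v ac xc by (intro add.finprod_one_eqI) (auto simp: m_lcomm[of v])
    finally show ?thesis using True by simp
  next
    case False
    then have "j \<in> F" using j by auto
    then have "(v \<otimes> w) \<otimes> x j = w \<otimes> (v \<otimes> x j)" using v(1) w(1) xc(1) by (simp add: m_ac)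
    then show ?thesis using v \<open>j \<in> F\<close> w by simp
  qed
  then show ?case using v w one_mult by (intro bexI[of _ "v \<otimes> w"]) auto
qed

end

section \<open>Extending characters of finite abelian groups\<close>

text \<open>Homomorphisms to \<open>\<int>/n\<close>, represented by arbitrary lifts of their values to the natural numbers.\<close>

definition residue_character_on ::
  "('g, 'l) monoid_scheme \<Rightarrow> nat \<Rightarrow> 'g set \<Rightarrow> ('g \<Rightarrow> nat) \<Rightarrow> bool" where
  "residue_character_on G n H \<kappa> \<longleftrightarrow>
     (\<forall>h\<in>H. \<forall>h'\<in>H. [\<kappa> (h \<otimes>\<^bsub>G\<^esub> h') = \<kappa> h + \<kappa> h'] (mod n))"

lemma residue_character_onD:
  "residue_character_on G n H \<kappa> \<Longrightarrow> h \<in> H \<Longrightarrow> h' \<in> H \<Longrightarrow> [\<kappa> (h \<otimes>\<^bsub>G\<^esub> h') = \<kappa> h + \<kappa> h'] (mod n)"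
  by (simp add: residue_character_on_def)

lemma (in group) subgroup_nat_pow_closed:
  assumes "subgroup H G" "h \<in> H"
  shows "h [^] (q::nat) \<in> H"
  by (induction q) (auto simp: assms subgroup.one_closed subgroup.m_closed)

context comm_group begin

lemma residue_character_one:
  assumes "residue_character_on G n H \<kappa>" "subgroup H G"
  shows "[\<kappa> \<one> = 0] (mod n)"
proof -
  have "[\<kappa> (\<one> \<otimes> \<one>) = \<kappa> \<one> + \<kappa> \<one>] (mod n)"
    using assms by (intro residue_character_onD) (auto simp: subgroup.one_closed)
  then have "[\<kappa> \<one> + \<kappa> \<one> = \<kappa> \<one> + 0] (mod n)" by (simp add: cong_sym)
  then show ?thesis by (simp only: cong_add_lcancel_nat)
qed

lemma residue_character_pow:
  assumes "residue_character_on G n H \<kappa>" "subgroup H G" "h \<in> H"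
  shows "[\<kappa> (h [^] (q::nat)) = q * \<kappa> h] (mod n)"
proof (induction q)
  case 0
  then show ?case using residue_character_one[OF assms(1,2)] by simp
next
  case (Suc q)
  have "h [^] q \<in> H" using assms by (simp add: subgroup.mem_carrier subgroup_nat_pow_closed)
  then have "[\<kappa> (h [^] q \<otimes> h) = \<kappa> (h [^] q) + \<kappa> h] (mod n)"
    using assms by (intro residue_character_onD)
  moreover have "[\<kappa> (h [^] q) + \<kappa> h = q * \<kappa> h + \<kappa> h] (mod n)"
    using Suc by (intro cong_add) auto
  ultimately show ?case by (auto simp: add.commute dest: cong_trans)
qed

lemma least_power_in_subgroup:
  assumes "finite (carrier G)" "subgroup H G" "x \<in> carrier G"
  obtains m :: nat where "m > 0" "x [^] m \<in> H" "\<And>i. x [^] i \<in> H \<Longrightarrow> m dvd i"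
proof -
  define m where "m = (LEAST m::nat. m > 0 \<and> x [^] m \<in> H)"
  have "order G > 0" using assms(1) by (simp add: order_gt_0_iff_finite)
  moreover have "x [^] order G \<in> H" using assms by (simp add: pow_order_eq_1 subgroup.one_closed)
  ultimately have m: "m > 0 \<and> x [^] m \<in> H" unfolding m_def by (intro LeastI[where P = "\<lambda>m. m > 0 \<and> x [^] m \<in> H"]) auto
  have "m dvd i" if "x [^] i \<in> H" for i :: nat
  proof -
    have xc: "x [^] j \<in> carrier G" for j :: nat using assms by simp
    have i_eq: "x [^] i = (x [^] m) [^] (i div m) \<otimes> x [^] (i mod m)"
      using assms(3) by (simp add: nat_pow_pow nat_pow_mult)
    have p: "(x [^] m) [^] (i div m) \<in> H" using m assms(2) by (simp add: subgroup_nat_pow_closed)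
    have "inv ((x [^] m) [^] (i div m)) \<otimes> x [^] i = x [^] (i mod m)"
      unfolding i_eq using xc assms(3) by (simp flip: m_assoc)
    then have "x [^] (i mod m) \<in> H"
      using subgroup.m_closed[OF assms(2) subgroup.m_inv_closed[OF assms(2) p] that] by simp
    then have "\<not> i mod m > 0"
      using m not_less_Least[of "i mod m" "\<lambda>m. m > 0 \<and> x [^] m \<in> H"] unfolding m_def[symmetric] by auto
    then show ?thesis by auto
  qed
  then show thesis using m that by blast
qed

text \<open>A character \<open>\<kappa>\<close> of \<open>H\<close> extends to the subgroup generated by \<open>H\<close> and \<open>x\<close> with \<open>x \<mapsto> c\<close> as soon as
\<open>c\<close> respects the single relation that \<open>x\<close> satisfies over \<open>H\<close>, namely \<open>x\<^sup>m \<in> H\<close>: two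
expressions for the same element differ by a power of that relation.\<close>

lemma residue_character_well_defined:
  assumes \<kappa>: "residue_character_on G n H \<kappa>" and H: "subgroup H G" and x: "x \<in> carrier G"
    and m: "x [^] (m::nat) \<in> H" "\<And>i::nat. x [^] i \<in> H \<Longrightarrow> m dvd i"
    and c: "[m * c = \<kappa> (x [^] m)] (mod n)"
    and h: "h \<in> H" "h' \<in> H" and eq: "h \<otimes> x [^] (i::nat) = h' \<otimes> x [^] (j::nat)" and ij: "i \<le> j"
  shows "[\<kappa> h + i * c = \<kappa> h' + j * c] (mod n)"
proof -
  have hc: "h \<in> carrier G" "h' \<in> carrier G" using h H by (auto simp: subgroup.mem_carrier)
  have "h \<otimes> x [^] i = (h' \<otimes> x [^] (j - i)) \<otimes> x [^] i"
    using eq ij x hc by (simp add: m_assoc nat_pow_mult)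
  then have h_eq: "h = h' \<otimes> x [^] (j - i)" using x hc by simp
  then have "x [^] (j - i) = inv h' \<otimes> h" using x hc by (simp add: inv_solve_left)
  then have xH: "x [^] (j - i) \<in> H" using h H by (simp add: subgroup.m_closed subgroup.m_inv_closed)
  then obtain q where q: "j - i = m * q" using m by (auto elim: dvdE)
  have "[\<kappa> (x [^] (j - i)) = q * \<kappa> (x [^] m)] (mod n)"
    using residue_character_pow[OF \<kappa> H m(1), of q] x by (simp add: q nat_pow_pow)
  moreover have "[q * \<kappa> (x [^] m) = q * (m * c)] (mod n)"
    using c by (intro cong_mult) (auto simp: cong_sym)
  ultimately have "[\<kappa> (x [^] (j - i)) = (j - i) * c] (mod n)"
    by (metis cong_trans q mult.assoc mult.commute)
  moreover have "[\<kappa> h = \<kappa> h' + \<kappa> (x [^] (j - i))] (mod n)"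
    using residue_character_onD[OF \<kappa> h(2) xH] h_eq by simp
  ultimately have "[\<kappa> h = \<kappa> h' + (j - i) * c] (mod n)"
    by (metis cong_trans cong_add_lcancel_nat)
  then have "[\<kappa> h + i * c = \<kappa> h' + (j - i) * c + i * c] (mod n)"
    by (intro cong_add) auto
  moreover have "(j - i) * c + i * c = j * c" using ij by (simp flip: add_mult_distrib)
  ultimately show ?thesis by (simp add: add.assoc)
qed

lemma extend_residue_character:
  assumes fin: "finite (carrier G)" and \<kappa>: "residue_character_on G n H \<kappa>" and H: "subgroup H G"
    and x: "x \<in> carrier G"
    and m: "x [^] (m::nat) \<in> H" "\<And>i::nat. x [^] i \<in> H \<Longrightarrow> m dvd i"
    and c: "[m * c = \<kappa> (x [^] m)] (mod n)"
  obtains H' \<kappa>' where "subgroup H' G" "H \<subseteq> H'" "x \<in> H'" "residue_character_on G n H' \<kappa>'"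
    "\<And>h. h \<in> H \<Longrightarrow> [\<kappa>' h = \<kappa> h] (mod n)" "[\<kappa>' x = c] (mod n)"
proof -
  define H' where "H' = {h \<otimes> x [^] (i::nat) | h i. h \<in> H}"
  \<comment> \<open>Any representation of an element as \<open>h x\<^sup>i\<close> may be used: the value does not depend on it.\<close>
  define \<kappa>' where "\<kappa>' y = (case (SOME (h, i). h \<in> H \<and> y = h \<otimes> x [^] (i::nat)) of (h, i) \<Rightarrow> \<kappa> h + i * c)" for y
  have Hc: "\<And>h. h \<in> H \<Longrightarrow> h \<in> carrier G" using H by (auto simp: subgroup.mem_carrier)
  note Hcl = subgroup.one_closed[OF H] subgroup.m_closed[OF H] subgroup.m_inv_closed[OF H]
  have val: "[\<kappa>' (h \<otimes> x [^] i) = \<kappa> h + i * c] (mod n)" if h: "h \<in> H" for h and i :: nat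
  proof -
    obtain h' j where hj: "(SOME (h', j). h' \<in> H \<and> h \<otimes> x [^] i = h' \<otimes> x [^] (j::nat)) = (h', j)"
      by (meson surj_pair)
    have "case (h', j) of (h', j) \<Rightarrow> h' \<in> H \<and> h \<otimes> x [^] i = h' \<otimes> x [^] j"
      unfolding hj[symmetric] by (rule someI[of _ "(h, i)"]) (use h in auto)
    then have hj': "h' \<in> H" "h \<otimes> x [^] i = h' \<otimes> x [^] j" by auto
    have "[\<kappa> h' + j * c = \<kappa> h + i * c] (mod n)"
    proof (cases "i \<le> j")
      case True
      then show ?thesis
        using residue_character_well_defined[OF \<kappa> H x m c h hj'] by (simp add: cong_sym)
    next
      case False
      then show ?thesis
        using residue_character_well_defined[OF \<kappa> H x m c hj'(1) h hj'(2)[symmetric]] by simp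
    qed
    then show ?thesis by (simp add: \<kappa>'_def hj)
  qed
  have mult_eq: "(h \<otimes> x [^] i) \<otimes> (h' \<otimes> x [^] j) = (h \<otimes> h') \<otimes> x [^] (i + j)"
    if "h \<in> H" "h' \<in> H" for h h' and i j :: nat
    unfolding nat_pow_mult[OF x, symmetric] using that x Hc by (simp add: m_ac)
  have sub: "subgroup H' G"
  proof (rule subgroupI)
    show "H' \<subseteq> carrier G" using x Hc by (auto simp: H'_def)
    show "H' \<noteq> {}" using Hcl(1) by (auto simp: H'_def)
    fix a assume "a \<in> H'"
    then obtain h i where a: "a = h \<otimes> x [^] (i::nat)" "h \<in> H" by (auto simp: H'_def)
    have "x [^] (order G - 1) \<otimes> x = \<one>"
      using x fin nat_pow_Suc[of x "order G - 1"] by (simp add: pow_order_eq_1 order_gt_0_iff_finite)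
    then have "inv x = x [^] (order G - 1)" using x by (simp add: inv_equality)
    then have "inv (x [^] i) = x [^] ((order G - 1) * i)"
      using x by (simp add: nat_pow_pow flip: nat_pow_inv)
    then have "inv a = inv h \<otimes> x [^] ((order G - 1) * i)"
      using a x Hc by (simp add: inv_mult)
    then show "inv a \<in> H'" using a Hcl by (auto simp: H'_def)
    fix b assume "b \<in> H'"
    then obtain h' j where b: "b = h' \<otimes> x [^] (j::nat)" "h' \<in> H" by (auto simp: H'_def)
    have "a \<otimes> b = (h \<otimes> h') \<otimes> x [^] (i + j)"
      using a b mult_eq by simp
    then show "a \<otimes> b \<in> H'" using a b Hcl by (auto simp: H'_def)
  qed
  have "H \<subseteq> H'"
  proof
    fix h assume "h \<in> H"
    then have "h = h \<otimes> x [^] (0::nat)" using Hc by simp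
    then show "h \<in> H'" unfolding H'_def using \<open>h \<in> H\<close> by blast
  qed
  have "x = \<one> \<otimes> x [^] (1::nat)" using x by simp
  then have "x \<in> H'" unfolding H'_def using Hcl(1) by blast
  moreover have "residue_character_on G n H' \<kappa>'"
    unfolding residue_character_on_def
  proof (intro ballI)
    fix a b assume "a \<in> H'" "b \<in> H'"
    then obtain h i h' j where a: "a = h \<otimes> x [^] (i::nat)" "h \<in> H"
      and b: "b = h' \<otimes> x [^] (j::nat)" "h' \<in> H" by (auto simp: H'_def)
    have "a \<otimes> b = (h \<otimes> h') \<otimes> x [^] (i + j)"
      using a b mult_eq by simp
    then have "[\<kappa>' (a \<otimes> b) = \<kappa> (h \<otimes> h') + (i + j) * c] (mod n)"
      using val[of "h \<otimes> h'" "i + j"] a b Hcl by simp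
    moreover have "[\<kappa> (h \<otimes> h') + (i + j) * c = \<kappa> h + \<kappa> h' + (i + j) * c] (mod n)"
      using residue_character_onD[OF \<kappa> a(2) b(2)] by (intro cong_add) auto
    moreover have "[\<kappa>' a + \<kappa>' b = (\<kappa> h + i * c) + (\<kappa> h' + j * c)] (mod n)"
      using val[OF a(2), of i] val[OF b(2), of j] a b by (intro cong_add) auto
    ultimately show "[\<kappa>' (a \<otimes> b) = \<kappa>' a + \<kappa>' b] (mod n)"
      by (simp add: algebra_simps cong_def)
  qed
  moreover have "[\<kappa>' h = \<kappa> h] (mod n)" if "h \<in> H" for h
    using val[OF that, of 0] that Hc by simp
  moreover have "[\<kappa>' x = c] (mod n)"
  proof -
    have "[\<kappa>' x = \<kappa> \<one> + c] (mod n)" using val[OF Hcl(1), of 1] x by simp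
    moreover have "[\<kappa> \<one> + c = 0 + c] (mod n)"
      using residue_character_one[OF \<kappa> H] by (intro cong_add) auto
    ultimately show ?thesis by (auto dest: cong_trans)
  qed
  ultimately show thesis using that sub \<open>H \<subseteq> H'\<close> by blast
qed

text \<open>On the cyclic group generated by \<open>g\<close>, of order \<open>m\<close>, one sends \<open>g\<close> to \<open>n / m\<close>. A character is then
extended as far as possible. No \<open>x\<close> can remain outside its domain \<open>H\<close>: if \<open>m\<close> is the order of \<open>x\<close> modulo \<open>H\<close>,
then \<open>n / m\<close> kills \<open>x\<^sup>m\<close> (as \<open>n\<close> kills \<open>x\<close>), hence \<open>n / m\<close> kills \<open>\<kappa> (x\<^sup>m)\<close> modulo \<open>n\<close>, so that
\<open>m\<close> divides \<open>\<kappa> (x\<^sup>m)\<close> and the value at \<open>x\<close> can be chosen.\<close>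

lemma separating_residue_character:
  assumes fin: "finite (carrier G)" and g: "g \<in> carrier G" "g \<noteq> \<one>"
  obtains \<kappa> where "residue_character_on G (order G) (carrier G) \<kappa>" "\<not> [\<kappa> g = 0] (mod order G)"
proof -
  let ?n = "order G"
  have n: "?n > 0" using fin by (simp add: order_gt_0_iff_finite)
  define P where "P H \<longleftrightarrow> subgroup H G \<and> g \<in> H \<and>
    (\<exists>\<kappa>. residue_character_on G ?n H \<kappa> \<and> \<not> [\<kappa> g = 0] (mod ?n))" for H
  have dvd_order: "m dvd ?n" if "\<And>i::nat. x [^] i \<in> H \<Longrightarrow> m dvd i" "x \<in> carrier G" "subgroup H G" for x m H
    using that by (simp add: pow_order_eq_1 subgroup.one_closed)
  have "\<exists>H. P H"
  proof -
    have triv: "subgroup {\<one>} G" by (rule triv_subgroup)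
    obtain m where m: "m > 0" "g [^] m \<in> {\<one>}" "\<And>i::nat. g [^] i \<in> {\<one>} \<Longrightarrow> m dvd i"
      using least_power_in_subgroup[OF fin triv g(1)] by blast
    \<comment> \<open>The witness \<open>c = n / m\<close> is nonzero modulo \<open>n\<close> because \<open>m > 1\<close>.\<close>
    have "m dvd ?n" by (rule dvd_order[OF m(3) g(1) triv])
    then obtain c where c: "?n = m * c" by (auto elim: dvdE)
    have "residue_character_on G ?n {\<one>} (\<lambda>_. 0)" by (simp add: residue_character_on_def)
    then obtain H \<kappa> where H: "subgroup H G" "g \<in> H" "residue_character_on G ?n H \<kappa>"
      "[\<kappa> g = c] (mod ?n)"
      using extend_residue_character[OF fin _ triv g(1) m(2,3), of ?n "\<lambda>_. 0" c] c
      by (metis cong_mult_self_left cong_0_iff dvd_refl)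
    have "\<not> [c = 0] (mod ?n)"
    proof
      assume "[c = 0] (mod ?n)"
      then have "?n dvd c" by (simp add: cong_0_iff)
      moreover have "c > 0" using c n by (cases c) auto
      ultimately have "m * c \<le> c" using c by (metis dvd_imp_le)
      then have "m = 1" using m(1) \<open>c > 0\<close> by simp
      then show False using m g by simp
    qed
    then have "\<not> [\<kappa> g = 0] (mod ?n)" using H(4) by (simp add: cong_def)
    then show ?thesis unfolding P_def using H by blast
  qed
  moreover have "\<forall>H. P H \<longrightarrow> card H < Suc ?n"
    unfolding P_def order_def using fin by (auto simp: less_Suc_eq_le intro!: card_mono dest: subgroup.subset)
  ultimately obtain H where H: "P H" "\<And>H'. P H' \<Longrightarrow> card H' \<le> card H"
    using ex_has_greatest_nat[of P _ card "Suc ?n"] by (metis less_imp_le)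
  then obtain \<kappa> where \<kappa>: "subgroup H G" "g \<in> H" "residue_character_on G ?n H \<kappa>" "\<not> [\<kappa> g = 0] (mod ?n)"
    unfolding P_def by blast
  have "H = carrier G"
  proof (rule ccontr)
    assume "H \<noteq> carrier G"
    then obtain x where x: "x \<in> carrier G" "x \<notin> H" using subgroup.subset[OF \<kappa>(1)] by blast
    obtain m where m: "m > 0" "x [^] m \<in> H" "\<And>i::nat. x [^] i \<in> H \<Longrightarrow> m dvd i"
      using least_power_in_subgroup[OF fin \<kappa>(1) x(1)] by blast
    obtain t where t: "?n = m * t" using dvd_order[OF m(3) x(1) \<kappa>(1)] by (auto elim: dvdE)
    have "[\<kappa> ((x [^] m) [^] t) = t * \<kappa> (x [^] m)] (mod ?n)"
      by (rule residue_character_pow[OF \<kappa>(3,1) m(2)])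
    moreover have "(x [^] m) [^] t = \<one>" using x t by (simp add: nat_pow_pow pow_order_eq_1 flip: t)
    ultimately have "[t * \<kappa> (x [^] m) = 0] (mod ?n)"
      using residue_character_one[OF \<kappa>(3,1)] by (simp add: cong_def)
    then have "t * m dvd t * \<kappa> (x [^] m)" using t by (simp add: cong_0_iff mult.commute)
    then obtain c where "\<kappa> (x [^] m) = m * c" using n t by (auto elim: dvdE)
    then have "[m * c = \<kappa> (x [^] m)] (mod ?n)" by simp
    then obtain H' \<kappa>' where H': "subgroup H' G" "H \<subseteq> H'" "x \<in> H'" "residue_character_on G ?n H' \<kappa>'"
      "\<And>h. h \<in> H \<Longrightarrow> [\<kappa>' h = \<kappa> h] (mod ?n)"
      using extend_residue_character[OF fin \<kappa>(3,1) x(1) m(2,3)] by metis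
    have "\<not> [\<kappa>' g = 0] (mod ?n)" using H'(5)[OF \<kappa>(2)] \<kappa>(4) by (simp add: cong_def)
    then have "P H'" unfolding P_def using H' \<kappa>(2) by blast
    moreover have "card H < card H'"
      using H' x fin by (intro psubset_card_mono) (auto intro: finite_subset dest: subgroup.subset)
    ultimately show False using H(2) by fastforce
  qed
  then show thesis using that \<kappa> by blast
qed

end

section \<open>Partial actions as families of total maps\<close>

lemma ideal_ident:
  fixes S (structure)
  assumes "cring S" "unital_ideal S I"
  shows "ideal_ident S I \<in> I" "\<And>x. x \<in> I \<Longrightarrow> ideal_ident S I \<otimes> x = x"
proof -
  interpret cring S by fact
  from assms(2) obtain u where I: "ideal I S" and u: "u \<in> I" "\<And>x. x \<in> I \<Longrightarrow> u \<otimes> x = x"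
    unfolding unital_ideal_def by blast
  have "ideal_ident S I = u"
    unfolding ideal_ident_def
  proof (rule the_equality)
    fix v assume "v \<in> I \<and> (\<forall>x\<in>I. v \<otimes> x = x)"
    then show "v = u" using u ideal.Icarr[OF I] by (metis m_comm)
  qed (use u in auto)
  then show "ideal_ident S I \<in> I" "\<And>x. x \<in> I \<Longrightarrow> ideal_ident S I \<otimes> x = x" using u by auto
qed

locale ring_partial_action = cring S + G: group G
  for S (structure) and G +
  fixes D :: "'c \<Rightarrow> 'a set" and \<alpha> :: "'c \<Rightarrow> 'a \<Rightarrow> 'a"
  assumes partial_action: "partial_ring_action G S D \<alpha>"
begin

abbreviation G_mult (infixl \<open>\<bullet>\<close> 70) where "g \<bullet> h \<equiv> g \<otimes>\<^bsub>G\<^esub> h"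

definition e :: "'c \<Rightarrow> 'a" where "e g = ideal_ident S (D g)"

definition act :: "'c \<Rightarrow> 'a \<Rightarrow> 'a" where "act g a = \<alpha> g (a \<otimes> e (inv\<^bsub>G\<^esub> g))"

lemma finite_G: "finite (carrier G)"
  using partial_action by (simp add: partial_ring_action_def)

lemma
  assumes "g \<in> carrier G"
  shows ideal_D: "ideal (D g) S" and unital_D: "unital_ideal S (D g)"
  using partial_action assms by (auto simp: partial_ring_action_def unital_ideal_def)

lemma e_in_D: "g \<in> carrier G \<Longrightarrow> e g \<in> D g"
  and e_times: "g \<in> carrier G \<Longrightarrow> x \<in> D g \<Longrightarrow> e g \<otimes> x = x"
  unfolding e_def by (rule ideal_ident[OF is_cring unital_D], assumption+)+

lemma D_closed: "g \<in> carrier G \<Longrightarrow> x \<in> D g \<Longrightarrow> x \<in> carrier S"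
  using ideal.Icarr[OF ideal_D] .

lemma e_closed [simp]: "g \<in> carrier G \<Longrightarrow> e g \<in> carrier S"
  using D_closed e_in_D by blast

lemma e_idem [simp]: "g \<in> carrier G \<Longrightarrow> e g \<otimes> e g = e g"
  using e_times e_in_D by blast

lemma e_idem_left [simp]: "g \<in> carrier G \<Longrightarrow> x \<in> carrier S \<Longrightarrow> e g \<otimes> (e g \<otimes> x) = e g \<otimes> x"
  by (simp flip: m_assoc)

lemma mem_D_iff: "g \<in> carrier G \<Longrightarrow> x \<in> D g \<longleftrightarrow> x \<in> carrier S \<and> x \<otimes> e g = x"
  by (metis D_closed e_in_D e_times e_closed ideal.I_l_closed ideal_D m_comm)

lemma e_one [simp]: "e \<one>\<^bsub>G\<^esub> = \<one>"
proof -
  have "D \<one>\<^bsub>G\<^esub> = carrier S" using partial_action by (simp add: partial_ring_action_def)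
  then show ?thesis using e_times[of "\<one>\<^bsub>G\<^esub>" \<one>] by simp
qed

lemma
  assumes "g \<in> carrier G"
  shows \<alpha>_bij: "bij_betw (\<alpha> g) (D (inv\<^bsub>G\<^esub> g)) (D g)"
    and \<alpha>_mult: "\<And>x y. x \<in> D (inv\<^bsub>G\<^esub> g) \<Longrightarrow> y \<in> D (inv\<^bsub>G\<^esub> g) \<Longrightarrow> \<alpha> g (x \<otimes> y) = \<alpha> g x \<otimes> \<alpha> g y"
    and \<alpha>_add: "\<And>x y. x \<in> D (inv\<^bsub>G\<^esub> g) \<Longrightarrow> y \<in> D (inv\<^bsub>G\<^esub> g) \<Longrightarrow> \<alpha> g (x \<oplus> y) = \<alpha> g x \<oplus> \<alpha> g y"
    and \<alpha>_e: "\<alpha> g (e (inv\<^bsub>G\<^esub> g)) = e g"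
proof -
  have "\<alpha> g \<in> ring_iso (ideal_ring S (D (inv\<^bsub>G\<^esub> g))) (ideal_ring S (D g))"
    using partial_action assms by (simp add: partial_ring_action_def)
  then show "bij_betw (\<alpha> g) (D (inv\<^bsub>G\<^esub> g)) (D g)"
    "\<And>x y. x \<in> D (inv\<^bsub>G\<^esub> g) \<Longrightarrow> y \<in> D (inv\<^bsub>G\<^esub> g) \<Longrightarrow> \<alpha> g (x \<otimes> y) = \<alpha> g x \<otimes> \<alpha> g y"
    "\<And>x y. x \<in> D (inv\<^bsub>G\<^esub> g) \<Longrightarrow> y \<in> D (inv\<^bsub>G\<^esub> g) \<Longrightarrow> \<alpha> g (x \<oplus> y) = \<alpha> g x \<oplus> \<alpha> g y"
    "\<alpha> g (e (inv\<^bsub>G\<^esub> g)) = e g"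
    by (auto simp: ring_iso_def ring_hom_def ideal_ring_def e_def)
qed

lemma \<alpha>_in_D: "g \<in> carrier G \<Longrightarrow> x \<in> D (inv\<^bsub>G\<^esub> g) \<Longrightarrow> \<alpha> g x \<in> D g"
  using \<alpha>_bij bij_betwE by blast

lemma times_e_in_D: "g \<in> carrier G \<Longrightarrow> a \<in> carrier S \<Longrightarrow> a \<otimes> e g \<in> D g"
  by (simp add: mem_D_iff m_assoc)

lemma act_in_D: "g \<in> carrier G \<Longrightarrow> a \<in> carrier S \<Longrightarrow> act g a \<in> D g"
  unfolding act_def by (intro \<alpha>_in_D times_e_in_D) auto

lemma act_closed [simp]: "g \<in> carrier G \<Longrightarrow> a \<in> carrier S \<Longrightarrow> act g a \<in> carrier S"
  using D_closed act_in_D by blast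

lemma act_times_e [simp]: "g \<in> carrier G \<Longrightarrow> a \<in> carrier S \<Longrightarrow> act g a \<otimes> e g = act g a"
  using act_in_D mem_D_iff by blast

lemma e_times_act [simp]: "g \<in> carrier G \<Longrightarrow> a \<in> carrier S \<Longrightarrow> e g \<otimes> act g a = act g a"
  using e_times act_in_D by blast

lemma act_eq_\<alpha>: "g \<in> carrier G \<Longrightarrow> x \<in> D (inv\<^bsub>G\<^esub> g) \<Longrightarrow> act g x = \<alpha> g x"
  by (simp add: act_def mem_D_iff)

lemma act_add [simp]:
  "g \<in> carrier G \<Longrightarrow> a \<in> carrier S \<Longrightarrow> b \<in> carrier S \<Longrightarrow> act g (a \<oplus> b) = act g a \<oplus> act g b"
  by (simp add: act_def l_distr \<alpha>_add times_e_in_D)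

lemma act_mult [simp]:
  assumes "g \<in> carrier G" "a \<in> carrier S" "b \<in> carrier S"
  shows "act g (a \<otimes> b) = act g a \<otimes> act g b"
proof -
  have "a \<otimes> b \<otimes> e (inv\<^bsub>G\<^esub> g) = (a \<otimes> e (inv\<^bsub>G\<^esub> g)) \<otimes> (b \<otimes> e (inv\<^bsub>G\<^esub> g))"
    using assms e_idem[of "inv\<^bsub>G\<^esub> g"] by (simp add: m_ac)
  then show ?thesis using assms by (simp add: act_def \<alpha>_mult times_e_in_D)
qed

lemma act_unit [simp]: "g \<in> carrier G \<Longrightarrow> act g \<one> = e g"
  by (simp add: act_def \<alpha>_e)

lemma act_by_one [simp]: "a \<in> carrier S \<Longrightarrow> act \<one>\<^bsub>G\<^esub> a = a"
  using partial_action by (simp add: act_def partial_ring_action_def)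

lemma act_zero [simp]: "g \<in> carrier G \<Longrightarrow> act g \<zero> = \<zero>"
  using act_add[of g \<zero> \<zero>] act_closed[of g \<zero>] by (metis add.r_cancel_one' l_zero zero_closed)

lemma act_finsum:
  assumes "g \<in> carrier G" "finite I" "\<And>i. i \<in> I \<Longrightarrow> f i \<in> carrier S"
  shows "act g (\<Oplus>i\<in>I. f i) = (\<Oplus>i\<in>I. act g (f i))"
  using assms(2,3) by (induction I rule: finite_induct) (auto simp: assms(1) Pi_def)

text \<open>Both sides are the identity element of \<open>D g \<inter> D (g h)\<close>, which is the image under \<open>\<alpha> g\<close> of
\<open>D (g\<inverse>) \<inter> D h\<close>.\<close>

lemma act_e:
  assumes g: "g \<in> carrier G" and h: "h \<in> carrier G"
  shows "act g (e h) = e g \<otimes> e (g \<bullet> h)"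
proof -
  have img: "\<alpha> g ` (D (inv\<^bsub>G\<^esub> g) \<inter> D h) = D g \<inter> D (g \<bullet> h)"
    using partial_action g h by (simp add: partial_ring_action_def)
  have gh: "g \<bullet> h \<in> carrier G" "inv\<^bsub>G\<^esub> g \<in> carrier G" using g h by auto
  let ?u = "e h \<otimes> e (inv\<^bsub>G\<^esub> g)"
  have u: "?u \<in> D (inv\<^bsub>G\<^esub> g) \<inter> D h"
    using times_e_in_D[of h "e (inv\<^bsub>G\<^esub> g)"] times_e_in_D[of "inv\<^bsub>G\<^esub> g" "e h"] g h by (simp add: m_comm)
  have uD: "\<alpha> g ?u \<in> D g \<inter> D (g \<bullet> h)" using img u by blast
  have "e g \<otimes> e (g \<bullet> h) \<in> D g \<inter> D (g \<bullet> h)"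
    using times_e_in_D[OF g, of "e (g \<bullet> h)"] times_e_in_D[OF gh(1), of "e g"] gh g by (simp add: m_comm)
  then obtain z where z: "z \<in> D (inv\<^bsub>G\<^esub> g) \<inter> D h" "e g \<otimes> e (g \<bullet> h) = \<alpha> g z"
    using img by (metis imageE)
  have zc: "z \<in> carrier S" using z D_closed h by blast
  have "?u \<otimes> z = e h \<otimes> (e (inv\<^bsub>G\<^esub> g) \<otimes> z)" using zc gh g h by (simp add: m_assoc)
  then have "?u \<otimes> z = z" using e_times[OF gh(2)] e_times[OF h] z by simp
  then have "\<alpha> g z = \<alpha> g ?u \<otimes> \<alpha> g z" using \<alpha>_mult[OF g] u z by (metis IntD1)
  also have "\<dots> = \<alpha> g ?u \<otimes> (e g \<otimes> e (g \<bullet> h))" using z by simp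
  also have "\<dots> = \<alpha> g ?u"
    using uD mem_D_iff[OF g] mem_D_iff[OF gh(1)] g gh by (simp flip: m_assoc)
  finally show ?thesis using z by (simp add: act_def)
qed

text \<open>The composition law in a form free of domains: \<open>\<alpha>\<^sub>g\<close> and \<open>\<alpha>\<^sub>h\<close> compose on the ideal
\<open>D (h\<inverse>) \<inter> D ((g h)\<inverse>)\<close>, and cutting \<open>a\<close> down to it amounts to multiplying the result by
\<open>e g\<close>.\<close>

lemma act_act:
  assumes g: "g \<in> carrier G" and h: "h \<in> carrier G" and a: "a \<in> carrier S"
  shows "act g (act h a) = act (g \<bullet> h) a \<otimes> e g"
proof -
  let ?gh = "g \<bullet> h" and ?g' = "inv\<^bsub>G\<^esub> g" and ?h' = "inv\<^bsub>G\<^esub> h"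
  have cl: "?gh \<in> carrier G" "?g' \<in> carrier G" "?h' \<in> carrier G" "inv\<^bsub>G\<^esub> ?gh \<in> carrier G" using g h by auto
  have inv_gh: "inv\<^bsub>G\<^esub> ?gh = ?h' \<bullet> ?g'" using g h by (simp add: G.inv_mult_group)
  define z where "z = a \<otimes> e ?h' \<otimes> e (inv\<^bsub>G\<^esub> ?gh)"
  have z: "z \<in> D ?h' \<inter> D (inv\<^bsub>G\<^esub> ?gh)"
  proof
    have "z = (a \<otimes> e (inv\<^bsub>G\<^esub> ?gh)) \<otimes> e ?h'" unfolding z_def using a cl by (simp add: m_ac)
    then show "z \<in> D ?h'" using a cl by (simp add: times_e_in_D)
    show "z \<in> D (inv\<^bsub>G\<^esub> ?gh)" unfolding z_def using a cl by (simp add: times_e_in_D)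
  qed
  then have zc: "z \<in> carrier S" using D_closed cl by blast
  have "act h z = act h a \<otimes> act h (e ?h') \<otimes> act h (e (inv\<^bsub>G\<^esub> ?gh))"
    unfolding z_def using a cl h by simp
  also have "\<dots> = act h a \<otimes> e ?g'"
    using a h cl by (simp add: act_e inv_gh G.m_assoc[symmetric] flip: m_assoc)
  finally have "\<alpha> h z = act h a \<otimes> e ?g'" using act_eq_\<alpha> h z by auto
  then have "act g (act h a) = \<alpha> g (\<alpha> h z)" by (simp add: act_def)
  also have "\<dots> = \<alpha> ?gh z" using partial_action g h z by (simp add: partial_ring_action_def)
  also have "\<dots> = act ?gh z" using act_eq_\<alpha>[OF cl(1)] z by simp
  also have "\<dots> = act ?gh a \<otimes> act ?gh (e ?h') \<otimes> act ?gh (e (inv\<^bsub>G\<^esub> ?gh))"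
    unfolding z_def using a cl h by simp
  also have "\<dots> = act ?gh a \<otimes> e g"
  proof -
    have "?gh \<bullet> ?h' = g" using g h by (simp add: G.m_assoc)
    then have 1: "act ?gh (e ?h') = e ?gh \<otimes> e g" using act_e[OF cl(1,3)] by simp
    have 2: "act ?gh (e (inv\<^bsub>G\<^esub> ?gh)) = e ?gh" using act_e[OF cl(1,4)] cl by simp
    have "act ?gh a \<otimes> (e ?gh \<otimes> e g) \<otimes> e ?gh = (act ?gh a \<otimes> e ?gh) \<otimes> e ?gh \<otimes> e g"
      using a g cl act_closed[OF cl(1) a] e_closed[OF cl(1)] by (simp only: m_ac m_closed e_closed)
    then show ?thesis unfolding 1 2 using a cl by simp
  qed
  finally show ?thesis .
qed

lemma partial_invariants_eq:
  "partial_invariants G S D \<alpha> = {a \<in> carrier S. \<forall>g\<in>carrier G. act g a = a \<otimes> e g}"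
  by (simp add: partial_invariants_def act_def e_def)

lemma cocycle_module_eq:
  "cocycle_module G S D \<alpha> f = {a \<in> carrier S. \<forall>g\<in>carrier G. act g a = f g \<otimes> a}"
  by (simp add: cocycle_module_def act_def e_def)

lemma Units_D_iff:
  assumes g: "g \<in> carrier G"
  shows "u \<in> Units (ideal_ring S (D g)) \<longleftrightarrow> u \<in> D g \<and> (\<exists>v\<in>D g. u \<otimes> v = e g)"
  unfolding Units_def ideal_ring_def e_def
  using m_comm D_closed[OF g] by auto

lemma cocycle_carrier_iff:
  "f \<in> carrier (cocycle_group G S D \<alpha>) \<longleftrightarrow> f \<in> extensional (carrier G) \<and>
     (\<forall>g\<in>carrier G. f g \<in> D g \<and> (\<exists>v\<in>D g. f g \<otimes> v = e g)) \<and>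
     (\<forall>g\<in>carrier G. \<forall>h\<in>carrier G. f (g \<bullet> h) \<otimes> e g = f g \<otimes> act g (f h))"
  by (auto simp: cocycle_group_def Units_D_iff act_def e_def)

text \<open>For the inverse of a cocycle, compare the two sides of its cocycle identity as inverses, within
the ideal with identity \<open>e (g h) e g\<close>, of the two equal sides of the identity for \<open>f\<close>.\<close>

lemma comm_group_cocycle_group: "comm_group (cocycle_group G S D \<alpha>)" (is "comm_group ?Z")
proof (rule comm_groupI)
  have mult: "f \<otimes>\<^bsub>?Z\<^esub> f' = (\<lambda>g\<in>carrier G. f g \<otimes> f' g)" for f f' by (simp add: cocycle_group_def)
  have one: "\<one>\<^bsub>?Z\<^esub> = (\<lambda>g\<in>carrier G. e g)" by (simp add: cocycle_group_def e_def)
  have cl: "f g \<in> carrier S" "f g \<otimes> e g = f g" "e g \<otimes> f g = f g" if "f \<in> carrier ?Z" "g \<in> carrier G" for f g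
  proof -
    have "f g \<in> D g" using that unfolding cocycle_carrier_iff by blast
    then show "f g \<in> carrier S" "f g \<otimes> e g = f g" "e g \<otimes> f g = f g"
      using mem_D_iff[OF that(2)] e_times[OF that(2)] by blast+
  qed
  show "\<one>\<^bsub>?Z\<^esub> \<in> carrier ?Z"
    unfolding cocycle_carrier_iff one
  proof (intro conjI ballI)
    fix g assume g: "g \<in> carrier G"
    show "\<exists>v\<in>D g. (\<lambda>g\<in>carrier G. e g) g \<otimes> v = e g"
      using g e_in_D by (intro bexI[of _ "e g"]) auto
    show "(\<lambda>g\<in>carrier G. e g) g \<in> D g" using g e_in_D by simp
    fix h assume h: "h \<in> carrier G"
    show "(\<lambda>g\<in>carrier G. e g) (g \<bullet> h) \<otimes> e g
        = (\<lambda>g\<in>carrier G. e g) g \<otimes> act g ((\<lambda>g\<in>carrier G. e g) h)"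
      using m_comm[OF e_closed e_closed, of "g \<bullet> h" g] g h by (simp add: act_e)
  qed simp
  fix f1 f2 assume f: "f1 \<in> carrier ?Z" "f2 \<in> carrier ?Z"
  note cl1 = cl[OF f(1)] and cl2 = cl[OF f(2)]
  show "f1 \<otimes>\<^bsub>?Z\<^esub> f2 \<in> carrier ?Z"
    unfolding cocycle_carrier_iff
  proof (intro conjI ballI)
    show "f1 \<otimes>\<^bsub>?Z\<^esub> f2 \<in> extensional (carrier G)" by (simp add: mult)
    fix g assume g: "g \<in> carrier G"
    have 1: "f1 g \<in> D g" "f2 g \<in> D g" using f g by (auto simp: cocycle_carrier_iff)
    show "(f1 \<otimes>\<^bsub>?Z\<^esub> f2) g \<in> D g" using g cl1(1)[OF g] cl2(1,2)[OF g] by (simp add: mult mem_D_iff m_assoc)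
    obtain v1 v2 where v: "v1 \<in> D g" "f1 g \<otimes> v1 = e g" "v2 \<in> D g" "f2 g \<otimes> v2 = e g"
      using f g by (meson cocycle_carrier_iff)
    then have vc: "v1 \<in> carrier S" "v2 \<in> carrier S" using D_closed g by auto
    have "(f1 g \<otimes> f2 g) \<otimes> (v1 \<otimes> v2) = (f1 g \<otimes> v1) \<otimes> (f2 g \<otimes> v2)"
      using vc cl1(1)[OF g] cl2(1)[OF g] by (simp add: m_ac)
    then have "(f1 \<otimes>\<^bsub>?Z\<^esub> f2) g \<otimes> (v1 \<otimes> v2) = e g" using v g by (simp add: mult)
    moreover have "v1 \<otimes> v2 \<in> D g" using v(1,3) vc g by (simp add: mem_D_iff m_assoc)
    ultimately show "\<exists>v\<in>D g. (f1 \<otimes>\<^bsub>?Z\<^esub> f2) g \<otimes> v = e g" by blast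
    fix h assume h: "h \<in> carrier G"
    let ?gh = "g \<bullet> h"
    have gh: "?gh \<in> carrier G" using g h by simp
    have c: "f1 ?gh \<otimes> e g = f1 g \<otimes> act g (f1 h)" "f2 ?gh \<otimes> e g = f2 g \<otimes> act g (f2 h)"
      using f g h by (auto simp: cocycle_carrier_iff)
    have "(f1 ?gh \<otimes> f2 ?gh) \<otimes> e g = (f1 ?gh \<otimes> e g) \<otimes> (f2 ?gh \<otimes> e g)"
    proof -
      have "(f1 ?gh \<otimes> e g) \<otimes> (f2 ?gh \<otimes> e g) = (f1 ?gh \<otimes> f2 ?gh) \<otimes> (e g \<otimes> e g)"
        using cl1(1)[OF gh] cl2(1)[OF gh] e_closed[OF g] by (simp only: m_ac m_closed)
      then show ?thesis using g by simp
    qed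
    also have "\<dots> = (f1 g \<otimes> f2 g) \<otimes> act g (f1 h \<otimes> f2 h)"
      unfolding c using g h cl1(1)[OF g] cl2(1)[OF g] cl1(1)[OF h] cl2(1)[OF h] by (simp add: m_ac)
    finally show "(f1 \<otimes>\<^bsub>?Z\<^esub> f2) ?gh \<otimes> e g = (f1 \<otimes>\<^bsub>?Z\<^esub> f2) g \<otimes> act g ((f1 \<otimes>\<^bsub>?Z\<^esub> f2) h)"
      using g h gh by (simp add: mult)
  qed
  show "f1 \<otimes>\<^bsub>?Z\<^esub> f2 = f2 \<otimes>\<^bsub>?Z\<^esub> f1"
    unfolding mult using cl1 cl2 by (auto simp: m_comm restrict_def)
  show "\<one>\<^bsub>?Z\<^esub> \<otimes>\<^bsub>?Z\<^esub> f1 = f1"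
  proof (rule extensionalityI)
    show "f1 \<in> extensional (carrier G)" using f by (simp add: cocycle_carrier_iff)
  qed (use cl1 in \<open>auto simp: mult one\<close>)
  fix f3 assume "f3 \<in> carrier ?Z"
  then show "f1 \<otimes>\<^bsub>?Z\<^esub> f2 \<otimes>\<^bsub>?Z\<^esub> f3 = f1 \<otimes>\<^bsub>?Z\<^esub> (f2 \<otimes>\<^bsub>?Z\<^esub> f3)"
    unfolding mult using cl1 cl2 cl by (auto simp: m_assoc restrict_def)
next
  let ?Z = "cocycle_group G S D \<alpha>"
  have mult: "f \<otimes>\<^bsub>?Z\<^esub> f' = (\<lambda>g\<in>carrier G. f g \<otimes> f' g)" for f f' by (simp add: cocycle_group_def)
  have one: "\<one>\<^bsub>?Z\<^esub> = (\<lambda>g\<in>carrier G. e g)" by (simp add: cocycle_group_def e_def)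
  fix f assume f: "f \<in> carrier ?Z"
  then have "\<forall>g\<in>carrier G. \<exists>v. v \<in> D g \<and> f g \<otimes> v = e g" by (auto simp: cocycle_carrier_iff)
  then obtain f' where f': "\<And>g. g \<in> carrier G \<Longrightarrow> f' g \<in> D g" "\<And>g. g \<in> carrier G \<Longrightarrow> f g \<otimes> f' g = e g"
    by metis
  have cl: "f g \<in> carrier S" "f' g \<in> carrier S" "f g \<otimes> e g = f g" "f' g \<otimes> e g = f' g"
    if "g \<in> carrier G" for g
  proof -
    have "f g \<in> D g" using that f unfolding cocycle_carrier_iff by blast
    then show "f g \<in> carrier S" "f' g \<in> carrier S" "f g \<otimes> e g = f g" "f' g \<otimes> e g = f' g"
      using mem_D_iff[OF that] f'(1)[OF that] by blast+
  qed
  define k where "k = (\<lambda>g\<in>carrier G. f' g)"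
  have "k \<in> carrier ?Z"
    unfolding cocycle_carrier_iff
  proof (intro conjI ballI)
    show "k \<in> extensional (carrier G)" by (simp add: k_def)
    fix g assume g: "g \<in> carrier G"
    show "k g \<in> D g" using f' g by (simp add: k_def)
    show "\<exists>v\<in>D g. k g \<otimes> v = e g"
    proof
      show "f g \<in> D g" using f g unfolding cocycle_carrier_iff by blast
      show "k g \<otimes> f g = e g" using f'(2)[OF g] m_comm[OF cl(1)[OF g] cl(2)[OF g]] g by (simp add: k_def)
    qed
    fix h assume h: "h \<in> carrier G"
    let ?gh = "g \<bullet> h"
    have gh: "?gh \<in> carrier G" using g h by simp
    note c = cl[OF g] cl[OF h] cl[OF gh] e_closed[OF g] e_closed[OF gh]
      act_closed[OF g cl(1)[OF h]] act_closed[OF g cl(2)[OF h]]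
    have coc: "f ?gh \<otimes> e g = f g \<otimes> act g (f h)" using f g h by (auto simp: cocycle_carrier_iff)
    define p where "p = f ?gh \<otimes> e g"
    define q where "q = f' ?gh \<otimes> e g"
    define r where "r = f' g \<otimes> act g (f' h)"
    have pc: "p \<in> carrier S" "q \<in> carrier S" "r \<in> carrier S" using c by (auto simp: p_def q_def r_def)
    have pq: "p \<otimes> q = e ?gh \<otimes> e g"
    proof -
      have "p \<otimes> q = (f ?gh \<otimes> f' ?gh) \<otimes> (e g \<otimes> e g)" using c unfolding p_def q_def by (simp only: m_ac m_closed)
      then show ?thesis using f'(2)[OF gh] g by simp
    qed
    have pr: "p \<otimes> r = e ?gh \<otimes> e g"
    proof -
      have "p \<otimes> r = (f g \<otimes> f' g) \<otimes> act g (f h \<otimes> f' h)"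
        using c g h unfolding p_def r_def coc by (simp add: m_ac)
      also have "\<dots> = e g \<otimes> (e g \<otimes> e ?gh)" using f'(2) g h by (simp add: act_e)
      also have "\<dots> = e ?gh \<otimes> e g" using g gh by (simp add: m_comm flip: m_assoc)
      finally show ?thesis .
    qed
    have eq: "q \<otimes> (e ?gh \<otimes> e g) = q"
    proof -
      have "q \<otimes> (e ?gh \<otimes> e g) = (f' ?gh \<otimes> e ?gh) \<otimes> (e g \<otimes> e g)"
        using c unfolding q_def by (simp only: m_ac m_closed)
      then show ?thesis using c g by (simp add: q_def)
    qed
    have er: "(e ?gh \<otimes> e g) \<otimes> r = r"
    proof -
      have "act g (f' h) = act g (f' h) \<otimes> act g (e h)"
        using g h c act_mult[OF g, of "f' h" "e h"] by simp
      then have 1: "act g (f' h) = act g (f' h) \<otimes> (e g \<otimes> e ?gh)" using act_e[OF g h] by simp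
      have "(e ?gh \<otimes> e g) \<otimes> r = f' g \<otimes> (act g (f' h) \<otimes> (e g \<otimes> e ?gh))"
        using c unfolding r_def by (simp only: m_ac m_closed)
      then show ?thesis using 1 by (simp add: r_def)
    qed
    have "q = q \<otimes> (p \<otimes> r)" using eq pr by simp
    also have "\<dots> = (p \<otimes> q) \<otimes> r" using pc by (simp add: m_ac)
    also have "\<dots> = r" using pq er by simp
    finally show "k ?gh \<otimes> e g = k g \<otimes> act g (k h)" using g h gh by (simp add: k_def q_def r_def)
  qed
  moreover have "k \<otimes>\<^bsub>?Z\<^esub> f = \<one>\<^bsub>?Z\<^esub>"
    unfolding mult one
  proof (rule restrict_ext)
    fix g assume g: "g \<in> carrier G"
    show "k g \<otimes> f g = e g" using f'(2)[OF g] m_comm[OF cl(1)[OF g] cl(2)[OF g]] g by (simp add: k_def)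
  qed
  ultimately show "\<exists>f'\<in>carrier ?Z. f' \<otimes>\<^bsub>?Z\<^esub> f = \<one>\<^bsub>?Z\<^esub>" by blast
qed

text \<open>A global action has \<open>\<alpha>\<^sub>g \<circ> \<alpha>\<^bsub>g\<inverse>\<^esub> = \<alpha>\<^sub>e\<close>, whose domain is \<open>S\<close>; so 1 lies in the domain of
\<open>\<alpha>\<^bsub>g\<inverse>\<^esub>\<close>, which is \<open>D g\<close>.\<close>

lemma global_iff: "global_partial_action G D \<alpha> \<longleftrightarrow> (\<forall>g\<in>carrier G. e g = \<one>)"
proof
  assume glob: "global_partial_action G D \<alpha>"
  show "\<forall>g\<in>carrier G. e g = \<one>"
  proof
    fix g assume g: "g \<in> carrier G"
    define a where "a = (\<lambda>g. (Some \<circ> \<alpha> g) |` D (inv\<^bsub>G\<^esub> g))"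
    have "a (g \<bullet> inv\<^bsub>G\<^esub> g) = a g \<circ>\<^sub>m a (inv\<^bsub>G\<^esub> g)"
      using glob g unfolding global_partial_action_def Let_def a_def by blast
    then have "a \<one>\<^bsub>G\<^esub> \<one> = (a g \<circ>\<^sub>m a (inv\<^bsub>G\<^esub> g)) \<one>" using g by simp
    moreover have "a \<one>\<^bsub>G\<^esub> \<one> \<noteq> None" using mem_D_iff[of "\<one>\<^bsub>G\<^esub>" \<one>] by (simp add: a_def)
    ultimately have "a (inv\<^bsub>G\<^esub> g) \<one> \<noteq> None" by (auto simp: map_comp_def split: option.splits)
    then have "\<one> \<in> D g" using g by (auto simp: a_def restrict_map_def split: if_splits)
    then show "e g = \<one>" using e_times[OF g, of \<one>] g by simp
  qed
next
  assume e: "\<forall>g\<in>carrier G. e g = \<one>"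
  then have D: "D g = carrier S" if "g \<in> carrier G" for g using mem_D_iff[OF that] that by auto
  have aa: "\<alpha> g (\<alpha> h x) = \<alpha> (g \<bullet> h) x" if "g \<in> carrier G" "h \<in> carrier G" "x \<in> carrier S" for g h x
    using that partial_action D by (simp add: partial_ring_action_def)
  have ac: "\<alpha> h x \<in> carrier S" if "h \<in> carrier G" "x \<in> carrier S" for h x
    using \<alpha>_in_D[of h x] that D by simp
  show "global_partial_action G D \<alpha>"
    unfolding global_partial_action_def Let_def
    by (auto simp: D map_comp_def restrict_map_def fun_eq_iff aa ac)
qed

end

section \<open>Invertible submodules\<close>

context cring begin

lemma subalgebra_iff:
  "subalgebra K M R \<longleftrightarrow> M \<subseteq> carrier R \<and> \<zero> \<in> M \<and> (\<forall>a\<in>M. \<forall>b\<in>M. a \<oplus> b \<in> M) \<and> (\<forall>a\<in>M. \<ominus> a \<in> M) \<and>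
     (\<forall>k\<in>K. \<forall>a\<in>M. k \<otimes> a \<in> M)"
  by (auto simp: subalgebra_def subalgebra_axioms_def subgroup_def a_inv_def)

lemma ideal_prod_closed:
  assumes "M \<subseteq> carrier R" "N \<subseteq> carrier R" "a \<in> ideal_prod R M N"
  shows "a \<in> carrier R"
  using assms(3) by (induction rule: ideal_prod.induct) (use assms(1,2) in auto)

lemma ideal_prod_mono:
  "M \<subseteq> M' \<Longrightarrow> N \<subseteq> N' \<Longrightarrow> ideal_prod R M N \<subseteq> ideal_prod R M' N'"
proof
  fix a assume "M \<subseteq> M'" "N \<subseteq> N'" "a \<in> ideal_prod R M N"
  from this(3,1,2) show "a \<in> ideal_prod R M' N'"
    by (induction rule: ideal_prod.induct) (auto intro: ideal_prod.intros)
qed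

lemma ideal_prod_least:
  assumes "\<And>a b. a \<in> M \<Longrightarrow> b \<in> N \<Longrightarrow> a \<otimes> b \<in> P" "\<And>a b. a \<in> P \<Longrightarrow> b \<in> P \<Longrightarrow> a \<oplus> b \<in> P"
  shows "ideal_prod R M N \<subseteq> P"
proof
  fix a assume "a \<in> ideal_prod R M N"
  then show "a \<in> P" by (induction rule: ideal_prod.induct) (auto intro: assms)
qed

lemma finsum_in_ideal_prod:
  assumes "finite I" "M \<subseteq> carrier R" "N \<subseteq> carrier R" "\<zero> \<in> M" "\<zero> \<in> N"
    and "\<And>i. i \<in> I \<Longrightarrow> u i \<in> M" "\<And>i. i \<in> I \<Longrightarrow> v i \<in> N"
  shows "(\<Oplus>i\<in>I. u i \<otimes> v i) \<in> ideal_prod R M N"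
  using assms
proof (induction I rule: finite_induct)
  case empty
  have "\<zero> \<otimes> \<zero> \<in> ideal_prod R M N" using empty by (intro ideal_prod.prod)
  then show ?case by simp
next
  case (insert i I)
  have "u i \<otimes> v i \<in> ideal_prod R M N" using insert.prems by (intro ideal_prod.prod) auto
  then have "u i \<otimes> v i \<oplus> (\<Oplus>i\<in>I. u i \<otimes> v i) \<in> ideal_prod R M N"
    using insert by (intro ideal_prod.sum) auto
  moreover have "(\<lambda>i. u i \<otimes> v i) \<in> insert i I \<rightarrow> carrier R" using insert.prems by blast
  ultimately show ?case using insert.hyps by simp
qed

lemma ideal_prod_comm:
  assumes "M \<subseteq> carrier R" "N \<subseteq> carrier R"
  shows "ideal_prod R M N = ideal_prod R N M"
proof -
  have "ideal_prod R M N \<subseteq> ideal_prod R N M" if "M \<subseteq> carrier R" "N \<subseteq> carrier R" for M N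
  proof (rule ideal_prod_least)
    fix a b assume "a \<in> M" "b \<in> N"
    then have "b \<otimes> a \<in> ideal_prod R N M" "b \<otimes> a = a \<otimes> b"
      using that by (auto intro: ideal_prod.prod m_comm)
    then show "a \<otimes> b \<in> ideal_prod R N M" by simp
  qed (rule ideal_prod.sum)
  then show ?thesis using assms by blast
qed

lemma ideal_prod_assoc:
  assumes "M \<subseteq> carrier R" "N \<subseteq> carrier R" "P \<subseteq> carrier R"
  shows "ideal_prod R (ideal_prod R M N) P = ideal_prod R M (ideal_prod R N P)"
proof -
  have *: "ideal_prod R (ideal_prod R M N) P \<subseteq> ideal_prod R M (ideal_prod R N P)"
    if MNP: "M \<subseteq> carrier R" "N \<subseteq> carrier R" "P \<subseteq> carrier R" for M N P
  proof (rule ideal_prod_least)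
    fix a c assume a: "a \<in> ideal_prod R M N" and c: "c \<in> P"
    from a show "a \<otimes> c \<in> ideal_prod R M (ideal_prod R N P)"
    proof (induction rule: ideal_prod.induct)
      case (prod m n)
      then have "m \<otimes> n \<otimes> c = m \<otimes> (n \<otimes> c)" using MNP c by (auto intro: m_assoc)
      then show ?case using prod c by (auto intro: ideal_prod.prod)
    next
      case (sum s1 s2)
      have "s1 \<in> carrier R" "s2 \<in> carrier R" "c \<in> carrier R"
        using ideal_prod_closed[OF MNP(1,2)] sum.hyps c MNP by auto
      then have "(s1 \<oplus> s2) \<otimes> c = s1 \<otimes> c \<oplus> s2 \<otimes> c" by (rule l_distr)
      then show ?case using sum.IH by (simp add: ideal_prod.sum)
    qed
  qed (rule ideal_prod.sum)
  have sub: "ideal_prod R M N \<subseteq> carrier R" "ideal_prod R N P \<subseteq> carrier R"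
    using ideal_prod_closed assms by blast+
  have "ideal_prod R M (ideal_prod R N P) = ideal_prod R (ideal_prod R N P) M"
    by (rule ideal_prod_comm[OF assms(1) sub(2)])
  also have "\<dots> = ideal_prod R (ideal_prod R P N) M"
    by (subst ideal_prod_comm[OF assms(2,3)]) (rule refl)
  also have "\<dots> \<subseteq> ideal_prod R P (ideal_prod R N M)" by (rule *[OF assms(3,2,1)])
  also have "\<dots> = ideal_prod R P (ideal_prod R M N)"
    by (subst ideal_prod_comm[OF assms(2,1)]) (rule refl)
  also have "\<dots> = ideal_prod R (ideal_prod R M N) P"
    by (rule ideal_prod_comm[OF assms(3) sub(1)])
  finally show ?thesis using *[OF assms] by blast
qed

lemma subalgebra_ideal_prod:
  assumes K: "K \<subseteq> carrier R" and M: "subalgebra K M R" and N: "subalgebra K N R"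
  shows "subalgebra K (ideal_prod R M N) R"
proof -
  have MN: "M \<subseteq> carrier R" "N \<subseteq> carrier R" "\<zero> \<in> M" "\<zero> \<in> N" "\<And>a. a \<in> M \<Longrightarrow> \<ominus> a \<in> M"
    "\<And>k a. k \<in> K \<Longrightarrow> a \<in> M \<Longrightarrow> k \<otimes> a \<in> M"
    using M N by (auto simp: subalgebra_iff)
  note cl = ideal_prod_closed[OF MN(1,2)]
  show ?thesis
    unfolding subalgebra_iff
  proof (intro conjI ballI)
    show "ideal_prod R M N \<subseteq> carrier R" using cl by blast
    have "\<zero> \<otimes> \<zero> \<in> ideal_prod R M N" using MN by (intro ideal_prod.prod)
    then show "\<zero> \<in> ideal_prod R M N" by simp
    fix a assume a: "a \<in> ideal_prod R M N"
    then show "a \<oplus> b \<in> ideal_prod R M N" if "b \<in> ideal_prod R M N" for b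
      using that by (rule ideal_prod.sum)
    show "\<ominus> a \<in> ideal_prod R M N"
      using a
    proof (induction rule: ideal_prod.induct)
      case (prod m n)
      then have "\<ominus> (m \<otimes> n) = (\<ominus> m) \<otimes> n" using MN(1,2) by (metis l_minus subsetD)
      then show ?case using prod MN by (auto intro: ideal_prod.prod)
    next
      case (sum s1 s2)
      then have "\<ominus> (s1 \<oplus> s2) = \<ominus> s1 \<oplus> \<ominus> s2" using cl by (simp add: minus_add)
      then show ?case using sum.IH by (simp add: ideal_prod.sum)
    qed
    fix k assume k: "k \<in> K"
    show "k \<otimes> a \<in> ideal_prod R M N"
      using a
    proof (induction rule: ideal_prod.induct)
      case (prod m n)
      then have "k \<otimes> (m \<otimes> n) = (k \<otimes> m) \<otimes> n" using MN(1,2) k K by (metis m_assoc subsetD)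
      then show ?case using prod MN k by (auto intro: ideal_prod.prod)
    next
      case (sum s1 s2)
      then have "k \<otimes> (s1 \<oplus> s2) = k \<otimes> s1 \<oplus> k \<otimes> s2" using cl k K by (auto intro: r_distr)
      then show ?case using sum.IH by (simp add: ideal_prod.sum)
    qed
  qed
qed

lemma ideal_prod_subring_left:
  assumes K: "subring K R" and M: "subalgebra K M R"
  shows "ideal_prod R K M = M"
proof
  show "ideal_prod R K M \<subseteq> M"
    using M by (intro ideal_prod_least) (auto simp: subalgebra_iff)
  show "M \<subseteq> ideal_prod R K M"
  proof
    fix a assume a: "a \<in> M"
    then have "\<one> \<otimes> a \<in> ideal_prod R K M" using subringE(3)[OF K] by (intro ideal_prod.prod)
    then show "a \<in> ideal_prod R K M" using a M by (auto simp: subalgebra_iff)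
  qed
qed

text \<open>Submodule products are associative and commutative, so the invertible elements of the resulting
commutative monoid form a group.\<close>

lemma group_invertible_submodules:
  assumes K: "subring K R"
  shows "group (invertible_submodules R K)"
proof (rule groupI)
  let ?I = "invertible_submodules R K"
  have Kc: "K \<subseteq> carrier R" using subringE(1)[OF K] .
  have KK: "subalgebra K K R" using subringE[OF K] by (auto simp: subalgebra_iff)
  have car: "M \<in> carrier ?I \<longleftrightarrow> subalgebra K M R \<and> (\<exists>N. subalgebra K N R \<and> ideal_prod R M N = K)" for M
    by (simp add: invertible_submodules_def)
  have sub: "M \<subseteq> carrier R" if "subalgebra K M R" for M using that by (simp add: subalgebra_iff)
  have mult: "M \<otimes>\<^bsub>?I\<^esub> N = ideal_prod R M N" for M N by (simp add: invertible_submodules_def)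
  have one: "\<one>\<^bsub>?I\<^esub> = K" by (simp add: invertible_submodules_def)
  show "\<one>\<^bsub>?I\<^esub> \<in> carrier ?I"
    unfolding car one using KK ideal_prod_subring_left[OF K KK] by blast
  fix M assume "M \<in> carrier ?I"
  then obtain M' where M: "subalgebra K M R" "subalgebra K M' R" "ideal_prod R M M' = K"
    by (auto simp: car)
  show "\<one>\<^bsub>?I\<^esub> \<otimes>\<^bsub>?I\<^esub> M = M" unfolding one mult by (rule ideal_prod_subring_left[OF K M(1)])
  have M'M: "ideal_prod R M' M = K" using ideal_prod_comm[OF sub sub] M by simp
  then have "M' \<in> carrier ?I" using M by (auto simp: car)
  then show "\<exists>N\<in>carrier ?I. N \<otimes>\<^bsub>?I\<^esub> M = \<one>\<^bsub>?I\<^esub>" using M'M by (auto simp: mult one)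
  fix N assume "N \<in> carrier ?I"
  then obtain N' where N: "subalgebra K N R" "subalgebra K N' R" "ideal_prod R N N' = K"
    by (auto simp: car)
  have "ideal_prod R (ideal_prod R M N) (ideal_prod R N' M') = K"
  proof -
    have NM: "ideal_prod R N' M' \<subseteq> carrier R"
      using sub subalgebra_ideal_prod[OF Kc] M N by blast
    have "ideal_prod R (ideal_prod R M N) (ideal_prod R N' M')
       = ideal_prod R M (ideal_prod R (ideal_prod R N N') M')"
      using NM sub M(1,2) N(1,2) by (simp add: ideal_prod_assoc)
    then show ?thesis using N M ideal_prod_subring_left[OF K M(2)] by simp
  qed
  then show "M \<otimes>\<^bsub>?I\<^esub> N \<in> carrier ?I"
    unfolding mult car using subalgebra_ideal_prod[OF Kc] M N by blast
  fix P assume "P \<in> carrier ?I"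
  then show "M \<otimes>\<^bsub>?I\<^esub> N \<otimes>\<^bsub>?I\<^esub> P = M \<otimes>\<^bsub>?I\<^esub> (N \<otimes>\<^bsub>?I\<^esub> P)"
    unfolding mult using sub M N by (simp add: ideal_prod_assoc car)
qed

end

section \<open>Eigenmodules and twisted traces\<close>

context ring_partial_action begin

abbreviation invs :: "'a set" where "invs \<equiv> partial_invariants G S D \<alpha>"

lemma invsD:
  "a \<in> invs \<Longrightarrow> a \<in> carrier S" "a \<in> invs \<Longrightarrow> g \<in> carrier G \<Longrightarrow> act g a = a \<otimes> e g"
  by (auto simp: partial_invariants_eq)

lemma act_invs_mult:
  assumes "r \<in> invs" "g \<in> carrier G" "a \<in> carrier S"
  shows "act g (r \<otimes> a) = r \<otimes> act g a"
  using assms invsD by (simp add: m_assoc)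

text \<open>Makes the inverse of the group order available as a scalar of the modules below.\<close>

lemma inverse_in_invs:
  assumes r: "r \<in> invs" and u: "u \<in> carrier S" "r \<otimes> u = \<one>"
  shows "u \<in> invs"
  unfolding partial_invariants_eq
proof (intro CollectI conjI ballI u)
  fix g assume g: "g \<in> carrier G"
  have rc: "r \<in> carrier S" using r invsD by blast
  have "r \<otimes> act g u = e g" using act_invs_mult[OF r g u(1)] u g by simp
  then have "u \<otimes> e g = u \<otimes> (r \<otimes> act g u)" by simp
  also have "\<dots> = (r \<otimes> u) \<otimes> act g u" using rc u(1) g by (simp add: m_ac)
  finally show "act g u = u \<otimes> e g" using u g by simp
qed

lemma translate_bij: "g \<in> carrier G \<Longrightarrow> (\<lambda>h. g \<bullet> h) ` carrier G = carrier G"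
  using G.surj_const_mult .

lemma finsum_translate:
  assumes g: "g \<in> carrier G" and f: "\<And>h. h \<in> carrier G \<Longrightarrow> f h \<in> carrier S"
  shows "(\<Oplus>h\<in>carrier G. f (g \<bullet> h)) = (\<Oplus>h\<in>carrier G. f h)"
proof -
  have "inj_on (\<lambda>h. g \<bullet> h) (carrier G)" using g by (simp add: inj_on_def)
  then have "(\<Oplus>h\<in>(\<lambda>h. g \<bullet> h) ` carrier G. f h) = (\<Oplus>h\<in>carrier G. f (g \<bullet> h))"
    using f by (intro finsum_reindex) (auto simp: translate_bij[OF g])
  then show ?thesis by (simp add: translate_bij[OF g])
qed

text \<open>Characters are considered up to their values on \<open>G\<close>, so that the trivial character, inverses and
products can be written as plain functions.\<close>

definition invariant_character :: "('c \<Rightarrow> 'a) \<Rightarrow> bool" where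
  "invariant_character \<chi> \<longleftrightarrow> \<chi> \<in> carrier G \<rightarrow> invs \<and> \<chi> \<one>\<^bsub>G\<^esub> = \<one> \<and>
     (\<forall>g\<in>carrier G. \<forall>h\<in>carrier G. \<chi> (g \<bullet> h) = \<chi> g \<otimes> \<chi> h)"

text \<open>The module of the cocycle \<open>g \<mapsto> \<chi> g e g\<close> attached to a character.\<close>

definition eigenmodule :: "('c \<Rightarrow> 'a) \<Rightarrow> 'a set" where
  "eigenmodule \<chi> = {a \<in> carrier S. \<forall>g\<in>carrier G. act g a = \<chi> g \<otimes> e g \<otimes> a}"

definition twisted_trace :: "('c \<Rightarrow> 'a) \<Rightarrow> 'a \<Rightarrow> 'a" where
  "twisted_trace \<chi> a = (\<Oplus>g\<in>carrier G. \<chi> (inv\<^bsub>G\<^esub> g) \<otimes> act g a)"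

abbreviation trace :: "'a \<Rightarrow> 'a" where "trace \<equiv> twisted_trace (\<lambda>_. \<one>)"

lemma invariant_characterD:
  assumes "invariant_character \<chi>"
  shows "g \<in> carrier G \<Longrightarrow> \<chi> g \<in> invs" "g \<in> carrier G \<Longrightarrow> \<chi> g \<in> carrier S" "\<chi> \<one>\<^bsub>G\<^esub> = \<one>"
    "g \<in> carrier G \<Longrightarrow> h \<in> carrier G \<Longrightarrow> \<chi> (g \<bullet> h) = \<chi> g \<otimes> \<chi> h"
    "g \<in> carrier G \<Longrightarrow> \<chi> g \<otimes> \<chi> (inv\<^bsub>G\<^esub> g) = \<one>" "g \<in> carrier G \<Longrightarrow> \<chi> (inv\<^bsub>G\<^esub> g) \<otimes> \<chi> g = \<one>"
proof -
  note * = assms[unfolded invariant_character_def]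
  show "g \<in> carrier G \<Longrightarrow> \<chi> g \<in> invs" "g \<in> carrier G \<Longrightarrow> \<chi> g \<in> carrier S" "\<chi> \<one>\<^bsub>G\<^esub> = \<one>"
    "g \<in> carrier G \<Longrightarrow> h \<in> carrier G \<Longrightarrow> \<chi> (g \<bullet> h) = \<chi> g \<otimes> \<chi> h"
    using * invsD(1) by auto
  show "\<chi> g \<otimes> \<chi> (inv\<^bsub>G\<^esub> g) = \<one>" "\<chi> (inv\<^bsub>G\<^esub> g) \<otimes> \<chi> g = \<one>" if "g \<in> carrier G"
    using * that by (metis G.inv_closed G.r_inv, metis G.inv_closed G.l_inv)
qed

lemma one_in_invs: "\<one> \<in> invs"
  by (auto simp: partial_invariants_eq)

lemma invs_mult:
  assumes a: "a \<in> invs" and b: "b \<in> invs"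
  shows "a \<otimes> b \<in> invs"
proof -
  have c: "a \<in> carrier S" "b \<in> carrier S" using a b invsD(1) by blast+
  have "act g (a \<otimes> b) = a \<otimes> b \<otimes> e g" if g: "g \<in> carrier G" for g
    unfolding act_invs_mult[OF a g c(2)] invsD(2)[OF b g] using c g by (simp add: m_assoc)
  then show ?thesis using c by (simp add: partial_invariants_eq)
qed

lemma trivial_character: "invariant_character (\<lambda>_. \<one>)"
  by (auto simp: invariant_character_def one_in_invs)

lemma inverse_character:
  assumes "invariant_character \<chi>"
  shows "invariant_character (\<lambda>g. \<chi> (inv\<^bsub>G\<^esub> g))"
  unfolding invariant_character_def
proof (intro conjI ballI)
  note X = invariant_characterD[OF assms]
  show "(\<lambda>g. \<chi> (inv\<^bsub>G\<^esub> g)) \<in> carrier G \<rightarrow> invs" using X(1) by simp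
  show "\<chi> (inv\<^bsub>G\<^esub> \<one>\<^bsub>G\<^esub>) = \<one>" using X(3) by simp
  fix g h assume gh: "g \<in> carrier G" "h \<in> carrier G"
  then have "\<chi> (inv\<^bsub>G\<^esub> (g \<bullet> h)) = \<chi> (inv\<^bsub>G\<^esub> h) \<otimes> \<chi> (inv\<^bsub>G\<^esub> g)"
    using X(4)[of "inv\<^bsub>G\<^esub> h" "inv\<^bsub>G\<^esub> g"] by (simp add: G.inv_mult_group)
  then show "\<chi> (inv\<^bsub>G\<^esub> (g \<bullet> h)) = \<chi> (inv\<^bsub>G\<^esub> g) \<otimes> \<chi> (inv\<^bsub>G\<^esub> h)"
    using m_comm[of "\<chi> (inv\<^bsub>G\<^esub> h)" "\<chi> (inv\<^bsub>G\<^esub> g)"] X(2) gh by simp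
qed

lemma eigenmodule_subset: "eigenmodule \<chi> \<subseteq> carrier S"
  by (auto simp: eigenmodule_def)

lemma eigenmodule_trivial: "eigenmodule (\<lambda>_. \<one>) = invs"
  by (auto simp: eigenmodule_def partial_invariants_eq m_comm)

lemma eigenmodule_cong:
  "(\<And>g. g \<in> carrier G \<Longrightarrow> \<chi> g = \<eta> g) \<Longrightarrow> eigenmodule \<chi> = eigenmodule \<eta>"
  by (simp add: eigenmodule_def)

lemma subalgebra_eigenmodule:
  assumes \<chi>: "invariant_character \<chi>"
  shows "subalgebra invs (eigenmodule \<chi>) S"
  unfolding subalgebra_iff
proof (intro conjI ballI)
  note X = invariant_characterD[OF \<chi>]
  show "eigenmodule \<chi> \<subseteq> carrier S" by (rule eigenmodule_subset)
  show "\<zero> \<in> eigenmodule \<chi>" using X(2) by (simp add: eigenmodule_def)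
  fix a assume a: "a \<in> eigenmodule \<chi>"
  then show "a \<oplus> b \<in> eigenmodule \<chi>" if "b \<in> eigenmodule \<chi>" for b
    using that X(2) by (simp add: eigenmodule_def r_distr)
  have "act g (\<ominus> a) = \<ominus> act g a" if "g \<in> carrier G" for g
  proof -
    have ac: "a \<in> carrier S" using a by (simp add: eigenmodule_def)
    then have "act g (\<ominus> a) \<oplus> act g a = act g (\<ominus> a \<oplus> a)" using that by simp
    also have "\<dots> = \<zero>" using that ac by (simp add: l_neg)
    finally show ?thesis using that ac by (metis a_inv_closed act_closed minus_equality)
  qed
  then show "\<ominus> a \<in> eigenmodule \<chi>" using a X(2) by (simp add: eigenmodule_def r_minus)
  show "k \<otimes> a \<in> eigenmodule \<chi>" if k: "k \<in> invs" for k
    unfolding eigenmodule_def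
  proof (intro CollectI conjI ballI)
    have c: "a \<in> carrier S" "k \<in> carrier S" using a invsD(1)[OF k] by (auto simp: eigenmodule_def)
    then show "k \<otimes> a \<in> carrier S" by simp
    fix g assume g: "g \<in> carrier G"
    have "act g (k \<otimes> a) = k \<otimes> (\<chi> g \<otimes> e g \<otimes> a)"
      unfolding act_invs_mult[OF k g c(1)] using a g by (simp add: eigenmodule_def)
    then show "act g (k \<otimes> a) = \<chi> g \<otimes> e g \<otimes> (k \<otimes> a)"
      using c g X(2) by (simp add: m_lcomm m_assoc)
  qed
qed

lemma eigenmodule_finsum:
  assumes \<chi>: "invariant_character \<chi>" and "finite I" "\<And>i. i \<in> I \<Longrightarrow> a i \<in> eigenmodule \<chi>"
  shows "(\<Oplus>i\<in>I. a i) \<in> eigenmodule \<chi>"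
  using assms(2,3)
proof (induction I rule: finite_induct)
  case empty
  then show ?case using subalgebra_eigenmodule[OF \<chi>] by (simp add: subalgebra_iff)
next
  case (insert i I)
  have "a \<in> I \<rightarrow> carrier S" "a i \<in> carrier S" using insert.prems eigenmodule_subset[of \<chi>] by blast+
  then show ?case using subalgebra_eigenmodule[OF \<chi>] insert by (simp add: subalgebra_iff)
qed

lemma eigenmodule_mult:
  assumes \<chi>: "invariant_character \<chi>" and \<eta>: "invariant_character \<eta>"
    and a: "a \<in> eigenmodule \<chi>" and b: "b \<in> eigenmodule \<eta>"
  shows "a \<otimes> b \<in> eigenmodule (\<lambda>g. \<chi> g \<otimes> \<eta> g)"
  unfolding eigenmodule_def
proof (intro CollectI conjI ballI)
  have ab: "a \<in> carrier S" "b \<in> carrier S" using a b by (auto simp: eigenmodule_def)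
  then show "a \<otimes> b \<in> carrier S" by simp
  fix g assume g: "g \<in> carrier G"
  have "act g (a \<otimes> b) = (\<chi> g \<otimes> e g \<otimes> a) \<otimes> (\<eta> g \<otimes> e g \<otimes> b)"
    using a b g ab by (simp add: eigenmodule_def)
  also have "\<dots> = \<chi> g \<otimes> \<eta> g \<otimes> (e g \<otimes> e g) \<otimes> (a \<otimes> b)"
    using ab invariant_characterD(2)[OF \<chi> g] invariant_characterD(2)[OF \<eta> g] e_closed[OF g]
    by (simp only: m_ac m_closed)
  finally show "act g (a \<otimes> b) = \<chi> g \<otimes> \<eta> g \<otimes> e g \<otimes> (a \<otimes> b)" using g by simp
qed

lemma twisted_trace_closed [simp]:
  assumes "invariant_character \<chi>" "a \<in> carrier S"
  shows "twisted_trace \<chi> a \<in> carrier S"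
  unfolding twisted_trace_def using assms invariant_characterD(2)[OF assms(1)] by (auto intro!: finsum_closed)

text \<open>Applying \<open>act h\<close> permutes the summands up to the factor \<open>\<chi> h e h\<close>, since
\<open>\<chi> (g\<inverse>) = \<chi> h \<chi> ((h g)\<inverse>)\<close>.\<close>

lemma twisted_trace_in_eigenmodule:
  assumes \<chi>: "invariant_character \<chi>" and a: "a \<in> carrier S"
  shows "twisted_trace \<chi> a \<in> eigenmodule \<chi>"
  unfolding eigenmodule_def
proof (intro CollectI conjI ballI)
  show "twisted_trace \<chi> a \<in> carrier S" using assms by simp
  note X = invariant_characterD[OF \<chi>]
  fix h assume h: "h \<in> carrier G"
  define F where "F k = \<chi> (inv\<^bsub>G\<^esub> k) \<otimes> act k a" for k
  have Fc: "F k \<in> carrier S" if "k \<in> carrier G" for k unfolding F_def using that a X(2) by simp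
  have "act h (twisted_trace \<chi> a) = (\<Oplus>g\<in>carrier G. act h (F g))"
    unfolding twisted_trace_def F_def[symmetric] using h finite_G Fc by (intro act_finsum) auto
  also have "\<dots> = (\<Oplus>g\<in>carrier G. (\<chi> h \<otimes> e h) \<otimes> F (h \<bullet> g))"
  proof (rule finsum_cong')
    show "(\<lambda>g. (\<chi> h \<otimes> e h) \<otimes> F (h \<bullet> g)) \<in> carrier G \<rightarrow> carrier S" using h Fc X(2) by simp
    fix g assume g: "g \<in> carrier G"
    have c: "\<chi> h \<in> carrier S" "\<chi> (inv\<^bsub>G\<^esub> g) \<in> carrier S" "\<chi> (inv\<^bsub>G\<^esub> h) \<in> carrier S"
      "e h \<in> carrier S" "act (h \<bullet> g) a \<in> carrier S" using g h a X(2) by auto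
    have "\<chi> (inv\<^bsub>G\<^esub> (h \<bullet> g)) = \<chi> (inv\<^bsub>G\<^esub> g) \<otimes> \<chi> (inv\<^bsub>G\<^esub> h)"
      using g h X(4) by (simp add: G.inv_mult_group)
    then have "(\<chi> h \<otimes> e h) \<otimes> F (h \<bullet> g)
       = (\<chi> h \<otimes> \<chi> (inv\<^bsub>G\<^esub> h)) \<otimes> (\<chi> (inv\<^bsub>G\<^esub> g) \<otimes> (act (h \<bullet> g) a \<otimes> e h))"
      unfolding F_def using c by (simp only: m_ac m_closed)
    also have "\<dots> = \<chi> (inv\<^bsub>G\<^esub> g) \<otimes> act h (act g a)"
      using X(5)[OF h] c act_act[OF h g a] by simp
    also have "\<dots> = act h (F g)" unfolding F_def using g h a X(1) by (simp add: act_invs_mult del: act_mult)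
    finally show "act h (F g) = (\<chi> h \<otimes> e h) \<otimes> F (h \<bullet> g)" by simp
  qed simp
  also have "\<dots> = (\<chi> h \<otimes> e h) \<otimes> (\<Oplus>g\<in>carrier G. F (h \<bullet> g))"
    using h Fc X(2) finite_G by (intro finsum_rdistr[symmetric]) auto
  also have "\<dots> = \<chi> h \<otimes> e h \<otimes> twisted_trace \<chi> a"
    unfolding twisted_trace_def F_def[symmetric] using finsum_translate[OF h, of F] Fc by simp
  finally show "act h (twisted_trace \<chi> a) = \<chi> h \<otimes> e h \<otimes> twisted_trace \<chi> a" .
qed

lemma twisted_trace_invs_mult:
  assumes \<chi>: "invariant_character \<chi>" and a: "a \<in> carrier S" and r: "r \<in> invs"
  shows "twisted_trace \<chi> (r \<otimes> a) = r \<otimes> twisted_trace \<chi> a"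
proof -
  note X = invariant_characterD[OF \<chi>] and rc = invsD(1)[OF r]
  have "r \<otimes> twisted_trace \<chi> a = (\<Oplus>g\<in>carrier G. r \<otimes> (\<chi> (inv\<^bsub>G\<^esub> g) \<otimes> act g a))"
    unfolding twisted_trace_def using a rc X(2) finite_G by (intro finsum_rdistr) auto
  also have "\<dots> = twisted_trace \<chi> (r \<otimes> a)"
    unfolding twisted_trace_def
    using a rc X(2) by (intro finsum_cong') (auto simp: act_invs_mult[OF r] m_lcomm simp del: act_mult)
  finally show ?thesis by simp
qed

lemma trace_in_invs: "a \<in> carrier S \<Longrightarrow> trace a \<in> invs"
  using twisted_trace_in_eigenmodule[OF trivial_character] by (simp add: eigenmodule_trivial)

lemma subring_invs: "subring invs S"
proof (rule subringI)
  have *: "subalgebra invs invs S"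
    using subalgebra_eigenmodule[OF trivial_character] by (simp add: eigenmodule_trivial)
  show "invs \<subseteq> carrier S" "\<And>h. h \<in> invs \<Longrightarrow> \<ominus> h \<in> invs"
    "\<And>h1 h2. h1 \<in> invs \<Longrightarrow> h2 \<in> invs \<Longrightarrow> h1 \<oplus> h2 \<in> invs"
    using * by (auto simp: subalgebra_iff)
qed (use one_in_invs invs_mult in auto)

end

section \<open>Partial Galois coordinates\<close>

locale partial_galois = ring_partial_action +
  fixes l :: nat and x y :: "nat \<Rightarrow> 'a"
  assumes x_in: "x \<in> {1..l} \<rightarrow> carrier S" and y_in: "y \<in> {1..l} \<rightarrow> carrier S"
    and coordinates: "\<And>g. g \<in> carrier G \<Longrightarrow>
      (\<Oplus>i\<in>{1..l}. x i \<otimes> act g (y i)) = (if g = \<one>\<^bsub>G\<^esub> then \<one> else \<zero>)"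
begin

lemma x_closed [simp]: "i \<in> {1..l} \<Longrightarrow> x i \<in> carrier S"
  and y_closed [simp]: "i \<in> {1..l} \<Longrightarrow> y i \<in> carrier S"
  using x_in y_in by auto

text \<open>Apply \<open>act g\<close> to the Galois condition for \<open>g\<inverse> h\<close>.\<close>

lemma conjugate_coordinates:
  assumes g: "g \<in> carrier G" and h: "h \<in> carrier G"
  shows "(\<Oplus>i\<in>{1..l}. act g (x i) \<otimes> act h (y i)) = (if h = g then e g else \<zero>)"
proof -
  let ?k = "inv\<^bsub>G\<^esub> g \<bullet> h"
  have k: "?k \<in> carrier G" "g \<bullet> ?k = h" using g h by (auto simp flip: G.m_assoc)
  have k1: "?k = \<one>\<^bsub>G\<^esub> \<longleftrightarrow> h = g"
  proof
    assume "?k = \<one>\<^bsub>G\<^esub>"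
    then show "h = g" using k(2) g by simp
  qed (use g in simp)
  have "(\<Oplus>i\<in>{1..l}. act g (x i) \<otimes> act h (y i)) = (\<Oplus>i\<in>{1..l}. act g (x i \<otimes> act ?k (y i)))"
  proof (rule finsum_cong')
    fix i assume i: "i \<in> {1..l}"
    have "act g (x i \<otimes> act ?k (y i)) = act g (x i) \<otimes> (act h (y i) \<otimes> e g)"
      using i g k act_act[OF g k(1), of "y i"] by simp
    also have "\<dots> = (act g (x i) \<otimes> e g) \<otimes> act h (y i)"
    proof -
      have "act g (x i) \<in> carrier S" "act h (y i) \<in> carrier S" "e g \<in> carrier S" using i g h by auto
      then show ?thesis by (simp only: m_ac m_closed)
    qed
    also have "\<dots> = act g (x i) \<otimes> act h (y i)" using i g by simp
    finally show "act g (x i) \<otimes> act h (y i) = act g (x i \<otimes> act ?k (y i))" by simp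
  qed (use g k in auto)
  also have "\<dots> = act g (\<Oplus>i\<in>{1..l}. x i \<otimes> act ?k (y i))"
    using g k by (intro act_finsum[symmetric]) auto
  also have "\<dots> = (if h = g then e g else \<zero>)"
    unfolding coordinates[OF k(1)] k1 using g by simp
  finally show ?thesis .
qed

lemma dual_basis:
  assumes a: "a \<in> carrier S"
  shows "a = (\<Oplus>i\<in>{1..l}. x i \<otimes> trace (y i \<otimes> a))"
proof -
  have "(\<Oplus>i\<in>{1..l}. x i \<otimes> trace (y i \<otimes> a))
      = (\<Oplus>i\<in>{1..l}. \<Oplus>g\<in>carrier G. (x i \<otimes> act g (y i)) \<otimes> act g a)"
  proof (rule finsum_cong')
    fix i assume i: "i \<in> {1..l}"
    have "x i \<otimes> trace (y i \<otimes> a) = (\<Oplus>g\<in>carrier G. x i \<otimes> (\<one> \<otimes> act g (y i \<otimes> a)))"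
      unfolding twisted_trace_def using i a finite_G by (intro finsum_rdistr) auto
    also have "\<dots> = (\<Oplus>g\<in>carrier G. (x i \<otimes> act g (y i)) \<otimes> act g a)"
      using i a by (intro finsum_cong') (auto simp: m_assoc)
    finally show "x i \<otimes> trace (y i \<otimes> a) = (\<Oplus>g\<in>carrier G. (x i \<otimes> act g (y i)) \<otimes> act g a)" .
  qed (use a in \<open>auto intro!: finsum_closed\<close>)
  also have "\<dots> = (\<Oplus>g\<in>carrier G. \<Oplus>i\<in>{1..l}. (x i \<otimes> act g (y i)) \<otimes> act g a)"
    using a finite_G by (intro finsum_swap) auto
  also have "\<dots> = (\<Oplus>g\<in>carrier G. if g = \<one>\<^bsub>G\<^esub> then act g a else \<zero>)"
  proof (rule finsum_cong')
    fix g assume g: "g \<in> carrier G"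
    have "(\<Oplus>i\<in>{1..l}. (x i \<otimes> act g (y i)) \<otimes> act g a) = (\<Oplus>i\<in>{1..l}. x i \<otimes> act g (y i)) \<otimes> act g a"
      using g a by (intro finsum_ldistr[symmetric]) auto
    then show "(\<Oplus>i\<in>{1..l}. (x i \<otimes> act g (y i)) \<otimes> act g a) = (if g = \<one>\<^bsub>G\<^esub> then act g a else \<zero>)"
      using coordinates[OF g] g a by simp
  qed (use a in auto)
  also have "\<dots> = act \<one>\<^bsub>G\<^esub> a" using finite_G a by (intro finsum_delta) auto
  finally show ?thesis using a by simp
qed

text \<open>The image of the trace is an ideal of the invariants, and by the dual basis it reproduces all
the generators \<open>x i\<close>. By Nakayama some \<open>v\<close> with \<open>1 - v\<close> a trace kills all \<open>x i\<close>; then \<open>v = 0\<close>,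
because \<open>\<Sum> x i y i = 1\<close>.\<close>

lemma trace_surj: "\<exists>c\<in>carrier S. trace c = \<one>"
proof -
  let ?I = "trace ` carrier S"
  note tc = trivial_character
  have I_in: "?I \<subseteq> invs" using trace_in_invs by blast
  have c: "trace a \<in> carrier S" if "a \<in> carrier S" for a using that tc by simp
  have mult: "r \<otimes> trace a \<in> ?I" if "a \<in> carrier S" "r \<in> invs" for a r
    using that twisted_trace_invs_mult[OF tc that] invsD(1)[OF that(2)] by (metis imageI m_closed)
  have add: "trace a \<oplus> trace b = trace (a \<oplus> b)" if "a \<in> carrier S" "b \<in> carrier S" for a b
  proof -
    have "trace (a \<oplus> b) = (\<Oplus>g\<in>carrier G. \<one> \<otimes> act g a \<oplus> \<one> \<otimes> act g b)"
      unfolding twisted_trace_def using that by (intro finsum_cong') auto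
    then show ?thesis
      unfolding twisted_trace_def using that by (subst (asm) finsum_addf) auto
  qed
  have minus_one: "\<ominus> \<one> \<in> invs" using subringE(3,5)[OF subring_invs] by blast
  have "\<exists>v\<in>carrier S. \<one> \<ominus> v \<in> ?I \<and> (\<forall>j\<in>{1..l}. v \<otimes> x j = \<zero>)"
  proof (rule annihilator_of_generators[where a = "\<lambda>j i. trace (y i \<otimes> x j)" and u = \<one>])
    show "?I \<subseteq> carrier S" using c by blast
    have tz: "trace \<zero> = \<zero>" unfolding twisted_trace_def by (intro add.finprod_one_eqI) simp
    show "\<zero> \<in> ?I" using tz by (metis imageI zero_closed)
    show "\<one> \<ominus> \<one> \<in> ?I" using tz by (metis imageI zero_closed a_minus_def r_neg one_closed)
    show "a \<oplus> b \<in> ?I" if "a \<in> ?I" "b \<in> ?I" for a b using that add by auto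
    show "a \<otimes> b \<in> ?I" if "a \<in> ?I" "b \<in> ?I" for a b using that mult I_in by blast
    show "\<ominus> a \<in> ?I" if aI: "a \<in> ?I" for a
    proof -
      have "\<ominus> a = (\<ominus> \<one>) \<otimes> a" 
        using aI subsetD[OF I_in] invsD(1) by (simp add: l_minus)
      moreover obtain b where b: "a = trace b" "b \<in> carrier S" using aI by blast
      ultimately show ?thesis using mult[OF b(2) minus_one] b(1) by simp
    qed
    show "trace (y i \<otimes> x j) \<in> ?I" if "i \<in> {1..l}" "j \<in> {1..l}" for i j using that by simp
    fix j assume j: "j \<in> {1..l}"
    have "\<one> \<otimes> x j = (\<Oplus>i\<in>{1..l}. x i \<otimes> trace (y i \<otimes> x j))" using dual_basis[of "x j"] j by simp
    also have "\<dots> = (\<Oplus>i\<in>{1..l}. trace (y i \<otimes> x j) \<otimes> x i)"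
      using j c by (intro finsum_cong') (auto simp: m_comm)
    finally show "\<one> \<otimes> x j = (\<Oplus>i\<in>{1..l}. trace (y i \<otimes> x j) \<otimes> x i)" .
  qed auto
  then obtain v where v: "v \<in> carrier S" "\<one> \<ominus> v \<in> ?I" "\<And>j. j \<in> {1..l} \<Longrightarrow> v \<otimes> x j = \<zero>" by blast
  have "v = v \<otimes> (\<Oplus>i\<in>{1..l}. x i \<otimes> act \<one>\<^bsub>G\<^esub> (y i))" using v(1) coordinates[of "\<one>\<^bsub>G\<^esub>"] by simp
  also have "\<dots> = (\<Oplus>i\<in>{1..l}. v \<otimes> (x i \<otimes> act \<one>\<^bsub>G\<^esub> (y i)))"
    using v(1) by (intro finsum_rdistr) auto
  also have "\<dots> = \<zero>"
    using v by (intro add.finprod_one_eqI) (simp flip: m_assoc)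
  finally have "\<one> \<in> ?I" using v by (simp add: a_minus_def)
  then show ?thesis by (metis imageE)
qed

text \<open>After expanding both twisted traces, the sum over \<open>i\<close> leaves only the terms in which the two group
elements agree. There the two characters cancel, and what remains is the trace of \<open>c\<close>.\<close>

lemma twisted_traces_generate_one:
  assumes \<chi>: "invariant_character \<chi>" and c: "c \<in> carrier S" "trace c = \<one>"
  shows "(\<Oplus>i\<in>{1..l}. twisted_trace \<chi> (c \<otimes> x i) \<otimes> twisted_trace (\<lambda>g. \<chi> (inv\<^bsub>G\<^esub> g)) (y i)) = \<one>"
proof -
  note X = invariant_characterD[OF \<chi>]
  let ?\<chi>' = "\<lambda>g. \<chi> (inv\<^bsub>G\<^esub> g)"
  have \<chi>': "invariant_character ?\<chi>'" using inverse_character[OF \<chi>] .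
  let ?t = "\<lambda>i. twisted_trace ?\<chi>' (y i)"
  have ty: "?t i \<in> carrier S" if "i \<in> {1..l}" for i using that \<chi>' by simp
  have inner: "(\<Oplus>i\<in>{1..l}. act g (x i) \<otimes> ?t i) = \<chi> g \<otimes> e g" if g: "g \<in> carrier G" for g
  proof -
    have "(\<Oplus>i\<in>{1..l}. act g (x i) \<otimes> ?t i)
        = (\<Oplus>i\<in>{1..l}. \<Oplus>h\<in>carrier G. \<chi> h \<otimes> (act g (x i) \<otimes> act h (y i)))"
    proof (rule finsum_cong')
      fix i assume i: "i \<in> {1..l}"
      have "act g (x i) \<otimes> ?t i
         = (\<Oplus>h\<in>carrier G. act g (x i) \<otimes> (?\<chi>' (inv\<^bsub>G\<^esub> h) \<otimes> act h (y i)))"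
        unfolding twisted_trace_def using i g X(2) finite_G by (intro finsum_rdistr) auto
      also have "\<dots> = (\<Oplus>h\<in>carrier G. \<chi> h \<otimes> (act g (x i) \<otimes> act h (y i)))"
        using i g X(2) by (intro finsum_cong') (auto simp: m_lcomm)
      finally show "act g (x i) \<otimes> ?t i = \<dots>" .
    qed (use g X(2) in \<open>auto intro!: finsum_closed\<close>)
    also have "\<dots> = (\<Oplus>h\<in>carrier G. \<Oplus>i\<in>{1..l}. \<chi> h \<otimes> (act g (x i) \<otimes> act h (y i)))"
      using g X(2) finite_G by (intro finsum_swap) auto
    also have "\<dots> = (\<Oplus>h\<in>carrier G. if h = g then \<chi> h \<otimes> e g else \<zero>)"
    proof (rule finsum_cong')
      fix h assume h: "h \<in> carrier G"
      have "(\<Oplus>i\<in>{1..l}. \<chi> h \<otimes> (act g (x i) \<otimes> act h (y i)))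
          = \<chi> h \<otimes> (\<Oplus>i\<in>{1..l}. act g (x i) \<otimes> act h (y i))"
        using g h X(2) by (intro finsum_rdistr[symmetric]) auto
      then show "(\<Oplus>i\<in>{1..l}. \<chi> h \<otimes> (act g (x i) \<otimes> act h (y i))) = (if h = g then \<chi> h \<otimes> e g else \<zero>)"
        using conjugate_coordinates[OF g h] X(2)[OF h] by simp
    qed (use g X(2) in auto)
    also have "\<dots> = \<chi> g \<otimes> e g" using g X(2) finite_G by (intro finsum_delta) auto
    finally show ?thesis .
  qed
  have "(\<Oplus>i\<in>{1..l}. twisted_trace \<chi> (c \<otimes> x i) \<otimes> ?t i)
      = (\<Oplus>i\<in>{1..l}. \<Oplus>g\<in>carrier G. (?\<chi>' g \<otimes> act g c) \<otimes> (act g (x i) \<otimes> ?t i))"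
  proof (rule finsum_cong')
    fix i assume i: "i \<in> {1..l}"
    have "twisted_trace \<chi> (c \<otimes> x i) \<otimes> ?t i
      = (\<Oplus>g\<in>carrier G. (\<chi> (inv\<^bsub>G\<^esub> g) \<otimes> act g (c \<otimes> x i)) \<otimes> ?t i)"
      unfolding twisted_trace_def[of \<chi>] using i c(1) X(2) ty finite_G by (intro finsum_ldistr) auto
    also have "\<dots> = (\<Oplus>g\<in>carrier G. (?\<chi>' g \<otimes> act g c) \<otimes> (act g (x i) \<otimes> ?t i))"
      using i c(1) X(2) ty by (intro finsum_cong') (auto simp: m_assoc)
    finally show "twisted_trace \<chi> (c \<otimes> x i) \<otimes> ?t i = \<dots>" .
  qed (use c(1) X(2) ty in \<open>auto intro!: finsum_closed\<close>)
  also have "\<dots> = (\<Oplus>g\<in>carrier G. \<Oplus>i\<in>{1..l}. (?\<chi>' g \<otimes> act g c) \<otimes> (act g (x i) \<otimes> ?t i))"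
    using c(1) X(2) ty finite_G by (intro finsum_swap) auto
  also have "\<dots> = (\<Oplus>g\<in>carrier G. \<one> \<otimes> act g c)"
  proof (rule finsum_cong')
    fix g assume g: "g \<in> carrier G"
    have "(\<Oplus>i\<in>{1..l}. (?\<chi>' g \<otimes> act g c) \<otimes> (act g (x i) \<otimes> ?t i))
       = (?\<chi>' g \<otimes> act g c) \<otimes> (\<Oplus>i\<in>{1..l}. act g (x i) \<otimes> ?t i)"
      using g c(1) X(2) ty by (intro finsum_rdistr[symmetric]) auto
    also have "\<dots> = (?\<chi>' g \<otimes> act g c) \<otimes> (\<chi> g \<otimes> e g)" unfolding inner[OF g] ..
    also have "\<dots> = (\<chi> g \<otimes> ?\<chi>' g) \<otimes> (act g c \<otimes> e g)"
    proof -
      have "\<chi> g \<in> carrier S" "?\<chi>' g \<in> carrier S" "act g c \<in> carrier S" "e g \<in> carrier S"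
        using g c(1) X(2) by auto
      then show ?thesis by (simp only: m_ac m_closed)
    qed
    also have "\<dots> = \<one> \<otimes> act g c" using X(5)[OF g] g c(1) by simp
    finally show "(\<Oplus>i\<in>{1..l}. (?\<chi>' g \<otimes> act g c) \<otimes> (act g (x i) \<otimes> ?t i)) = \<one> \<otimes> act g c" .
  qed (use c(1) in auto)
  also have "\<dots> = \<one>" using c(2) by (simp add: twisted_trace_def)
  finally show ?thesis .
qed

lemma eigenmodule_one_decomposition:
  assumes \<chi>: "invariant_character \<chi>"
  shows "\<exists>u v. (\<forall>i\<in>{1..l}. u i \<in> eigenmodule \<chi>) \<and>
    (\<forall>i\<in>{1..l}. v i \<in> eigenmodule (\<lambda>g. \<chi> (inv\<^bsub>G\<^esub> g))) \<and> (\<Oplus>i\<in>{1..l}. u i \<otimes> v i) = \<one>"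
proof -
  obtain c where c: "c \<in> carrier S" "trace c = \<one>" using trace_surj by blast
  show ?thesis
  proof (intro exI conjI ballI)
    show "(\<Oplus>i\<in>{1..l}. twisted_trace \<chi> (c \<otimes> x i) \<otimes> twisted_trace (\<lambda>g. \<chi> (inv\<^bsub>G\<^esub> g)) (y i)) = \<one>"
      by (rule twisted_traces_generate_one[OF \<chi> c])
    fix i assume "i \<in> {1..l}"
    then show "twisted_trace \<chi> (c \<otimes> x i) \<in> eigenmodule \<chi>"
      "twisted_trace (\<lambda>g. \<chi> (inv\<^bsub>G\<^esub> g)) (y i) \<in> eigenmodule (\<lambda>g. \<chi> (inv\<^bsub>G\<^esub> g))"
      using c(1) by (auto intro!: twisted_trace_in_eigenmodule inverse_character \<chi>)
  qed
qed

text \<open>The annihilator of \<open>eigenmodule \<chi>\<close> is zero, as this module generates the unit ideal of \<open>S\<close>.\<close>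

lemma eigenmodule_cancel:
  assumes \<chi>: "invariant_character \<chi>" and p: "p \<in> carrier S" and q: "q \<in> carrier S"
    and eq: "\<And>v. v \<in> eigenmodule \<chi> \<Longrightarrow> p \<otimes> v = q \<otimes> v"
  shows "p = q"
proof -
  obtain u v where uv: "\<And>i. i \<in> {1..l} \<Longrightarrow> u i \<in> eigenmodule \<chi>"
    "\<And>i. i \<in> {1..l} \<Longrightarrow> v i \<in> eigenmodule (\<lambda>g. \<chi> (inv\<^bsub>G\<^esub> g))"
    "(\<Oplus>i\<in>{1..l}. u i \<otimes> v i) = \<one>"
    using eigenmodule_one_decomposition[OF \<chi>] by blast
  have uvc: "u i \<in> carrier S" "v i \<in> carrier S" if "i \<in> {1..l}" for i
    by (rule subsetD[OF eigenmodule_subset uv(1)[OF that]], rule subsetD[OF eigenmodule_subset uv(2)[OF that]])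
  have expand: "r = (\<Oplus>i\<in>{1..l}. (r \<otimes> u i) \<otimes> v i)" if r: "r \<in> carrier S" for r
  proof -
    have "r = r \<otimes> (\<Oplus>i\<in>{1..l}. u i \<otimes> v i)" using r uv(3) by simp
    also have "\<dots> = (\<Oplus>i\<in>{1..l}. r \<otimes> (u i \<otimes> v i))" using r uvc by (intro finsum_rdistr) auto
    also have "\<dots> = (\<Oplus>i\<in>{1..l}. (r \<otimes> u i) \<otimes> v i)"
      using r uvc by (intro finsum_cong') (auto simp: m_assoc)
    finally show ?thesis .
  qed
  have "(\<Oplus>i\<in>{1..l}. (p \<otimes> u i) \<otimes> v i) = (\<Oplus>i\<in>{1..l}. (q \<otimes> u i) \<otimes> v i)"
    using q uvc eq[OF uv(1)] by (intro finsum_cong') auto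
  then show ?thesis using expand[OF p] expand[OF q] by simp
qed

lemma eigenmodule_prod_inverse:
  assumes \<chi>: "invariant_character \<chi>"
  shows "ideal_prod S (eigenmodule \<chi>) (eigenmodule (\<lambda>g. \<chi> (inv\<^bsub>G\<^esub> g))) = invs"
proof
  let ?\<chi>' = "\<lambda>g. \<chi> (inv\<^bsub>G\<^esub> g)"
  note \<chi>' = inverse_character[OF \<chi>]
  show "ideal_prod S (eigenmodule \<chi>) (eigenmodule ?\<chi>') \<subseteq> invs"
  proof (rule ideal_prod_least)
    fix a b assume ab: "a \<in> eigenmodule \<chi>" "b \<in> eigenmodule ?\<chi>'"
    have "eigenmodule (\<lambda>g. \<chi> g \<otimes> ?\<chi>' g) = eigenmodule (\<lambda>_. \<one>)"
      using invariant_characterD(5)[OF \<chi>] by (intro eigenmodule_cong)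
    then show "a \<otimes> b \<in> invs" using eigenmodule_mult[OF \<chi> \<chi>' ab] eigenmodule_trivial by simp
  qed (use subringE(7)[OF subring_invs] in blast)
  have sub: "subalgebra invs (ideal_prod S (eigenmodule \<chi>) (eigenmodule ?\<chi>')) S"
    using subringE(1)[OF subring_invs] by (intro subalgebra_ideal_prod subalgebra_eigenmodule \<chi> \<chi>')
  have "\<zero> \<in> eigenmodule \<chi>" "\<zero> \<in> eigenmodule ?\<chi>'"
    using subalgebra_eigenmodule[OF \<chi>] subalgebra_eigenmodule[OF \<chi>'] by (auto simp: subalgebra_iff)
  moreover obtain u v where uv: "\<And>i. i \<in> {1..l} \<Longrightarrow> u i \<in> eigenmodule \<chi>"
    "\<And>i. i \<in> {1..l} \<Longrightarrow> v i \<in> eigenmodule ?\<chi>'" "(\<Oplus>i\<in>{1..l}. u i \<otimes> v i) = \<one>"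
    using eigenmodule_one_decomposition[OF \<chi>] by blast
  ultimately have "\<one> \<in> ideal_prod S (eigenmodule \<chi>) (eigenmodule ?\<chi>')"
    using finsum_in_ideal_prod[of "{1..l}" "eigenmodule \<chi>" "eigenmodule ?\<chi>'" u v]
    by (simp add: eigenmodule_subset)
  then have one: "r \<otimes> \<one> \<in> ideal_prod S (eigenmodule \<chi>) (eigenmodule ?\<chi>')" if "r \<in> invs" for r
    using sub that by (simp add: subalgebra_iff)
  show "invs \<subseteq> ideal_prod S (eigenmodule \<chi>) (eigenmodule ?\<chi>')"
    using one invsD(1) by (metis r_one subsetI)
qed

lemma eigenmodule_invertible:
  assumes \<chi>: "invariant_character \<chi>"
  shows "eigenmodule \<chi> \<in> carrier (invertible_submodules S invs)"
  using eigenmodule_prod_inverse[OF \<chi>] subalgebra_eigenmodule[OF \<chi>]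
    subalgebra_eigenmodule[OF inverse_character[OF \<chi>]]
  by (auto simp: invertible_submodules_def)

text \<open>The nontrivial inclusion is formal: \<open>Q\<^bsub>\<chi>\<eta>\<^esub> = Q\<^sub>\<chi> Q\<^bsub>\<chi>\<inverse>\<^esub> Q\<^bsub>\<chi>\<eta>\<^esub> \<subseteq> Q\<^sub>\<chi> Q\<^sub>\<eta>\<close>.\<close>

lemma eigenmodule_prod:
  assumes \<chi>: "invariant_character \<chi>" and \<eta>: "invariant_character \<eta>"
  shows "ideal_prod S (eigenmodule \<chi>) (eigenmodule \<eta>) = eigenmodule (\<lambda>g. \<chi> g \<otimes> \<eta> g)"
proof
  let ?\<chi>' = "\<lambda>g. \<chi> (inv\<^bsub>G\<^esub> g)" and ?\<chi>\<eta> = "\<lambda>g. \<chi> g \<otimes> \<eta> g"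
  note \<chi>' = inverse_character[OF \<chi>]
  note X = invariant_characterD[OF \<chi>] and Y = invariant_characterD[OF \<eta>]
  have \<chi>\<eta>: "invariant_character ?\<chi>\<eta>"
    unfolding invariant_character_def
  proof (intro conjI ballI)
    show "?\<chi>\<eta> \<in> carrier G \<rightarrow> invs" using X(1) Y(1) invs_mult by blast
    show "?\<chi>\<eta> \<one>\<^bsub>G\<^esub> = \<one>" using X(3) Y(3) by simp
    fix g h assume gh: "g \<in> carrier G" "h \<in> carrier G"
    have c: "\<chi> g \<in> carrier S" "\<chi> h \<in> carrier S" "\<eta> g \<in> carrier S" "\<eta> h \<in> carrier S"
      using X(2) Y(2) gh by auto
    show "?\<chi>\<eta> (g \<bullet> h) = ?\<chi>\<eta> g \<otimes> ?\<chi>\<eta> h"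
      unfolding X(4)[OF gh] Y(4)[OF gh] using c by (simp only: m_ac m_closed)
  qed
  show le: "ideal_prod S (eigenmodule \<chi>) (eigenmodule \<eta>) \<subseteq> eigenmodule ?\<chi>\<eta>"
    using eigenmodule_mult[OF \<chi> \<eta>] subalgebra_eigenmodule[OF \<chi>\<eta>]
    by (intro ideal_prod_least) (auto simp: subalgebra_iff)
  have "eigenmodule ?\<chi>\<eta> = ideal_prod S invs (eigenmodule ?\<chi>\<eta>)"
    using ideal_prod_subring_left[OF subring_invs subalgebra_eigenmodule[OF \<chi>\<eta>]] by simp
  also have "\<dots> = ideal_prod S (eigenmodule \<chi>) (ideal_prod S (eigenmodule ?\<chi>') (eigenmodule ?\<chi>\<eta>))"
    unfolding eigenmodule_prod_inverse[OF \<chi>, symmetric] by (rule ideal_prod_assoc) (rule eigenmodule_subset)+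
  also have "\<dots> \<subseteq> ideal_prod S (eigenmodule \<chi>) (eigenmodule \<eta>)"
  proof (rule ideal_prod_mono[OF subset_refl ideal_prod_least])
    fix a b assume ab: "a \<in> eigenmodule ?\<chi>'" "b \<in> eigenmodule ?\<chi>\<eta>"
    have "eigenmodule (\<lambda>g. ?\<chi>' g \<otimes> ?\<chi>\<eta> g) = eigenmodule \<eta>"
      using X(2,6) Y(2) by (intro eigenmodule_cong) (simp flip: m_assoc)
    then show "a \<otimes> b \<in> eigenmodule \<eta>" using eigenmodule_mult[OF \<chi>' \<chi>\<eta> ab] by simp
  qed (use subalgebra_eigenmodule[OF \<eta>] in \<open>auto simp: subalgebra_iff\<close>)
  finally show "eigenmodule ?\<chi>\<eta> \<subseteq> ideal_prod S (eigenmodule \<chi>) (eigenmodule \<eta>)" .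
qed

end

section \<open>Characters with values in the roots of unity\<close>

lemma (in group) generate_finite_order:
  assumes w: "w \<in> carrier G" "w [^] (n::nat) = \<one>" and n: "n > 0"
  shows "generate G {w} = range (\<lambda>i::nat. w [^] i)"
proof
  have inv_w: "inv w = w [^] (n - 1)"
  proof (rule inv_equality)
    show "w [^] (n - 1) \<otimes> w = \<one>" using w n nat_pow_Suc[of w "n - 1"] by simp
  qed (use w in auto)
  show "generate G {w} \<subseteq> range (\<lambda>i::nat. w [^] i)"
  proof
    fix z assume "z \<in> generate G {w}"
    then show "z \<in> range (\<lambda>i::nat. w [^] i)"
    proof (induction rule: generate.induct)
      case one
      have "\<one> = w [^] (0::nat)" by simp
      then show ?case by (rule range_eqI)
    next
      case (incl h)
      then have "h = w [^] (1::nat)" using w by simp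
      then show ?case by (rule range_eqI)
    next
      case (inv h)
      then have "inv h = w [^] (n - 1)" using inv_w by simp
      then show ?case by (rule range_eqI)
    next
      case (eng h1 h2)
      then obtain i j :: nat where "h1 = w [^] i" "h2 = w [^] j" by blast
      then have "h1 \<otimes> h2 = w [^] (i + j)" using w by (simp add: nat_pow_mult)
      then show ?case by (rule range_eqI)
    qed
  qed
  have "w [^] i \<in> generate G {w}" for i :: nat
    by (induction i) (auto intro: generate.one generate.eng generate.incl)
  then show "range (\<lambda>i::nat. w [^] i) \<subseteq> generate G {w}" by blast
qed

text \<open>Removes the subgroup generated by \<open>w\<close> inside the unit group of the subring from the description of
characters.\<close>

lemma (in cring) char_group_carrier_iff:
  assumes K: "subring K R" and w: "w \<in> K" "w [^] (n::nat) = \<one>" and n: "n > 0"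
  shows "\<chi> \<in> carrier (char_group G (R\<lparr>carrier := K\<rparr>) w) \<longleftrightarrow>
    \<chi> \<in> extensional (carrier G) \<and> (\<forall>g\<in>carrier G. \<exists>i::nat. \<chi> g = w [^] i) \<and>
    (\<forall>g\<in>carrier G. \<forall>h\<in>carrier G. \<chi> (g \<otimes>\<^bsub>G\<^esub> h) = \<chi> g \<otimes> \<chi> h)"
proof -
  let ?K = "R\<lparr>carrier := K\<rparr>"
  let ?U = "units_of ?K"
  have "ring ?K" using subring_is_ring[OF K] .
  then interpret K: ring ?K .
  interpret U: group ?U by (rule K.units_group)
  have wc: "w \<in> carrier R" using w subringE(1)[OF K] by blast
  have pow: "w [^]\<^bsub>?K\<^esub> i = w [^] i" for i :: nat
    by (simp add: nat_pow_def)
  have w_unit: "w \<in> Units ?K"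
  proof -
    have "w [^] (n - 1) \<otimes> w = \<one>" using w n nat_pow_Suc[of w "n - 1"] by simp
    moreover from this have "w \<otimes> w [^] (n - 1) = \<one>"
      using m_comm[OF nat_pow_closed[OF wc] wc] by simp
    moreover have "w [^] (n - 1) \<in> K" using K.nat_pow_closed[of w "n - 1"] w by (simp add: pow)
    ultimately show ?thesis using w unfolding Units_def by auto
  qed
  have Upow: "w [^]\<^bsub>?U\<^esub> i = w [^] i" for i :: nat
    using K.units_of_pow[OF w_unit, of i] pow by simp
  have "generate ?U {w} = range (\<lambda>i::nat. w [^] i)"
    using U.generate_finite_order[of w n] w_unit w n by (simp add: Upow units_of_carrier units_of_one)
  then have car: "carrier (subgroup_generated ?U {w}) = range (\<lambda>i::nat. w [^] i)"
    using w_unit by (simp add: carrier_subgroup_generated units_of_carrier Int_absorb1)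
  have mult: "a \<otimes>\<^bsub>subgroup_generated ?U {w}\<^esub> b = a \<otimes> b" for a b
    by (simp add: subgroup_generated_def units_of_def)
  show ?thesis
    unfolding char_group_def hom_def using car mult by (auto simp: Pi_def image_iff)
qed

text \<open>The differences \<open>1 - w\<^sup>i\<close> are taken as units of \<open>S\<close>; this follows from their being units of the
subring of invariants, where the kummerian condition is stated.\<close>

locale partial_kummer = partial_galois +
  fixes w :: 'a
  assumes comm_G: "comm_group G"
    and w_inv: "w \<in> invs" and w_pow: "w [^] order G = \<one>"
    and w_unit: "\<And>i. 0 < i \<Longrightarrow> i < order G \<Longrightarrow> \<one> \<ominus> w [^] i \<in> Units S"
begin

abbreviation "Ghat \<equiv> char_group G (S\<lparr>carrier := invs\<rparr>) w"
abbreviation "chars \<equiv> carrier Ghat"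

lemma order_pos: "order G > 0"
  using finite_G by (simp add: G.order_gt_0_iff_finite)

lemma w_closed: "w \<in> carrier S"
  using w_inv invsD(1) by blast

lemmas char_iff = char_group_carrier_iff[OF subring_invs w_inv w_pow order_pos, where G = G]

lemma w_pow_in_invs: "w [^] (i::nat) \<in> invs"
  by (induction i) (auto simp: one_in_invs invs_mult w_inv)

lemma w_pow_cong:
  assumes "[i = j] (mod order G)"
  shows "w [^] i = w [^] j"
proof -
  have "w [^] i = w [^] (i mod order G)" for i
  proof -
    have "w [^] i = (w [^] order G) [^] (i div order G) \<otimes> w [^] (i mod order G)"
      using w_closed by (simp add: nat_pow_pow nat_pow_mult)
    then show ?thesis using w_closed w_pow by simp
  qed
  then show ?thesis using assms unfolding cong_def by metis
qed

lemma one_minus_w_pow_unit: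
  assumes "\<not> [i = 0] (mod order G)"
  shows "\<one> \<ominus> w [^] i \<in> Units S"
proof -
  have "w [^] i = w [^] (i mod order G)" by (rule w_pow_cong) (simp add: cong_def)
  moreover have "0 < i mod order G" "i mod order G < order G"
    using assms order_pos by (auto simp: cong_def)
  ultimately show ?thesis using w_unit by simp
qed

lemma char_value:
  assumes "\<chi> \<in> chars" "g \<in> carrier G"
  obtains i where "\<chi> g = w [^] (i::nat)"
  using assms char_iff by blast

lemma char_one_minus_unit:
  assumes "\<chi> \<in> chars" "g \<in> carrier G" "\<chi> g \<noteq> \<one>"
  shows "\<one> \<ominus> \<chi> g \<in> Units S"
proof -
  obtain i where i: "\<chi> g = w [^] (i::nat)" using char_value[OF assms(1,2)] .
  have "\<not> [i = 0] (mod order G)" using w_pow_cong[of i 0] i assms(3) by auto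
  then show ?thesis using one_minus_w_pow_unit i by simp
qed

lemma char_closed: "\<chi> \<in> chars \<Longrightarrow> g \<in> carrier G \<Longrightarrow> \<chi> g \<in> carrier S"
  using char_value w_closed by (metis nat_pow_closed)

lemma char_mult: "\<chi> \<in> chars \<Longrightarrow> g \<in> carrier G \<Longrightarrow> h \<in> carrier G \<Longrightarrow> \<chi> (g \<bullet> h) = \<chi> g \<otimes> \<chi> h"
  unfolding char_iff by blast

lemma char_character:
  assumes \<chi>: "\<chi> \<in> chars"
  shows "invariant_character \<chi>"
  unfolding invariant_character_def
proof (intro conjI)
  show "\<chi> \<in> carrier G \<rightarrow> invs"
  proof
    fix g assume "g \<in> carrier G"
    then obtain i where "\<chi> g = w [^] (i::nat)" using char_value[OF \<chi>] by blast
    then show "\<chi> g \<in> invs" using w_pow_in_invs by simp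
  qed
  show "\<chi> \<one>\<^bsub>G\<^esub> = \<one>"
  proof -
    have c: "\<chi> \<one>\<^bsub>G\<^esub> \<in> carrier S" using char_closed[OF \<chi>] by simp
    obtain i where "\<chi> \<one>\<^bsub>G\<^esub> = w [^] (i::nat)" using char_value[OF \<chi> G.one_closed] .
    then have "\<chi> \<one>\<^bsub>G\<^esub> \<in> Units S"
      using unit_of_finite_order[OF w_closed w_pow order_pos] Units_pow_closed by simp
    moreover have "\<chi> \<one>\<^bsub>G\<^esub> \<otimes> \<chi> \<one>\<^bsub>G\<^esub> = \<chi> \<one>\<^bsub>G\<^esub> \<otimes> \<one>"
      using char_mult[OF \<chi>, of "\<one>\<^bsub>G\<^esub>" "\<one>\<^bsub>G\<^esub>"] c by simp
    ultimately show ?thesis using c Units_l_cancel one_closed by blast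
  qed
  show "\<forall>g\<in>carrier G. \<forall>h\<in>carrier G. \<chi> (g \<bullet> h) = \<chi> g \<otimes> \<chi> h"
    using char_mult[OF \<chi>] by simp
qed

lemma char_ext: "\<chi> \<in> chars \<Longrightarrow> \<eta> \<in> chars \<Longrightarrow> (\<And>g. g \<in> carrier G \<Longrightarrow> \<chi> g = \<eta> g) \<Longrightarrow> \<chi> = \<eta>"
  by (rule extensionalityI[of _ "carrier G"]) (auto simp: char_iff)

lemma Ghat_mult: "\<chi> \<otimes>\<^bsub>Ghat\<^esub> \<eta> = (\<lambda>g\<in>carrier G. \<chi> g \<otimes> \<eta> g)"
  and Ghat_one: "\<one>\<^bsub>Ghat\<^esub> = (\<lambda>g\<in>carrier G. \<one>)"
  by (simp_all add: char_group_def)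

lemma comm_group_Ghat: "comm_group Ghat"
proof (rule comm_groupI)
  show one: "\<one>\<^bsub>Ghat\<^esub> \<in> chars"
    unfolding char_iff Ghat_one by (auto intro: exI[of _ "0::nat"])
  fix \<chi> assume \<chi>: "\<chi> \<in> chars"
  note C = invariant_characterD[OF char_character[OF \<chi>]]
  define \<chi>' where "\<chi>' = (\<lambda>g\<in>carrier G. \<chi> (inv\<^bsub>G\<^esub> g))"
  have "\<chi>' \<in> chars"
    unfolding char_iff
  proof (intro conjI ballI)
    fix g h assume g: "g \<in> carrier G" and h: "h \<in> carrier G"
    have "inv\<^bsub>G\<^esub> (g \<bullet> h) = inv\<^bsub>G\<^esub> g \<bullet> inv\<^bsub>G\<^esub> h"
      using comm_group.inv_mult[OF comm_G g h] .
    then show "\<chi>' (g \<bullet> h) = \<chi>' g \<otimes> \<chi>' h" using g h C(4) by (simp add: \<chi>'_def)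
  next
    fix g assume g: "g \<in> carrier G"
    then show "\<exists>i::nat. \<chi>' g = w [^] i" using \<chi> by (simp add: char_iff \<chi>'_def)
  qed (simp add: \<chi>'_def)
  moreover have "\<chi>' \<otimes>\<^bsub>Ghat\<^esub> \<chi> = \<one>\<^bsub>Ghat\<^esub>"
    unfolding Ghat_mult Ghat_one using C(6) by (auto simp: \<chi>'_def restrict_def)
  ultimately show "\<exists>\<chi>'\<in>chars. \<chi>' \<otimes>\<^bsub>Ghat\<^esub> \<chi> = \<one>\<^bsub>Ghat\<^esub>" by blast
  show "\<one>\<^bsub>Ghat\<^esub> \<otimes>\<^bsub>Ghat\<^esub> \<chi> = \<chi>"
    unfolding Ghat_mult Ghat_one
    by (rule extensionalityI[of _ "carrier G"]) (use C(2) \<chi> in \<open>auto simp: char_iff\<close>)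
  fix \<eta> assume \<eta>: "\<eta> \<in> chars"
  note E = invariant_characterD[OF char_character[OF \<eta>]]
  show "\<chi> \<otimes>\<^bsub>Ghat\<^esub> \<eta> = \<eta> \<otimes>\<^bsub>Ghat\<^esub> \<chi>"
    unfolding Ghat_mult using C(2) E(2) m_comm by (auto simp: restrict_def)
  show "\<chi> \<otimes>\<^bsub>Ghat\<^esub> \<eta> \<in> chars"
    unfolding char_iff
  proof (intro conjI ballI)
    fix g assume g: "g \<in> carrier G"
    obtain i j :: nat where "\<chi> g = w [^] i" "\<eta> g = w [^] j"
      using char_value[OF \<chi> g] char_value[OF \<eta> g] by metis
    then show "\<exists>i::nat. (\<chi> \<otimes>\<^bsub>Ghat\<^esub> \<eta>) g = w [^] i"
      using g w_closed by (auto simp: Ghat_mult nat_pow_mult)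
    fix h assume h: "h \<in> carrier G"
    have c: "\<chi> g \<in> carrier S" "\<chi> h \<in> carrier S" "\<eta> g \<in> carrier S" "\<eta> h \<in> carrier S"
      using C(2) E(2) g h by auto
    have "\<chi> g \<otimes> \<chi> h \<otimes> (\<eta> g \<otimes> \<eta> h) = \<chi> g \<otimes> \<eta> g \<otimes> (\<chi> h \<otimes> \<eta> h)"
      using c by (simp only: m_ac m_closed)
    then show "(\<chi> \<otimes>\<^bsub>Ghat\<^esub> \<eta>) (g \<bullet> h) = (\<chi> \<otimes>\<^bsub>Ghat\<^esub> \<eta>) g \<otimes> (\<chi> \<otimes>\<^bsub>Ghat\<^esub> \<eta>) h"
      using g h by (simp add: Ghat_mult C(4) E(4))
  qed (simp add: Ghat_mult)
  fix \<theta> assume \<theta>: "\<theta> \<in> chars"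
  show "\<chi> \<otimes>\<^bsub>Ghat\<^esub> \<eta> \<otimes>\<^bsub>Ghat\<^esub> \<theta> = \<chi> \<otimes>\<^bsub>Ghat\<^esub> (\<eta> \<otimes>\<^bsub>Ghat\<^esub> \<theta>)"
    unfolding Ghat_mult using C(2) E(2) char_closed[OF \<theta>] by (auto simp: restrict_def m_assoc)
qed

lemma finite_chars: "finite chars"
proof (rule finite_subset)
  have "\<chi> \<in> (\<Pi>\<^sub>E g\<in>carrier G. (\<lambda>i. w [^] i) ` {..<order G})" if "\<chi> \<in> chars" for \<chi>
  proof (rule PiE_I)
    fix g assume "g \<in> carrier G"
    then obtain i where "\<chi> g = w [^] (i::nat)" using char_value[OF \<open>\<chi> \<in> chars\<close>] by blast
    then have "\<chi> g = w [^] (i mod order G)" using w_pow_cong[of i "i mod order G"] by (simp add: cong_def)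
    then show "\<chi> g \<in> (\<lambda>i. w [^] i) ` {..<order G}" using order_pos by simp
  qed (use that in \<open>auto simp: char_iff extensional_def\<close>)
  then show "chars \<subseteq> (\<Pi>\<^sub>E g\<in>carrier G. (\<lambda>i. w [^] i) ` {..<order G})" by blast
qed (use finite_G in \<open>simp add: finite_PiE\<close>)

lemma separating_character:
  assumes g: "g \<in> carrier G" "g \<noteq> \<one>\<^bsub>G\<^esub>"
  obtains \<chi> where "\<chi> \<in> chars" "\<one> \<ominus> \<chi> g \<in> Units S"
proof -
  obtain \<kappa> where \<kappa>: "residue_character_on G (order G) (carrier G) \<kappa>" "\<not> [\<kappa> g = 0] (mod order G)"
    using comm_group.separating_residue_character[OF comm_G finite_G g] by metis
  define \<chi> where "\<chi> = (\<lambda>g\<in>carrier G. w [^] \<kappa> g)"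
  have "\<chi> \<in> chars"
    unfolding char_iff
  proof (intro conjI ballI)
    fix g h assume gh: "g \<in> carrier G" "h \<in> carrier G"
    have "w [^] \<kappa> (g \<bullet> h) = w [^] (\<kappa> g + \<kappa> h)"
      by (rule w_pow_cong[OF residue_character_onD[OF \<kappa>(1) gh]])
    then show "\<chi> (g \<bullet> h) = \<chi> g \<otimes> \<chi> h" using gh w_closed by (simp add: \<chi>_def nat_pow_mult)
  qed (auto simp: \<chi>_def)
  moreover have "\<one> \<ominus> \<chi> g \<in> Units S" using one_minus_w_pow_unit[OF \<kappa>(2)] g by (simp add: \<chi>_def)
  ultimately show thesis by (rule that)
qed

text \<open>The replacement for cancellation in a field: translation invariance of a character sum gives
\<open>u a = a\<close>.\<close>

lemma eq_zero_if_scaled: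
  assumes "u \<in> carrier S" "\<one> \<ominus> u \<in> Units S" "a \<in> carrier S" "u \<otimes> a = a"
  shows "a = \<zero>"
proof -
  have "(\<one> \<ominus> u) \<otimes> a = (\<one> \<ominus> u) \<otimes> \<zero>"
    using assms(1,3,4) by (simp add: a_minus_def l_distr l_minus r_neg)
  then show ?thesis using assms(2,3) Units_l_cancel zero_closed by blast
qed

lemma sum_over_characters:
  assumes g: "g \<in> carrier G" "g \<noteq> \<one>\<^bsub>G\<^esub>"
  shows "(\<Oplus>\<chi>\<in>chars. \<chi> g) = \<zero>"
proof -
  interpret H: comm_group Ghat by (rule comm_group_Ghat)
  obtain \<eta> where \<eta>: "\<eta> \<in> chars" "\<one> \<ominus> \<eta> g \<in> Units S" using separating_character[OF g] .
  have c: "\<chi> g \<in> carrier S" if "\<chi> \<in> chars" for \<chi> using char_closed that g by blast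
  have "(\<Oplus>\<chi>\<in>chars. \<chi> g) = (\<Oplus>\<chi>\<in>(\<lambda>\<chi>. \<eta> \<otimes>\<^bsub>Ghat\<^esub> \<chi>) ` chars. \<chi> g)"
    unfolding H.surj_const_mult[OF \<eta>(1)] ..
  also have "\<dots> = (\<Oplus>\<chi>\<in>chars. (\<eta> \<otimes>\<^bsub>Ghat\<^esub> \<chi>) g)"
    using c \<eta>(1) H.m_closed by (intro finsum_reindex) (auto simp: inj_on_def)
  also have "\<dots> = (\<Oplus>\<chi>\<in>chars. \<eta> g \<otimes> \<chi> g)"
    using c \<eta>(1) g by (intro finsum_cong') (auto simp: Ghat_mult)
  also have "\<dots> = \<eta> g \<otimes> (\<Oplus>\<chi>\<in>chars. \<chi> g)"
    using c \<eta>(1) finite_chars by (intro finsum_rdistr[symmetric]) auto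
  finally show ?thesis
    using eq_zero_if_scaled[OF c[OF \<eta>(1)] \<eta>(2), of "\<Oplus>\<chi>\<in>chars. \<chi> g"] c by (simp add: finsum_closed Pi_def)
qed

lemma sum_of_character:
  assumes \<chi>: "\<chi> \<in> chars" "\<chi> \<noteq> \<one>\<^bsub>Ghat\<^esub>"
  shows "(\<Oplus>g\<in>carrier G. \<chi> g) = \<zero>"
proof -
  interpret H: comm_group Ghat by (rule comm_group_Ghat)
  note C = invariant_characterD[OF char_character[OF \<chi>(1)]]
  obtain h where h: "h \<in> carrier G" "\<chi> h \<noteq> \<one>"
    using char_ext[OF \<chi>(1) H.one_closed] \<chi>(2) by (auto simp: Ghat_one)
  have "(\<Oplus>g\<in>carrier G. \<chi> g) = (\<Oplus>g\<in>carrier G. \<chi> (h \<bullet> g))"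
    using finsum_translate[OF h(1), of \<chi>] C(2) by simp
  also have "\<dots> = (\<Oplus>g\<in>carrier G. \<chi> h \<otimes> \<chi> g)"
    using C(2,4) h by (intro finsum_cong') auto
  also have "\<dots> = \<chi> h \<otimes> (\<Oplus>g\<in>carrier G. \<chi> g)"
    using C(2) h finite_G by (intro finsum_rdistr[symmetric]) auto
  finally show ?thesis
    using eq_zero_if_scaled[OF C(2)[OF h(1)] char_one_minus_unit[OF \<chi>(1) h], of "\<Oplus>g\<in>carrier G. \<chi> g"] C(2)
    by (simp add: finsum_closed Pi_def)
qed

text \<open>The number of characters as an element of \<open>S\<close>. Comparing the two orders of summation of all
character values identifies it with the image of the order of \<open>G\<close>, so the characters need not be
counted in \<open>\<nat>\<close>.\<close>

definition N :: 'a where "N = (\<Oplus>\<chi>\<in>chars. \<one>)"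

lemma sum_over_characters_eq:
  assumes "g \<in> carrier G"
  shows "(\<Oplus>\<chi>\<in>chars. \<chi> g) = (if g = \<one>\<^bsub>G\<^esub> then N else \<zero>)"
proof (cases "g = \<one>\<^bsub>G\<^esub>")
  case True
  have "(\<Oplus>\<chi>\<in>chars. \<chi> \<one>\<^bsub>G\<^esub>) = N"
    unfolding N_def using invariant_characterD(3)[OF char_character] by (intro finsum_cong') auto
  then show ?thesis using True by simp
qed (use assms sum_over_characters in simp)

lemma N_closed: "N \<in> carrier S"
  by (simp add: N_def finsum_closed)

lemma N_eq: "N = (\<Oplus>g\<in>carrier G. \<one>)"
proof -
  interpret H: comm_group Ghat by (rule comm_group_Ghat)
  have "(\<Oplus>\<chi>\<in>chars. \<Oplus>g\<in>carrier G. \<chi> g) = (\<Oplus>g\<in>carrier G. \<Oplus>\<chi>\<in>chars. \<chi> g)"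
    using finite_chars finite_G char_closed by (intro finsum_swap)
  also have "\<dots> = (\<Oplus>g\<in>carrier G. if g = \<one>\<^bsub>G\<^esub> then N else \<zero>)"
    using sum_over_characters_eq N_closed by (intro finsum_cong') auto
  also have "\<dots> = N" using finite_G N_closed by (intro finsum_delta) auto
  also have "(\<Oplus>\<chi>\<in>chars. \<Oplus>g\<in>carrier G. \<chi> g) = (\<Oplus>\<chi>\<in>chars. if \<chi> = \<one>\<^bsub>Ghat\<^esub> then (\<Oplus>g\<in>carrier G. \<one>) else \<zero>)"
  proof (rule finsum_cong')
    fix \<chi> assume \<chi>: "\<chi> \<in> chars"
    have "(\<Oplus>g\<in>carrier G. \<one>\<^bsub>Ghat\<^esub> g) = (\<Oplus>g\<in>carrier G. \<one>)"
      by (intro finsum_cong') (auto simp: Ghat_one)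
    then show "(\<Oplus>g\<in>carrier G. \<chi> g) = (if \<chi> = \<one>\<^bsub>Ghat\<^esub> then (\<Oplus>g\<in>carrier G. \<one>) else \<zero>)"
      using sum_of_character[OF \<chi>] by simp
  qed (auto simp: finsum_closed)
  also have "\<dots> = (\<Oplus>g\<in>carrier G. \<one>)"
    using finite_chars H.one_closed by (intro finsum_delta) (auto simp: finsum_closed)
  finally show ?thesis by simp
qed

lemma N_unit: "N \<in> Units S"
proof -
  have "N = add_pow S (order G) \<one>"
    unfolding N_eq order_def by (simp add: add.finprod_const)
  then show ?thesis using root_order_unit[OF w_closed w_pow order_pos w_unit] by simp
qed

lemma N_in_invs: "N \<in> invs"
proof -
  have "(\<Oplus>g\<in>A. \<one>) \<in> invs" if "finite A" for A :: "'c set"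
    using that
  proof (induction A rule: finite_induct)
    case empty
    then show ?case using subringE(2)[OF subring_invs] by simp
  next
    case (insert a A)
    then show ?case using subringE(7)[OF subring_invs] one_in_invs by simp
  qed
  then show ?thesis unfolding N_eq using finite_G by blast
qed

end

section \<open>The sum of the eigenmodules\<close>

context partial_kummer begin

text \<open>The values \<open>\<chi> g \<eta> (g\<inverse>)\<close> are those of the character \<open>\<chi> \<eta>\<inverse>\<close>, to which the vanishing of
sums of nontrivial characters applies.\<close>

lemma character_orthogonality:
  assumes \<chi>: "\<chi> \<in> chars" and \<eta>: "\<eta> \<in> chars"
  shows "(\<Oplus>g\<in>carrier G. \<chi> g \<otimes> \<eta> (inv\<^bsub>G\<^esub> g)) = (if \<chi> = \<eta> then N else \<zero>)"
proof -
  interpret H: comm_group Ghat by (rule comm_group_Ghat)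
  note C = invariant_characterD[OF char_character[OF \<chi>]]
  note E = invariant_characterD[OF char_character[OF \<eta>]]
  define \<eta>' where "\<eta>' = inv\<^bsub>Ghat\<^esub> \<eta>"
  have \<eta>': "\<eta>' \<in> chars" using \<eta> by (simp add: \<eta>'_def)
  have "\<eta>' g = \<eta> (inv\<^bsub>G\<^esub> g)" if g: "g \<in> carrier G" for g
  proof -
    have "\<eta>' \<otimes>\<^bsub>Ghat\<^esub> \<eta> = \<one>\<^bsub>Ghat\<^esub>" using \<eta> by (simp add: \<eta>'_def)
    then have "\<eta>' g \<otimes> \<eta> g = \<one>" using g by (auto simp: Ghat_mult Ghat_one dest: fun_cong[of _ _ g])
    then have "\<eta> (inv\<^bsub>G\<^esub> g) = (\<eta>' g \<otimes> \<eta> g) \<otimes> \<eta> (inv\<^bsub>G\<^esub> g)" using E(2) g by simp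
    also have "\<dots> = \<eta>' g \<otimes> (\<eta> g \<otimes> \<eta> (inv\<^bsub>G\<^esub> g))"
      using E(2) g char_closed[OF \<eta>' g] by (simp add: m_assoc)
    finally show ?thesis using E(5)[OF g] char_closed[OF \<eta>' g] by simp
  qed
  then have "(\<Oplus>g\<in>carrier G. \<chi> g \<otimes> \<eta> (inv\<^bsub>G\<^esub> g)) = (\<Oplus>g\<in>carrier G. (\<chi> \<otimes>\<^bsub>Ghat\<^esub> \<eta>') g)"
    using C(2) E(2) by (intro finsum_cong') (auto simp: Ghat_mult)
  moreover have "\<chi> \<otimes>\<^bsub>Ghat\<^esub> \<eta>' = \<one>\<^bsub>Ghat\<^esub> \<longleftrightarrow> \<chi> = \<eta>"
  proof
    assume "\<chi> \<otimes>\<^bsub>Ghat\<^esub> \<eta>' = \<one>\<^bsub>Ghat\<^esub>"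
    then have "\<chi> \<otimes>\<^bsub>Ghat\<^esub> \<eta>' = \<eta> \<otimes>\<^bsub>Ghat\<^esub> \<eta>'" using \<eta> by (simp add: \<eta>'_def)
    then show "\<chi> = \<eta>" using \<chi> \<eta> \<eta>' by simp
  qed (use \<eta> in \<open>simp add: \<eta>'_def\<close>)
  moreover have "(\<Oplus>g\<in>carrier G. \<one>\<^bsub>Ghat\<^esub> g) = N"
    unfolding N_eq by (intro finsum_cong') (auto simp: Ghat_one)
  ultimately show ?thesis
    using sum_of_character[of "\<chi> \<otimes>\<^bsub>Ghat\<^esub> \<eta>'"] \<chi> \<eta>' by auto
qed

lemma sum_twisted_traces:
  assumes a: "a \<in> carrier S"
  shows "(\<Oplus>\<chi>\<in>chars. twisted_trace \<chi> a) = N \<otimes> a"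
proof -
  have cl: "\<chi> (inv\<^bsub>G\<^esub> g) \<in> carrier S" if "\<chi> \<in> chars" "g \<in> carrier G" for \<chi> g
    using that char_closed by simp
  have "(\<Oplus>\<chi>\<in>chars. twisted_trace \<chi> a) = (\<Oplus>g\<in>carrier G. \<Oplus>\<chi>\<in>chars. \<chi> (inv\<^bsub>G\<^esub> g) \<otimes> act g a)"
    unfolding twisted_trace_def using finite_chars finite_G cl a by (intro finsum_swap) auto
  also have "\<dots> = (\<Oplus>g\<in>carrier G. if g = \<one>\<^bsub>G\<^esub> then N \<otimes> act g a else \<zero>)"
  proof (rule finsum_cong')
    fix g assume g: "g \<in> carrier G"
    have "(\<Oplus>\<chi>\<in>chars. \<chi> (inv\<^bsub>G\<^esub> g) \<otimes> act g a) = (\<Oplus>\<chi>\<in>chars. \<chi> (inv\<^bsub>G\<^esub> g)) \<otimes> act g a"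
      using finite_chars g cl a by (intro finsum_ldistr[symmetric]) auto
    then show "(\<Oplus>\<chi>\<in>chars. \<chi> (inv\<^bsub>G\<^esub> g) \<otimes> act g a) = (if g = \<one>\<^bsub>G\<^esub> then N \<otimes> act g a else \<zero>)"
      using sum_over_characters_eq[of "inv\<^bsub>G\<^esub> g"] g a by (simp add: G.inv_eq_1_iff)
  qed (use a N_closed in auto)
  also have "\<dots> = N \<otimes> act \<one>\<^bsub>G\<^esub> a" using finite_G a N_closed by (intro finsum_delta) auto
  finally show ?thesis using a by simp
qed

lemma family_sum_eigenmodules: "carrier S = family_sum S chars eigenmodule"
proof
  show "family_sum S chars eigenmodule \<subseteq> carrier S"
    unfolding family_sum_def using eigenmodule_subset by (force intro!: finsum_closed)
  show "carrier S \<subseteq> family_sum S chars eigenmodule"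
  proof
    fix a assume a: "a \<in> carrier S"
    let ?N' = "inv N"
    have N': "?N' \<in> carrier S" "N \<otimes> ?N' = \<one>" using N_unit by auto
    have N'_inv: "?N' \<in> invs" by (rule inverse_in_invs[OF N_in_invs N'])
    define m where "m = (\<lambda>\<chi>\<in>chars. ?N' \<otimes> twisted_trace \<chi> a)"
    have tc: "twisted_trace \<chi> a \<in> carrier S" if "\<chi> \<in> chars" for \<chi>
      using that a char_character by simp
    have "m \<in> (\<Pi>\<^sub>E \<chi>\<in>chars. eigenmodule \<chi>)"
    proof (rule PiE_I)
      fix \<chi> assume \<chi>: "\<chi> \<in> chars"
      then have "twisted_trace \<chi> a \<in> eigenmodule \<chi>"
        using twisted_trace_in_eigenmodule[OF char_character a] by blast
      then show "m \<chi> \<in> eigenmodule \<chi>"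
        using subalgebra_eigenmodule[OF char_character[OF \<chi>]] N'_inv \<chi> by (simp add: m_def subalgebra_iff)
    qed (simp add: m_def)
    moreover have "(\<Oplus>\<chi>\<in>chars. m \<chi>) = a"
    proof -
      have "(\<Oplus>\<chi>\<in>chars. m \<chi>) = (\<Oplus>\<chi>\<in>chars. ?N' \<otimes> twisted_trace \<chi> a)"
        using tc N'(1) by (intro finsum_cong') (auto simp: m_def)
      also have "\<dots> = ?N' \<otimes> (N \<otimes> a)"
        unfolding sum_twisted_traces[OF a, symmetric]
        using tc N'(1) finite_chars by (intro finsum_rdistr[symmetric]) auto
      also have "\<dots> = (N \<otimes> ?N') \<otimes> a" using N'(1) N_closed a by (simp add: m_ac)
      finally show ?thesis using N'(2) a by simp
    qed
    ultimately show "a \<in> family_sum S chars eigenmodule"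
      unfolding family_sum_def by (intro image_eqI[of _ _ m]) auto
  qed
qed

text \<open>For a global action the eigenvalue of \<open>act g\<close> on the component \<open>m \<chi>\<close> is \<open>\<chi> g\<close> itself, and
orthogonality isolates the component at \<open>\<eta>\<close>. For a proper partial action the factor \<open>e g\<close> spoils
this.\<close>

lemma twisted_trace_of_sum_global:
  assumes glob: "\<And>g. g \<in> carrier G \<Longrightarrow> e g = \<one>"
    and m: "\<And>\<chi>. \<chi> \<in> chars \<Longrightarrow> m \<chi> \<in> eigenmodule \<chi>" and \<eta>: "\<eta> \<in> chars"
  shows "twisted_trace \<eta> (\<Oplus>\<chi>\<in>chars. m \<chi>) = N \<otimes> m \<eta>"
proof -
  have mc: "m \<chi> \<in> carrier S" if "\<chi> \<in> chars" for \<chi> using m[OF that] eigenmodule_subset by blast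
  have cl: "\<chi> g \<in> carrier S" "\<chi> (inv\<^bsub>G\<^esub> g) \<in> carrier S" if "\<chi> \<in> chars" "g \<in> carrier G" for \<chi> g
    using that char_closed by auto
  have "twisted_trace \<eta> (\<Oplus>\<chi>\<in>chars. m \<chi>)
      = (\<Oplus>g\<in>carrier G. \<Oplus>\<chi>\<in>chars. (\<chi> g \<otimes> \<eta> (inv\<^bsub>G\<^esub> g)) \<otimes> m \<chi>)"
    unfolding twisted_trace_def
  proof (rule finsum_cong')
    fix g assume g: "g \<in> carrier G"
    have "act g (\<Oplus>\<chi>\<in>chars. m \<chi>) = (\<Oplus>\<chi>\<in>chars. act g (m \<chi>))"
      using g mc finite_chars by (intro act_finsum) auto
    also have "\<dots> = (\<Oplus>\<chi>\<in>chars. \<chi> g \<otimes> m \<chi>)"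
      using m cl g mc glob by (intro finsum_cong') (auto simp: eigenmodule_def)
    finally have "\<eta> (inv\<^bsub>G\<^esub> g) \<otimes> act g (\<Oplus>\<chi>\<in>chars. m \<chi>) = (\<Oplus>\<chi>\<in>chars. \<eta> (inv\<^bsub>G\<^esub> g) \<otimes> (\<chi> g \<otimes> m \<chi>))"
      using finite_chars cl mc g \<eta> by (simp add: finsum_rdistr Pi_def)
    also have "\<dots> = (\<Oplus>\<chi>\<in>chars. (\<chi> g \<otimes> \<eta> (inv\<^bsub>G\<^esub> g)) \<otimes> m \<chi>)"
      using cl mc g \<eta> by (intro finsum_cong') (auto simp: m_ac)
    finally show "\<eta> (inv\<^bsub>G\<^esub> g) \<otimes> act g (\<Oplus>\<chi>\<in>chars. m \<chi>)
      = (\<Oplus>\<chi>\<in>chars. (\<chi> g \<otimes> \<eta> (inv\<^bsub>G\<^esub> g)) \<otimes> m \<chi>)" .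
  qed (use cl mc \<eta> in \<open>auto intro!: finsum_closed\<close>)
  also have "\<dots> = (\<Oplus>\<chi>\<in>chars. \<Oplus>g\<in>carrier G. (\<chi> g \<otimes> \<eta> (inv\<^bsub>G\<^esub> g)) \<otimes> m \<chi>)"
    using cl mc \<eta> finite_G finite_chars by (intro finsum_swap) auto
  also have "\<dots> = (\<Oplus>\<chi>\<in>chars. if \<chi> = \<eta> then N \<otimes> m \<chi> else \<zero>)"
  proof (rule finsum_cong')
    fix \<chi> assume \<chi>: "\<chi> \<in> chars"
    have "(\<Oplus>g\<in>carrier G. (\<chi> g \<otimes> \<eta> (inv\<^bsub>G\<^esub> g)) \<otimes> m \<chi>)
        = (\<Oplus>g\<in>carrier G. \<chi> g \<otimes> \<eta> (inv\<^bsub>G\<^esub> g)) \<otimes> m \<chi>"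
      using cl mc \<eta> \<chi> finite_G by (intro finsum_ldistr[symmetric]) auto
    then show "(\<Oplus>g\<in>carrier G. (\<chi> g \<otimes> \<eta> (inv\<^bsub>G\<^esub> g)) \<otimes> m \<chi>) = (if \<chi> = \<eta> then N \<otimes> m \<chi> else \<zero>)"
      using character_orthogonality[OF \<chi> \<eta>] mc[OF \<chi>] by simp
  qed (use mc N_closed in auto)
  also have "\<dots> = N \<otimes> m \<eta>" using finite_chars \<eta> mc N_closed by (intro finsum_delta) auto
  finally show ?thesis .
qed

lemma global_imp_direct:
  assumes glob: "\<And>g. g \<in> carrier G \<Longrightarrow> e g = \<one>"
  shows "family_sum_direct S chars eigenmodule"
  unfolding family_sum_direct_def
proof (rule inj_onI)
  fix m m' assume m: "m \<in> (\<Pi>\<^sub>E \<chi>\<in>chars. eigenmodule \<chi>)" and m': "m' \<in> (\<Pi>\<^sub>E \<chi>\<in>chars. eigenmodule \<chi>)"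
    and eq: "(\<Oplus>\<chi>\<in>chars. m \<chi>) = (\<Oplus>\<chi>\<in>chars. m' \<chi>)"
  have mem: "m \<chi> \<in> eigenmodule \<chi>" "m' \<chi> \<in> eigenmodule \<chi>" if "\<chi> \<in> chars" for \<chi>
    using m m' that by auto
  show "m = m'"
  proof (rule PiE_ext[OF m m'])
    fix \<eta> assume \<eta>: "\<eta> \<in> chars"
    have "N \<otimes> m \<eta> = N \<otimes> m' \<eta>"
      using twisted_trace_of_sum_global[OF glob mem(1) \<eta>] twisted_trace_of_sum_global[OF glob mem(2) \<eta>] eq
      by simp
    moreover have "m \<eta> \<in> carrier S" "m' \<eta> \<in> carrier S" using mem[OF \<eta>] eigenmodule_subset by blast+
    ultimately show "m \<eta> = m' \<eta>" using N_unit Units_l_cancel by blast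
  qed
qed

text \<open>Directness yields projections of \<open>S\<close> onto the eigenmodules. The elements \<open>z i\<close> are the images of the \<open>x i\<close>
under the linear map that multiplies the component at \<open>\<chi>\<close> by \<open>\<chi> h\<close>, and \<open>C g\<close> is the
coefficient of \<open>act g\<close> when this map is written through the dual basis. Evaluating at the eigenvectors
determines \<open>\<Sum> \<eta> g C g\<close>, and orthogonality of characters then gives \<open>C h = 1\<close>, although
\<open>C h\<close> is a multiple of \<open>e h\<close> by construction.\<close>

lemma direct_imp_global:
  assumes direct: "family_sum_direct S chars eigenmodule" and h: "h \<in> carrier G"
  shows "e h = \<one>"
proof -
  have "\<exists>m\<in>\<Pi>\<^sub>E \<chi>\<in>chars. eigenmodule \<chi>. x i = (\<Oplus>\<chi>\<in>chars. m \<chi>)" if "i \<in> {1..l}" for i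
    using x_closed[OF that] family_sum_eigenmodules unfolding family_sum_def by blast
  then obtain m where m: "\<And>i. i \<in> {1..l} \<Longrightarrow> m i \<in> (\<Pi>\<^sub>E \<chi>\<in>chars. eigenmodule \<chi>)"
    "\<And>i. i \<in> {1..l} \<Longrightarrow> x i = (\<Oplus>\<chi>\<in>chars. m i \<chi>)" by metis
  have mem: "m i \<chi> \<in> eigenmodule \<chi>" if "i \<in> {1..l}" "\<chi> \<in> chars" for i \<chi>
    using m(1)[OF that(1)] that(2) by auto
  have mc: "m i \<chi> \<in> carrier S" if "i \<in> {1..l}" "\<chi> \<in> chars" for i \<chi>
    using mem[OF that] eigenmodule_subset by blast
  have cc: "\<chi> g \<in> carrier S" if "\<chi> \<in> chars" "g \<in> carrier G" for \<chi> g
    using that char_closed by auto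
  define z where "z i = (\<Oplus>\<chi>\<in>chars. \<chi> h \<otimes> m i \<chi>)" for i
  have zc: "z i \<in> carrier S" if "i \<in> {1..l}" for i
    unfolding z_def using that mc cc h by (auto intro!: finsum_closed)
  define C where "C g = (\<Oplus>i\<in>{1..l}. z i \<otimes> act g (y i))" for g
  have Cc: "C g \<in> carrier S" if "g \<in> carrier G" for g
    unfolding C_def using that zc by (auto intro!: finsum_closed)
  have key: "(\<Oplus>g\<in>carrier G. \<eta> g \<otimes> C g) = \<eta> h" if \<eta>: "\<eta> \<in> chars" for \<eta>
  proof (rule eigenmodule_cancel[OF char_character[OF \<eta>]])
    show "(\<Oplus>g\<in>carrier G. \<eta> g \<otimes> C g) \<in> carrier S" "\<eta> h \<in> carrier S"
      using cc \<eta> h Cc by (auto intro!: finsum_closed)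
    fix v assume v: "v \<in> eigenmodule \<eta>"
    then have vc: "v \<in> carrier S" using eigenmodule_subset by blast
    define r where "r i = trace (y i \<otimes> v)" for i
    have r: "r i \<in> invs" if "i \<in> {1..l}" for i unfolding r_def using trace_in_invs that vc by simp
    have rc: "r i \<in> carrier S" if "i \<in> {1..l}" for i using r[OF that] invsD(1) by blast
    define M where "M \<chi> = (\<Oplus>i\<in>{1..l}. r i \<otimes> m i \<chi>)" for \<chi>
    have M_in: "M \<chi> \<in> eigenmodule \<chi>" if \<chi>: "\<chi> \<in> chars" for \<chi>
      unfolding M_def
    proof (rule eigenmodule_finsum[OF char_character[OF \<chi>]])
      fix i assume "i \<in> {1..l}"
      then show "r i \<otimes> m i \<chi> \<in> eigenmodule \<chi>"
        using subalgebra_eigenmodule[OF char_character[OF \<chi>]] r mem \<chi> by (simp add: subalgebra_iff)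
    qed simp
    have Mc: "M \<chi> \<in> carrier S" if "\<chi> \<in> chars" for \<chi> using M_in[OF that] eigenmodule_subset by blast
    have "v = (\<Oplus>i\<in>{1..l}. x i \<otimes> r i)" unfolding r_def by (rule dual_basis[OF vc])
    also have "\<dots> = (\<Oplus>i\<in>{1..l}. \<Oplus>\<chi>\<in>chars. r i \<otimes> m i \<chi>)"
    proof (rule finsum_cong')
      fix i assume i: "i \<in> {1..l}"
      have "x i \<otimes> r i = r i \<otimes> (\<Oplus>\<chi>\<in>chars. m i \<chi>)"
        unfolding m(2)[OF i, symmetric] using i rc by (simp add: m_comm)
      also have "\<dots> = (\<Oplus>\<chi>\<in>chars. r i \<otimes> m i \<chi>)"
        using i rc mc finite_chars by (intro finsum_rdistr) auto
      finally show "x i \<otimes> r i = (\<Oplus>\<chi>\<in>chars. r i \<otimes> m i \<chi>)" .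
    qed (use rc mc in \<open>auto intro!: finsum_closed\<close>)
    also have "\<dots> = (\<Oplus>\<chi>\<in>chars. M \<chi>)"
      unfolding M_def using rc mc finite_chars by (intro finsum_swap) auto
    finally have sum_M: "(\<Oplus>\<chi>\<in>chars. M \<chi>) = v" by simp
    let ?M = "\<lambda>\<chi>\<in>chars. M \<chi>" and ?V = "\<lambda>\<chi>\<in>chars. if \<chi> = \<eta> then v else \<zero>"
    \<comment> \<open>The eigenvector \<open>v\<close> has two decompositions: the trivial one, and the one obtained by
    decomposing the \<open>x i\<close> in its expansion by the dual basis.\<close>
    have "?M = ?V"
    proof (rule inj_onD[OF direct[unfolded family_sum_direct_def]])
      have "(\<Oplus>\<chi>\<in>chars. ?M \<chi>) = (\<Oplus>\<chi>\<in>chars. M \<chi>)"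
        using Mc by (intro finsum_cong') auto
      moreover have "(\<Oplus>\<chi>\<in>chars. ?V \<chi>) = (\<Oplus>\<chi>\<in>chars. if \<chi> = \<eta> then v else \<zero>)"
        using vc by (intro finsum_cong') auto
      moreover have "(\<Oplus>\<chi>\<in>chars. if \<chi> = \<eta> then v else \<zero>) = v"
        using finite_chars \<eta> vc by (intro finsum_delta) auto
      ultimately show "(\<Oplus>\<chi>\<in>chars. ?M \<chi>)
        = (\<Oplus>\<chi>\<in>chars. ?V \<chi>)" using sum_M by simp
      show "?M \<in> (\<Pi>\<^sub>E \<chi>\<in>chars. eigenmodule \<chi>)" using M_in by auto
      have "\<zero> \<in> eigenmodule \<chi>" if "\<chi> \<in> chars" for \<chi>
        using subalgebra_eigenmodule[OF char_character[OF that]] by (simp add: subalgebra_iff)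
      then show "?V \<in> (\<Pi>\<^sub>E \<chi>\<in>chars. eigenmodule \<chi>)"
        using v by auto
    qed
    then have M_eq: "M \<chi> = (if \<chi> = \<eta> then v else \<zero>)" if "\<chi> \<in> chars" for \<chi>
      using that by (auto dest: fun_cong[of _ _ \<chi>])
    have "(\<Oplus>i\<in>{1..l}. z i \<otimes> r i) = (\<Oplus>i\<in>{1..l}. \<Oplus>\<chi>\<in>chars. \<chi> h \<otimes> (r i \<otimes> m i \<chi>))"
    proof (rule finsum_cong')
      fix i assume i: "i \<in> {1..l}"
      have "z i \<otimes> r i = (\<Oplus>\<chi>\<in>chars. (\<chi> h \<otimes> m i \<chi>) \<otimes> r i)"
        unfolding z_def using i rc mc cc h finite_chars by (intro finsum_ldistr) auto
      also have "\<dots> = (\<Oplus>\<chi>\<in>chars. \<chi> h \<otimes> (r i \<otimes> m i \<chi>))"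
        using i rc mc cc h by (intro finsum_cong') (auto simp: m_ac)
      finally show "z i \<otimes> r i = (\<Oplus>\<chi>\<in>chars. \<chi> h \<otimes> (r i \<otimes> m i \<chi>))" .
    qed (use rc mc cc h in \<open>auto intro!: finsum_closed\<close>)
    also have "\<dots> = (\<Oplus>\<chi>\<in>chars. \<Oplus>i\<in>{1..l}. \<chi> h \<otimes> (r i \<otimes> m i \<chi>))"
      using rc mc cc h finite_chars by (intro finsum_swap) auto
    also have "\<dots> = (\<Oplus>\<chi>\<in>chars. if \<chi> = \<eta> then \<chi> h \<otimes> v else \<zero>)"
    proof (rule finsum_cong')
      fix \<chi> assume \<chi>: "\<chi> \<in> chars"
      have "(\<Oplus>i\<in>{1..l}. \<chi> h \<otimes> (r i \<otimes> m i \<chi>)) = \<chi> h \<otimes> M \<chi>"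
        unfolding M_def using \<chi> rc mc cc h by (intro finsum_rdistr[symmetric]) auto
      then show "(\<Oplus>i\<in>{1..l}. \<chi> h \<otimes> (r i \<otimes> m i \<chi>)) = (if \<chi> = \<eta> then \<chi> h \<otimes> v else \<zero>)"
        using M_eq[OF \<chi>] cc[OF \<chi> h] by simp
    qed (use vc cc h in auto)
    also have "\<dots> = \<eta> h \<otimes> v" using finite_chars \<eta> vc cc h by (intro finsum_delta) auto
    finally have zr: "(\<Oplus>i\<in>{1..l}. z i \<otimes> r i) = \<eta> h \<otimes> v" .
    have "(\<Oplus>i\<in>{1..l}. z i \<otimes> r i)
        = (\<Oplus>i\<in>{1..l}. \<Oplus>g\<in>carrier G. \<eta> g \<otimes> (z i \<otimes> act g (y i)) \<otimes> v)"
    proof (rule finsum_cong')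
      fix i assume i: "i \<in> {1..l}"
      have "z i \<otimes> r i = (\<Oplus>g\<in>carrier G. z i \<otimes> (\<one> \<otimes> act g (y i \<otimes> v)))"
        unfolding r_def twisted_trace_def using i zc vc finite_G by (intro finsum_rdistr) auto
      also have "\<dots> = (\<Oplus>g\<in>carrier G. \<eta> g \<otimes> (z i \<otimes> act g (y i)) \<otimes> v)"
      proof (rule finsum_cong')
        fix g assume g: "g \<in> carrier G"
        have c: "z i \<in> carrier S" "act g (y i) \<in> carrier S" "\<eta> g \<in> carrier S" "e g \<in> carrier S"
          using i g zc cc \<eta> by auto
        have "act g v = \<eta> g \<otimes> e g \<otimes> v" using v g by (simp add: eigenmodule_def)
        then have "z i \<otimes> (\<one> \<otimes> act g (y i \<otimes> v)) = z i \<otimes> (act g (y i) \<otimes> (\<eta> g \<otimes> e g \<otimes> v))"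
          using i g vc c by simp
        also have "\<dots> = \<eta> g \<otimes> (z i \<otimes> (act g (y i) \<otimes> e g)) \<otimes> v"
          using c vc by (simp only: m_ac m_closed)
        finally show "z i \<otimes> (\<one> \<otimes> act g (y i \<otimes> v)) = \<eta> g \<otimes> (z i \<otimes> act g (y i)) \<otimes> v"
          using i g by simp
      qed (use i zc vc cc \<eta> in auto)
      finally show "z i \<otimes> r i = (\<Oplus>g\<in>carrier G. \<eta> g \<otimes> (z i \<otimes> act g (y i)) \<otimes> v)" .
    qed (use zc vc cc \<eta> in \<open>auto intro!: finsum_closed\<close>)
    also have "\<dots> = (\<Oplus>g\<in>carrier G. \<Oplus>i\<in>{1..l}. \<eta> g \<otimes> (z i \<otimes> act g (y i)) \<otimes> v)"
      using zc vc cc \<eta> finite_G by (intro finsum_swap) auto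
    also have "\<dots> = (\<Oplus>g\<in>carrier G. \<eta> g \<otimes> C g \<otimes> v)"
    proof (rule finsum_cong')
      fix g assume g: "g \<in> carrier G"
      have "(\<Oplus>i\<in>{1..l}. \<eta> g \<otimes> (z i \<otimes> act g (y i)) \<otimes> v) = (\<Oplus>i\<in>{1..l}. \<eta> g \<otimes> (z i \<otimes> act g (y i))) \<otimes> v"
        using g zc vc cc \<eta> by (intro finsum_ldistr[symmetric]) auto
      also have "(\<Oplus>i\<in>{1..l}. \<eta> g \<otimes> (z i \<otimes> act g (y i))) = \<eta> g \<otimes> C g"
        unfolding C_def using g zc cc \<eta> by (intro finsum_rdistr[symmetric]) auto
      finally show "(\<Oplus>i\<in>{1..l}. \<eta> g \<otimes> (z i \<otimes> act g (y i)) \<otimes> v) = \<eta> g \<otimes> C g \<otimes> v" .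
    qed (use Cc vc cc \<eta> in auto)
    also have "\<dots> = (\<Oplus>g\<in>carrier G. \<eta> g \<otimes> C g) \<otimes> v"
      using Cc vc cc \<eta> finite_G by (intro finsum_ldistr[symmetric]) auto
    finally show "(\<Oplus>g\<in>carrier G. \<eta> g \<otimes> C g) \<otimes> v = \<eta> h \<otimes> v" using zr by simp
  qed
  have hg: "inv\<^bsub>G\<^esub> h \<bullet> g \<in> carrier G" if "g \<in> carrier G" for g using that h by simp
  \<comment> \<open>Divide the relation for \<open>\<eta>\<close> by \<open>\<eta> h\<close> and sum over all \<open>\<eta>\<close>; only the term at \<open>g = h\<close> survives.\<close>
  have "N = (\<Oplus>\<eta>\<in>chars. \<Oplus>g\<in>carrier G. \<eta> (inv\<^bsub>G\<^esub> h \<bullet> g) \<otimes> C g)"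
    unfolding N_def
  proof (rule finsum_cong')
    fix \<eta> assume \<eta>: "\<eta> \<in> chars"
    note E = invariant_characterD[OF char_character[OF \<eta>]]
    have "\<one> = \<eta> (inv\<^bsub>G\<^esub> h) \<otimes> (\<Oplus>g\<in>carrier G. \<eta> g \<otimes> C g)" unfolding key[OF \<eta>] using E(6)[OF h] by simp
    also have "\<dots> = (\<Oplus>g\<in>carrier G. \<eta> (inv\<^bsub>G\<^esub> h) \<otimes> (\<eta> g \<otimes> C g))"
      using E(2) h Cc finite_G by (intro finsum_rdistr) auto
    also have "\<dots> = (\<Oplus>g\<in>carrier G. \<eta> (inv\<^bsub>G\<^esub> h \<bullet> g) \<otimes> C g)"
      using E(2,4) h Cc by (intro finsum_cong') (auto simp: m_assoc)
    finally show "\<one> = (\<Oplus>g\<in>carrier G. \<eta> (inv\<^bsub>G\<^esub> h \<bullet> g) \<otimes> C g)" .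
  qed (use cc hg Cc in \<open>auto intro!: finsum_closed\<close>)
  also have "\<dots> = (\<Oplus>g\<in>carrier G. \<Oplus>\<eta>\<in>chars. \<eta> (inv\<^bsub>G\<^esub> h \<bullet> g) \<otimes> C g)"
    using cc hg Cc finite_G finite_chars by (intro finsum_swap) auto
  also have "\<dots> = (\<Oplus>g\<in>carrier G. if g = h then N \<otimes> C g else \<zero>)"
  proof (rule finsum_cong')
    fix g assume g: "g \<in> carrier G"
    have "inv\<^bsub>G\<^esub> h \<bullet> g = \<one>\<^bsub>G\<^esub> \<longleftrightarrow> g = h"
    proof
      assume "inv\<^bsub>G\<^esub> h \<bullet> g = \<one>\<^bsub>G\<^esub>"
      then show "g = h" using g h by (metis G.inv_equality G.inv_inv G.inv_closed G.inv_comm)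
    qed (use h in simp)
    moreover have "(\<Oplus>\<eta>\<in>chars. \<eta> (inv\<^bsub>G\<^esub> h \<bullet> g) \<otimes> C g) = (\<Oplus>\<eta>\<in>chars. \<eta> (inv\<^bsub>G\<^esub> h \<bullet> g)) \<otimes> C g"
      using cc hg g Cc finite_chars by (intro finsum_ldistr[symmetric]) auto
    ultimately show "(\<Oplus>\<eta>\<in>chars. \<eta> (inv\<^bsub>G\<^esub> h \<bullet> g) \<otimes> C g) = (if g = h then N \<otimes> C g else \<zero>)"
      using sum_over_characters_eq[OF hg[OF g]] Cc[OF g] by simp
  qed (use Cc N_closed in auto)
  also have "\<dots> = N \<otimes> C h" using finite_G h Cc N_closed by (intro finsum_delta) auto
  finally have "N \<otimes> \<one> = N \<otimes> C h" using N_closed by simp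
  then have C_one: "C h = \<one>" using N_unit Cc[OF h] Units_l_cancel[of N \<one> "C h"] by simp
  have "C h \<otimes> e h = (\<Oplus>i\<in>{1..l}. (z i \<otimes> act h (y i)) \<otimes> e h)"
    unfolding C_def using zc h by (intro finsum_ldistr) auto
  also have "\<dots> = C h"
    unfolding C_def using zc h by (intro finsum_cong') (auto simp: m_assoc)
  finally show ?thesis using C_one h by simp
qed

lemma direct_iff_global:
  "family_sum_direct S chars eigenmodule \<longleftrightarrow> global_partial_action G D \<alpha>"
  using direct_imp_global global_imp_direct by (auto simp: global_iff)

end

section \<open>Globalizations\<close>

text \<open>The globalization is itself a partial action with all domains equal to \<open>T\<close>, so the calculus of
total maps applies to it as well.\<close>

locale globalized_partial_action = ring_partial_action +
  fixes T (structure) and \<beta> and \<iota>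
  assumes globalization: "globalization G S D \<alpha> T \<beta> \<iota>"
begin

abbreviation T_mult (infixl \<open>\<star>\<close> 70) where "a \<star> b \<equiv> a \<otimes>\<^bsub>T\<^esub> b"

sublocale T: ring_partial_action T G "\<lambda>_. carrier T" \<beta>
proof -
  have T: "partial_ring_action G T (\<lambda>_. carrier T) \<beta>"
    using globalization unfolding globalization_def by blast
  then have "cring T" by (simp add: partial_ring_action_def)
  then show "ring_partial_action T G (\<lambda>_. carrier T) \<beta>"
    by (intro ring_partial_action.intro ring_partial_action_axioms.intro T G.group_axioms)
qed

lemma T_e [simp]: "g \<in> carrier G \<Longrightarrow> T.e g = \<one>\<^bsub>T\<^esub>"
  using globalization T.global_iff unfolding globalization_def by blast

lemma T_act: "g \<in> carrier G \<Longrightarrow> t \<in> carrier T \<Longrightarrow> T.act g t = \<beta> g t"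
  by (simp add: T.act_eq_\<alpha>)

text \<open>The identity of the ideal of \<open>T\<close> with which \<open>S\<close> is identified.\<close>

definition u where "u = \<iota> \<one>"

lemma ideal_range: "ideal (\<iota> ` carrier S) T"
  using globalization by (simp add: globalization_def unital_ideal_def)

lemma
  shows \<iota>_closed [simp]: "\<And>a. a \<in> carrier S \<Longrightarrow> \<iota> a \<in> carrier T"
    and \<iota>_mult [simp]: "\<And>a b. a \<in> carrier S \<Longrightarrow> b \<in> carrier S \<Longrightarrow> \<iota> (a \<otimes> b) = \<iota> a \<star> \<iota> b"
    and \<iota>_inj: "inj_on \<iota> (carrier S)"
proof -
  have iso: "\<iota> \<in> ring_iso S (ideal_ring T (\<iota> ` carrier S))"
    using globalization unfolding globalization_def by blast
  show "\<And>a. a \<in> carrier S \<Longrightarrow> \<iota> a \<in> carrier T" using ideal.Icarr[OF ideal_range] by blast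
  show "\<And>a b. a \<in> carrier S \<Longrightarrow> b \<in> carrier S \<Longrightarrow> \<iota> (a \<otimes> b) = \<iota> a \<star> \<iota> b"
    "inj_on \<iota> (carrier S)"
    using iso by (auto simp: ring_iso_def ring_hom_def ideal_ring_def bij_betw_def)
qed

lemma u_closed [simp]: "u \<in> carrier T"
  by (simp add: u_def)

lemma \<iota>_times_u [simp]: "a \<in> carrier S \<Longrightarrow> \<iota> a \<star> u = \<iota> a"
  using \<iota>_mult[of a \<one>] by (simp add: u_def del: \<iota>_mult)

lemma u_idem [simp]: "u \<star> u = u"
  using \<iota>_times_u[of \<one>] by (simp add: u_def)

lemma times_u_in_range: "t \<in> carrier T \<Longrightarrow> t \<star> u \<in> \<iota> ` carrier S"
  using ideal.I_l_closed[OF ideal_range, of u t] by (simp add: u_def)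

lemma T_act_inverse:
  "g \<in> carrier G \<Longrightarrow> t \<in> carrier T \<Longrightarrow> T.act g (T.act (inv\<^bsub>G\<^esub> g) t) = t"
  using T.act_act[of g "inv\<^bsub>G\<^esub> g" t] by simp

text \<open>Both sides are the identity element of the ideal \<open>S \<inter> \<beta>\<^sub>k(S)\<close>.\<close>

lemma \<iota>_e:
  assumes k: "k \<in> carrier G"
  shows "\<iota> (e k) = u \<star> T.act k u"
proof -
  have D: "\<iota> ` D k = \<iota> ` carrier S \<inter> \<beta> k ` \<iota> ` carrier S"
    using globalization k by (simp add: globalization_def)
  have k': "inv\<^bsub>G\<^esub> k \<in> carrier G" using k by simp
  have "u \<star> T.act k u \<in> \<iota> ` D k"
    unfolding D
  proof
    show "u \<star> T.act k u \<in> \<iota> ` carrier S"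
      using times_u_in_range[of "T.act k u"] k by (simp add: T.m_comm)
    have v: "T.act (inv\<^bsub>G\<^esub> k) u \<star> u \<in> \<iota> ` carrier S"
      using times_u_in_range k' by simp
    have "u \<star> T.act k u = T.act k (T.act (inv\<^bsub>G\<^esub> k) u \<star> u)"
      using k k' by (simp add: T_act_inverse)
    also have "\<dots> = \<beta> k (T.act (inv\<^bsub>G\<^esub> k) u \<star> u)" using k k' by (intro T_act) auto
    finally show "u \<star> T.act k u \<in> \<beta> k ` \<iota> ` carrier S" using v by blast
  qed
  then obtain a where a: "a \<in> D k" "u \<star> T.act k u = \<iota> a" by blast
  have ac: "a \<in> carrier S" using a(1) D_closed k by blast
  have "\<iota> (e k \<otimes> a) = \<iota> a" using e_times[OF k a(1)] by simp
  then have 1: "\<iota> (e k) \<star> (u \<star> T.act k u) = u \<star> T.act k u" using a ac k by simp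
  have "\<iota> (e k) \<in> \<beta> k ` \<iota> ` carrier S" using D e_in_D[OF k] by blast
  then obtain b where b: "b \<in> carrier S" "\<iota> (e k) = T.act k (\<iota> b)" using T_act k by auto
  have "T.act k (\<iota> b \<star> u) = T.act k (\<iota> b)" using b by simp
  then have "\<iota> (e k) \<star> T.act k u = \<iota> (e k)" using b k by (simp del: \<iota>_times_u)
  then have "\<iota> (e k) \<star> (u \<star> T.act k u) = \<iota> (e k)"
    using k by (simp flip: T.m_assoc)
  then show ?thesis using 1 by simp
qed

lemma \<iota>_act:
  assumes k: "k \<in> carrier G" and a: "a \<in> carrier S"
  shows "\<iota> (act k a) = T.act k (\<iota> a) \<star> u"
proof -
  have k': "inv\<^bsub>G\<^esub> k \<in> carrier G" using k by simp
  have "\<iota> (act k a) = \<beta> k (\<iota> (a \<otimes> e (inv\<^bsub>G\<^esub> k)))"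
    unfolding act_def using globalization k times_e_in_D[OF k' a] by (simp add: globalization_def)
  also have "\<dots> = T.act k (\<iota> a \<star> (u \<star> T.act (inv\<^bsub>G\<^esub> k) u))"
    using T_act[of k "\<iota> (a \<otimes> e (inv\<^bsub>G\<^esub> k))"] k k' a by (simp add: \<iota>_e)
  also have "\<iota> a \<star> (u \<star> T.act (inv\<^bsub>G\<^esub> k) u) = \<iota> a \<star> T.act (inv\<^bsub>G\<^esub> k) u"
    using a k' by (simp flip: T.m_assoc)
  also have "T.act k \<dots> = T.act k (\<iota> a) \<star> u"
    using a k k' by (simp add: T_act_inverse)
  finally show ?thesis .
qed

text \<open>The prescribed components \<open>\<beta>\<^sub>g r\<close> agree on overlaps, since \<open>r\<close> is invariant under the
partial action. Components are then adjoined one at a time: correcting \<open>t\<close> by \<open>\<beta>\<^sub>h r - t \<beta>\<^sub>h u\<close>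
installs the component at \<open>h\<close> and, by compatibility, leaves the earlier ones intact.\<close>

lemma glue_translates:
  assumes r: "r \<in> invs" and F: "finite F" "F \<subseteq> carrier G"
  shows "\<exists>t\<in>carrier T. \<forall>g\<in>F. t \<star> T.act g u = T.act g (\<iota> r)"
  using F
proof (induction F rule: finite_induct)
  case empty
  then show ?case by auto
next
  case (insert h F)
  then have h: "h \<in> carrier G" and F: "F \<subseteq> carrier G" by auto
  have rc: "r \<in> carrier S" using r invsD(1) by blast
  obtain t where t: "t \<in> carrier T" "\<And>g. g \<in> F \<Longrightarrow> t \<star> T.act g u = T.act g (\<iota> r)"
    using insert.IH F by blast
  have compat: "T.act g (\<iota> r) \<star> T.act h u = T.act h (\<iota> r) \<star> T.act g u" if g: "g \<in> carrier G" for g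
  proof -
    define k where "k = inv\<^bsub>G\<^esub> g \<otimes>\<^bsub>G\<^esub> h"
    have k: "k \<in> carrier G" "g \<otimes>\<^bsub>G\<^esub> k = h" using g h by (auto simp: k_def simp flip: G.m_assoc)
    have hk: "T.act h s = T.act g (T.act k s)" if "s \<in> carrier T" for s
      using T.act_act[OF g k(1) that] k g h that by simp
    have "T.act k (\<iota> r) \<star> u = \<iota> (r \<otimes> e k)"
      using \<iota>_act[OF k(1) rc] invsD(2)[OF r k(1)] by simp
    also have "\<dots> = \<iota> r \<star> T.act k u"
      using rc k by (simp add: \<iota>_e flip: T.m_assoc)
    finally have "T.act g (\<iota> r \<star> T.act k u) = T.act g (T.act k (\<iota> r) \<star> u)" by simp
    then show ?thesis using rc g k by (simp add: hk)
  qed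
  define t' where "t' = t \<oplus>\<^bsub>T\<^esub> T.act h (\<iota> r) \<ominus>\<^bsub>T\<^esub> t \<star> T.act h u"
  have t'c: "t' \<in> carrier T" using t h rc by (simp add: t'_def)
  have cl: "t \<in> carrier T" "T.act h (\<iota> r) \<in> carrier T" "T.act h u \<in> carrier T" using t h rc by auto
  have "T.act h u \<star> T.act h u = T.act h (u \<star> u)" using h by (simp del: u_idem)
  then have uu: "T.act h u \<star> T.act h u = T.act h u" by simp
  have "T.act h (\<iota> r) \<star> T.act h u = T.act h (\<iota> r \<star> u)" using h rc by (simp del: \<iota>_times_u)
  then have ru: "T.act h (\<iota> r) \<star> T.act h u = T.act h (\<iota> r)" using rc by simp
  have expand: "t' \<star> s = t \<star> s \<oplus>\<^bsub>T\<^esub> T.act h (\<iota> r) \<star> s \<ominus>\<^bsub>T\<^esub> t \<star> (T.act h u \<star> s)"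
    if "s \<in> carrier T" for s
    unfolding t'_def using cl that by (simp add: a_minus_def T.l_distr T.l_minus T.m_assoc)
  have cancel: "p \<oplus>\<^bsub>T\<^esub> q \<ominus>\<^bsub>T\<^esub> p = q" "q \<oplus>\<^bsub>T\<^esub> p \<ominus>\<^bsub>T\<^esub> p = q" if "p \<in> carrier T" "q \<in> carrier T" for p q
  proof -
    have "p \<oplus>\<^bsub>T\<^esub> q \<ominus>\<^bsub>T\<^esub> p = q \<oplus>\<^bsub>T\<^esub> (p \<oplus>\<^bsub>T\<^esub> \<ominus>\<^bsub>T\<^esub> p)" "q \<oplus>\<^bsub>T\<^esub> p \<ominus>\<^bsub>T\<^esub> p = q \<oplus>\<^bsub>T\<^esub> (p \<oplus>\<^bsub>T\<^esub> \<ominus>\<^bsub>T\<^esub> p)"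
      using that by (simp_all add: a_minus_def T.a_ac)
    then show "p \<oplus>\<^bsub>T\<^esub> q \<ominus>\<^bsub>T\<^esub> p = q" "q \<oplus>\<^bsub>T\<^esub> p \<ominus>\<^bsub>T\<^esub> p = q" using that by (simp_all add: T.r_neg)
  qed
  have "t' \<star> T.act g u = T.act g (\<iota> r)" if g: "g \<in> insert h F" for g
  proof (cases "g = h")
    case True
    then show ?thesis using expand[of "T.act h u"] cl uu ru cancel by simp
  next
    case False
    then have gF: "g \<in> F" "g \<in> carrier G" using g F by auto
    have gc: "T.act g u \<in> carrier T" "T.act g (\<iota> r) \<in> carrier T" using gF rc by auto
    have "t \<star> (T.act h u \<star> T.act g u) = (t \<star> T.act g u) \<star> T.act h u"
      using cl gc by (simp add: T.m_ac)
    also have "\<dots> = T.act h (\<iota> r) \<star> T.act g u" unfolding t(2)[OF gF(1)] by (rule compat[OF gF(2)])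
    finally show ?thesis using expand[OF gc(1)] t(2)[OF gF(1)] cl gc cancel(2) by simp
  qed
  then show ?case using t'c by blast
qed

text \<open>The glued element is invariant, because it and its translates have the same components and
an element of \<open>T = \<Sum> \<beta>\<^sub>g(S)\<close> is determined by its components.\<close>

lemma invariant_lift_exists:
  assumes r: "r \<in> invs"
  shows "\<exists>t\<in>invariants G T \<beta>. t \<star> u = \<iota> r"
proof -
  have rc: "r \<in> carrier S" using r invsD(1) by blast
  obtain t where t: "t \<in> carrier T" "\<And>g. g \<in> carrier G \<Longrightarrow> t \<star> T.act g u = T.act g (\<iota> r)"
    using glue_translates[OF r finite_G] by blast
  have "T.act h t = t" if h: "h \<in> carrier G" for h
  proof -
    \<comment> \<open>The difference annihilates every \<open>\<beta>\<^sub>g(S)\<close>, hence their sum, which contains 1.\<close>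
    define d where "d = T.act h t \<ominus>\<^bsub>T\<^esub> t"
    have dc: "d \<in> carrier T" using t h by (simp add: d_def)
    have d0: "d \<star> T.act g u = \<zero>\<^bsub>T\<^esub>" if g: "g \<in> carrier G" for g
    proof -
      define k where "k = inv\<^bsub>G\<^esub> h \<otimes>\<^bsub>G\<^esub> g"
      have k: "k \<in> carrier G" "h \<otimes>\<^bsub>G\<^esub> k = g" using g h by (auto simp: k_def simp flip: G.m_assoc)
      have hk: "T.act g s = T.act h (T.act k s)" if "s \<in> carrier T" for s
        using T.act_act[OF h k(1) that] k g h that by simp
      have "T.act h t \<star> T.act g u = T.act h (t \<star> T.act k u)"
        using t(1) h k hk by simp
      also have "\<dots> = T.act g (\<iota> r)" unfolding t(2)[OF k(1)] using hk rc by simp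
      also have "\<dots> = t \<star> T.act g u" using t(2)[OF g] by simp
      finally show ?thesis
        unfolding d_def using t(1) h g by (simp add: a_minus_def T.l_distr T.l_minus T.r_neg)
    qed
    obtain m where m: "m \<in> (\<Pi>\<^sub>E g\<in>carrier G. \<beta> g ` \<iota> ` carrier S)" "\<one>\<^bsub>T\<^esub> = (\<Oplus>\<^bsub>T\<^esub>g\<in>carrier G. m g)"
      using globalization T.one_closed unfolding globalization_def family_sum_def by blast
    have m0: "m g \<in> carrier T" "d \<star> m g = \<zero>\<^bsub>T\<^esub>" if g: "g \<in> carrier G" for g
    proof -
      have "m g \<in> \<beta> g ` \<iota> ` carrier S" by (rule PiE_mem[OF m(1) g])
      then obtain a where "a \<in> carrier S" "m g = \<beta> g (\<iota> a)" by blast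
      then have a: "a \<in> carrier S" "m g = T.act g (\<iota> a)" using T_act[OF g, of "\<iota> a"] by auto
      then show "m g \<in> carrier T" using g by simp
      have "m g = T.act g (\<iota> a \<star> u)" using a by simp
      also have "\<dots> = T.act g u \<star> T.act g (\<iota> a)" using a g by (simp add: T.m_comm del: \<iota>_times_u)
      finally have "d \<star> m g = (d \<star> T.act g u) \<star> T.act g (\<iota> a)"
        using dc a g by (simp add: T.m_assoc)
      then show "d \<star> m g = \<zero>\<^bsub>T\<^esub>" using d0[OF g] a g by simp
    qed
    have "d = d \<star> (\<Oplus>\<^bsub>T\<^esub>g\<in>carrier G. m g)" using dc by (simp flip: m(2))
    also have "\<dots> = (\<Oplus>\<^bsub>T\<^esub>g\<in>carrier G. d \<star> m g)"
      using dc m0(1) finite_G by (intro T.finsum_rdistr) auto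
    also have "\<dots> = \<zero>\<^bsub>T\<^esub>" using m0(2) by (intro T.add.finprod_one_eqI) auto
    finally show ?thesis unfolding d_def using t(1) h by simp
  qed
  then have "t \<in> invariants G T \<beta>" using t(1) T_act by (simp add: invariants_def)
  moreover have "t \<star> u = \<iota> r" using t(2)[of "\<one>\<^bsub>G\<^esub>"] rc by simp
  ultimately show ?thesis by blast
qed

lemma invariants_lift_correct:
  assumes r: "r \<in> invs"
  shows "invariants_lift G S T \<beta> \<iota> r \<in> carrier T" "invariants_lift G S T \<beta> \<iota> r \<star> u = \<iota> r"
proof -
  define F where "F t = inv_into (carrier S) \<iota> (t \<star> u)" for t
  obtain t where t: "t \<in> invariants G T \<beta>" "t \<star> u = \<iota> r" using invariant_lift_exists[OF r] by blast
  have "F t = r" using t(2) \<iota>_inj invsD(1)[OF r] by (simp add: F_def)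
  then have img: "r \<in> F ` invariants G T \<beta>" using t(1) by blast
  have lift: "invariants_lift G S T \<beta> \<iota> r = inv_into (invariants G T \<beta>) F r"
    unfolding invariants_lift_def F_def u_def ..
  have in_inv: "invariants_lift G S T \<beta> \<iota> r \<in> invariants G T \<beta>"
    unfolding lift by (rule inv_into_into[OF img])
  then show c: "invariants_lift G S T \<beta> \<iota> r \<in> carrier T" by (simp add: invariants_def)
  have "F (invariants_lift G S T \<beta> \<iota> r) = r" unfolding lift by (rule f_inv_into_f[OF img])
  then have "\<iota> r = \<iota> (inv_into (carrier S) \<iota> (invariants_lift G S T \<beta> \<iota> r \<star> u))" by (simp add: F_def)
  also have "\<dots> = invariants_lift G S T \<beta> \<iota> r \<star> u"
    by (rule f_inv_into_f[OF times_u_in_range[OF c]])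
  finally show "invariants_lift G S T \<beta> \<iota> r \<star> u = \<iota> r" by simp
qed

text \<open>Multiplying the eigenvalue equation in \<open>T\<close> by the identity of \<open>S\<close> turns \<open>\<psi> (\<chi> g)\<close> into
\<open>\<chi> g\<close> and \<open>\<beta>\<^sub>g u\<close> into \<open>e g\<close>.\<close>

lemma lifted_char_module_times_u:
  assumes \<chi>: "\<And>g. g \<in> carrier G \<Longrightarrow> \<chi> g \<in> invs"
  shows "(\<lambda>b. b \<star> \<iota> \<one>) ` lifted_char_module G S T \<beta> \<iota> \<chi> \<subseteq> \<iota> ` eigenmodule \<chi>"
proof
  fix z assume "z \<in> (\<lambda>b. b \<star> \<iota> \<one>) ` lifted_char_module G S T \<beta> \<iota> \<chi>"
  then obtain b where z: "z = b \<star> u" and b: "b \<in> carrier T"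
    "\<And>g. g \<in> carrier G \<Longrightarrow> \<beta> g b = invariants_lift G S T \<beta> \<iota> (\<chi> g) \<star> b"
    unfolding lifted_char_module_def u_def by blast
  obtain a where a: "a \<in> carrier S" "b \<star> u = \<iota> a" using times_u_in_range[OF b(1)] by blast
  have "act g a = \<chi> g \<otimes> e g \<otimes> a" if g: "g \<in> carrier G" for g
  proof -
    define p where "p = invariants_lift G S T \<beta> \<iota> (\<chi> g)"
    have p: "p \<in> carrier T" "p \<star> u = \<iota> (\<chi> g)"
      unfolding p_def using invariants_lift_correct[OF \<chi>[OF g]] by auto
    have xc: "\<chi> g \<in> carrier S" using \<chi>[OF g] invsD(1) by blast
    have gu: "T.act g u \<in> carrier T" using g by simp
    have "\<iota> (act g a) = T.act g (b \<star> u) \<star> u" using \<iota>_act[OF g a(1)] a(2) by simp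
    also have "\<dots> = (p \<star> b) \<star> T.act g u \<star> u"
      using b g T_act[OF g b(1)] by (simp add: p_def)
    also have "\<dots> = (p \<star> (u \<star> u)) \<star> (u \<star> T.act g u) \<star> (b \<star> u)"
    proof -
      have "(p \<star> (u \<star> u)) \<star> (u \<star> T.act g u) \<star> (b \<star> u)
         = (p \<star> b) \<star> T.act g u \<star> (u \<star> (u \<star> (u \<star> u)))"
        using p(1) b(1) gu u_closed by (simp only: T.m_ac T.m_closed)
      then show ?thesis by simp
    qed
    also have "\<dots> = \<iota> (\<chi> g \<otimes> e g \<otimes> a)"
      using p(2) a xc g by (simp add: \<iota>_e)
    finally show ?thesis by (rule inj_onD[OF \<iota>_inj]) (use a(1) xc g in auto)
  qed
  then have "a \<in> eigenmodule \<chi>" using a(1) by (simp add: eigenmodule_def)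
  then show "z \<in> \<iota> ` eigenmodule \<chi>" using z a(2) by simp
qed

end

section \<open>Characters as cocycles\<close>

context partial_kummer begin

abbreviation "\<mu> \<equiv> par_char G S D"
abbreviation "Z1 \<equiv> cocycle_group G S D \<alpha>"

lemma par_char_eq: "\<mu> \<chi> = (\<lambda>g\<in>carrier G. \<chi> g \<otimes> e g)"
  by (simp add: par_char_def e_def)

lemma cocycle_module_par_char: "cocycle_module G S D \<alpha> (\<mu> \<chi>) = eigenmodule \<chi>"
  by (simp add: cocycle_module_eq eigenmodule_def par_char_eq)

lemma Z1_mult: "f \<otimes>\<^bsub>Z1\<^esub> f' = (\<lambda>g\<in>carrier G. f g \<otimes> f' g)"
  and Z1_one: "\<one>\<^bsub>Z1\<^esub> = (\<lambda>g\<in>carrier G. e g)"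
  by (simp_all add: cocycle_group_def e_def)

lemma par_char_cocycle:
  assumes \<chi>: "\<chi> \<in> chars"
  shows "\<mu> \<chi> \<in> carrier Z1"
  unfolding cocycle_carrier_iff par_char_eq
proof (intro conjI ballI)
  note C = invariant_characterD[OF char_character[OF \<chi>]]
  fix g assume g: "g \<in> carrier G"
  show "(\<lambda>g\<in>carrier G. \<chi> g \<otimes> e g) g \<in> D g" using g C(2) times_e_in_D by simp
  have c: "\<chi> g \<in> carrier S" "\<chi> (inv\<^bsub>G\<^esub> g) \<in> carrier S" "e g \<in> carrier S" using C(2) g by auto
  have "(\<chi> g \<otimes> e g) \<otimes> (\<chi> (inv\<^bsub>G\<^esub> g) \<otimes> e g) = (\<chi> g \<otimes> \<chi> (inv\<^bsub>G\<^esub> g)) \<otimes> (e g \<otimes> e g)"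
    using c by (simp only: m_ac m_closed)
  then have "(\<chi> g \<otimes> e g) \<otimes> (\<chi> (inv\<^bsub>G\<^esub> g) \<otimes> e g) = e g" using C(5)[OF g] g by simp
  then show "\<exists>v\<in>D g. (\<lambda>g\<in>carrier G. \<chi> g \<otimes> e g) g \<otimes> v = e g"
    using g c times_e_in_D by (intro bexI[of _ "\<chi> (inv\<^bsub>G\<^esub> g) \<otimes> e g"]) auto
  fix h assume h: "h \<in> carrier G"
  let ?gh = "g \<bullet> h"
  have c': "\<chi> h \<in> carrier S" "e ?gh \<in> carrier S" using C(2) g h by auto
  have "(\<chi> g \<otimes> e g) \<otimes> act g (\<chi> h \<otimes> e h) = (\<chi> g \<otimes> e g) \<otimes> (\<chi> h \<otimes> (e g \<otimes> e ?gh))"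
    using act_invs_mult[OF C(1)[OF h] g, of "e h"] g h by (simp add: act_e)
  also have "\<dots> = (\<chi> g \<otimes> \<chi> h) \<otimes> e ?gh \<otimes> (e g \<otimes> e g)"
    using c c' by (simp only: m_ac m_closed)
  finally show "(\<lambda>g\<in>carrier G. \<chi> g \<otimes> e g) ?gh \<otimes> e g
      = (\<lambda>g\<in>carrier G. \<chi> g \<otimes> e g) g \<otimes> act g ((\<lambda>g\<in>carrier G. \<chi> g \<otimes> e g) h)"
    using g h by (simp add: C(4))
qed simp

lemma par_char_mult:
  assumes \<chi>: "\<chi> \<in> chars" and \<eta>: "\<eta> \<in> chars"
  shows "\<mu> (\<chi> \<otimes>\<^bsub>Ghat\<^esub> \<eta>) = \<mu> \<chi> \<otimes>\<^bsub>Z1\<^esub> \<mu> \<eta>"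
  unfolding par_char_eq Z1_mult
proof (rule restrict_ext)
  fix g assume g: "g \<in> carrier G"
  have c: "\<chi> g \<in> carrier S" "\<eta> g \<in> carrier S" "e g \<in> carrier S"
    using char_closed \<chi> \<eta> g by auto
  have "(\<chi> g \<otimes> e g) \<otimes> (\<eta> g \<otimes> e g) = (\<chi> g \<otimes> \<eta> g) \<otimes> (e g \<otimes> e g)"
    using c by (simp only: m_ac m_closed)
  then show "(\<chi> \<otimes>\<^bsub>Ghat\<^esub> \<eta>) g \<otimes> e g = (\<lambda>g\<in>carrier G. \<chi> g \<otimes> e g) g \<otimes> (\<lambda>g\<in>carrier G. \<eta> g \<otimes> e g) g"
    using g by (simp add: Ghat_mult)
qed

sublocale \<mu>: group_hom Ghat Z1 \<mu>
proof -
  have "\<mu> \<in> hom Ghat Z1" using par_char_cocycle par_char_mult by (auto intro: homI)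
  then show "group_hom Ghat Z1 \<mu>"
    using comm_group_Ghat comm_group_cocycle_group
    by (simp add: group_hom_def group_hom_axioms_def comm_group.axioms(2))
qed

lemma par_char_epi: "\<mu> \<in> epi Ghat (Z1\<lparr>carrier := \<mu> ` chars\<rparr>)"
  using \<mu>.homh by (auto simp: epi_def hom_def)

text \<open>Values different from 1 are so far from 1 that \<open>1 - \<chi> g\<close> is a unit; it can only kill \<open>e g\<close> if
\<open>e g = 0\<close>.\<close>

lemma char_value_on_e:
  assumes \<chi>: "\<chi> \<in> chars" and g: "g \<in> carrier G"
  shows "\<chi> g \<otimes> e g = e g \<longleftrightarrow> e g = \<zero> \<or> \<chi> g = \<one>"
proof
  assume "\<chi> g \<otimes> e g = e g"
  then show "e g = \<zero> \<or> \<chi> g = \<one>"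
    using eq_zero_if_scaled[OF char_closed[OF \<chi> g] char_one_minus_unit[OF \<chi> g] e_closed[OF g]] by blast
qed (use char_closed[OF \<chi> g] g in auto)

lemma par_char_eq_one_iff:
  assumes \<chi>: "\<chi> \<in> chars"
  shows "\<mu> \<chi> = \<one>\<^bsub>Z1\<^esub> \<longleftrightarrow> (\<forall>g\<in>carrier G. e g \<noteq> \<zero> \<longrightarrow> \<chi> g = \<one>)"
proof -
  have "\<mu> \<chi> = \<one>\<^bsub>Z1\<^esub> \<longleftrightarrow> (\<forall>g\<in>carrier G. \<chi> g \<otimes> e g = e g)"
    unfolding par_char_eq Z1_one by (auto simp: fun_eq_iff restrict_def)
  then show ?thesis using char_value_on_e[OF \<chi>] by auto
qed

lemma kernel_par_char:
  "kernel Ghat (Z1\<lparr>carrier := \<mu> ` chars\<rparr>) \<mu> = {\<chi> \<in> chars. \<forall>g\<in>carrier G. e g \<noteq> \<zero> \<longrightarrow> \<chi> g = \<one>}"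
  using par_char_eq_one_iff by (auto simp: kernel_def)

lemma par_char_iso:
  assumes e: "\<forall>g\<in>carrier G. e g \<noteq> \<zero>"
  shows "Ghat \<cong> Z1\<lparr>carrier := \<mu> ` chars\<rparr>"
proof -
  have "inj_on \<mu> chars"
    unfolding \<mu>.inj_on_one_iff
  proof (intro allI impI)
    fix \<chi> assume \<chi>: "\<chi> \<in> chars" "\<mu> \<chi> = \<one>\<^bsub>Z1\<^esub>"
    then show "\<chi> = \<one>\<^bsub>Ghat\<^esub>"
      using par_char_eq_one_iff[OF \<chi>(1)] e
      by (intro char_ext[OF \<chi>(1) \<mu>.G.one_closed]) (simp add: Ghat_one)
  qed
  then have "\<mu> \<in> iso Ghat (Z1\<lparr>carrier := \<mu> ` chars\<rparr>)"
    using par_char_epi by (simp add: iso_iff_mon_epi mon_def epi_def)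
  then show ?thesis by (auto simp: is_iso_def)
qed

lemma cocycle_module_hom:
  "group_hom (Z1\<lparr>carrier := \<mu> ` chars\<rparr>) (invertible_submodules S invs) (cocycle_module G S D \<alpha>)"
proof -
  have "group (Z1\<lparr>carrier := \<mu> ` chars\<rparr>)"
    by (rule subgroup.subgroup_is_group[OF \<mu>.img_is_subgroup \<mu>.H.is_group])
  moreover have "cocycle_module G S D \<alpha> \<in> hom (Z1\<lparr>carrier := \<mu> ` chars\<rparr>) (invertible_submodules S invs)"
  proof (rule homI)
    fix f assume "f \<in> carrier (Z1\<lparr>carrier := \<mu> ` chars\<rparr>)"
    then obtain \<chi> where \<chi>: "\<chi> \<in> chars" "f = \<mu> \<chi>" by auto
    then show "cocycle_module G S D \<alpha> f \<in> carrier (invertible_submodules S invs)"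
      using eigenmodule_invertible[OF char_character[OF \<chi>(1)]] by (simp add: cocycle_module_par_char)
    fix f' assume "f' \<in> carrier (Z1\<lparr>carrier := \<mu> ` chars\<rparr>)"
    then obtain \<eta> where \<eta>: "\<eta> \<in> chars" "f' = \<mu> \<eta>" by auto
    have "eigenmodule (\<chi> \<otimes>\<^bsub>Ghat\<^esub> \<eta>) = eigenmodule (\<lambda>g. \<chi> g \<otimes> \<eta> g)"
      by (intro eigenmodule_cong) (simp add: Ghat_mult)
    then show "cocycle_module G S D \<alpha> (f \<otimes>\<^bsub>Z1\<lparr>carrier := \<mu> ` chars\<rparr>\<^esub> f')
       = cocycle_module G S D \<alpha> f \<otimes>\<^bsub>invertible_submodules S invs\<^esub> cocycle_module G S D \<alpha> f'"
      using eigenmodule_prod[OF char_character[OF \<chi>(1)] char_character[OF \<eta>(1)]]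
      by (simp add: \<chi>(2) \<eta>(2) par_char_mult[OF \<chi>(1) \<eta>(1), symmetric] cocycle_module_par_char
          invertible_submodules_def)
  qed
  ultimately show ?thesis
    using group_invertible_submodules[OF subring_invs] by (simp add: group_hom_def group_hom_axioms_def)
qed

end

theorem lemma4p6:
  fixes n :: nat
    and k :: "('k, 'n) ring_scheme"
    and G :: "('g, 'l) monoid_scheme"
    and S :: "('k, 'a, 'm) module_scheme"
    and D :: "'g \<Rightarrow> 'a set"
    and \<alpha> :: "'g \<Rightarrow> 'a \<Rightarrow> 'a"
    and R :: "'a set"
    and \<omega> :: 'a
  defines "Ghat \<equiv> char_group G (S\<lparr>carrier := R\<rparr>) \<omega>"
    and "Z1 \<equiv> cocycle_group G S D \<alpha>"
    and "\<mu>\<^sub>p \<equiv> par_char G S D"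
    and "Q \<equiv> cocycle_module G S D \<alpha>"
  defines "Ghat_par \<equiv> \<mu>\<^sub>p ` carrier Ghat"
  assumes "n \<ge> 2"
    and "partial_kummerian_extension n k G S D \<alpha> R"
    and "kummerian_root n (S\<lparr>carrier := R\<rparr>) \<omega>"
  shows
    "(\<forall>g\<in>carrier G. g \<noteq> \<one>\<^bsub>G\<^esub> \<longrightarrow> (\<Oplus>\<^bsub>S\<^esub>\<chi>\<in>carrier Ghat. \<chi> g) = \<zero>\<^bsub>S\<^esub>) \<and>
     subgroup Ghat_par Z1 \<and>
     \<mu>\<^sub>p \<in> epi Ghat (Z1\<lparr>carrier := Ghat_par\<rparr>) \<and>
     kernel Ghat (Z1\<lparr>carrier := Ghat_par\<rparr>) \<mu>\<^sub>p =
       {\<chi> \<in> carrier Ghat. \<forall>g\<in>carrier G. ideal_ident S (D g) \<noteq> \<zero>\<^bsub>S\<^esub> \<longrightarrow> \<chi> g = \<one>\<^bsub>S\<^esub>} \<and>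
     ((\<forall>g\<in>carrier G. ideal_ident S (D g) \<noteq> \<zero>\<^bsub>S\<^esub>) \<longrightarrow> Ghat \<cong> Z1\<lparr>carrier := Ghat_par\<rparr>) \<and>
     group_hom (Z1\<lparr>carrier := Ghat_par\<rparr>) (invertible_submodules S R) Q \<and>
     carrier S = family_sum S (carrier Ghat) (\<lambda>\<chi>. Q (\<mu>\<^sub>p \<chi>)) \<and>
     (family_sum_direct S (carrier Ghat) (\<lambda>\<chi>. Q (\<mu>\<^sub>p \<chi>)) \<longleftrightarrow> galois_extension k G S D \<alpha> R) \<and>
     (\<forall>(T :: ('b, 'p) ring_scheme) \<beta> \<iota>. globalization G S D \<alpha> T \<beta> \<iota> \<longrightarrow>
        (\<forall>\<chi>\<in>carrier Ghat.
           (\<lambda>b. b \<otimes>\<^bsub>T\<^esub> \<iota> \<one>\<^bsub>S\<^esub>) ` lifted_char_module G S T \<beta> \<iota> \<chi> \<subseteq> \<iota> ` Q (\<mu>\<^sub>p \<chi>)))"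
proof -
  have galois: "partial_galois_extension k G S D \<alpha> R" and comm: "comm_group G" and order: "order G = n"
    using assms(7) by (auto simp: partial_kummerian_extension_def)
  have action: "partial_ring_action G S D \<alpha>"
    using galois by (simp add: partial_galois_extension_def unital_partial_action_def)
  then have "cring S" "group G" by (auto simp: partial_ring_action_def)
  then interpret A: ring_partial_action S G D \<alpha>
    by (intro ring_partial_action.intro ring_partial_action_axioms.intro action)
  have R: "R = A.invs" using galois by (simp add: partial_galois_extension_def)
  obtain l :: nat and x y where xy: "x \<in> {1..l} \<rightarrow> carrier S" "y \<in> {1..l} \<rightarrow> carrier S"
    "\<forall>g\<in>carrier G. (\<Oplus>\<^bsub>S\<^esub>i\<in>{1..l}. x i \<otimes>\<^bsub>S\<^esub> A.act g (y i)) = (if g = \<one>\<^bsub>G\<^esub> then \<one>\<^bsub>S\<^esub> else \<zero>\<^bsub>S\<^esub>)"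
    using galois unfolding partial_galois_extension_def A.act_def A.e_def by blast
  have root: "\<omega> \<in> Units (S\<lparr>carrier := R\<rparr>)" "\<omega> [^]\<^bsub>S\<lparr>carrier := R\<rparr>\<^esub> n = \<one>\<^bsub>S\<^esub>"
    "\<And>i. 0 < i \<Longrightarrow> i < n \<Longrightarrow> \<one>\<^bsub>S\<^esub> \<ominus>\<^bsub>S\<lparr>carrier := R\<rparr>\<^esub> \<omega> [^]\<^bsub>S\<lparr>carrier := R\<rparr>\<^esub> i \<in> Units (S\<lparr>carrier := R\<rparr>)"
    using assms(8) by (auto simp: kummerian_root_def)
  have \<omega>R: "\<omega> \<in> R" using root(1) by (simp add: Units_def)
  have sub: "subring R S" using A.subring_invs R by simp
  have pow: "\<omega> [^]\<^bsub>S\<lparr>carrier := R\<rparr>\<^esub> i = \<omega> [^]\<^bsub>S\<^esub> i" for i :: nat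
    by (simp add: nat_pow_def)
  have powR: "\<omega> [^]\<^bsub>S\<^esub> i \<in> R" for i :: nat
    by (induction i) (use subringE[OF sub] \<omega>R in auto)
  have minus: "\<one>\<^bsub>S\<^esub> \<ominus>\<^bsub>S\<lparr>carrier := R\<rparr>\<^esub> a = \<one>\<^bsub>S\<^esub> \<ominus>\<^bsub>S\<^esub> a" if "a \<in> R" for a
  proof -
    interpret R: ring "S\<lparr>carrier := R\<rparr>" using A.subring_is_ring[OF sub] .
    have "\<ominus>\<^bsub>S\<^esub> a \<oplus>\<^bsub>S\<^esub> a = \<zero>\<^bsub>S\<^esub>" using that subringE(1)[OF sub] by (intro A.l_neg) blast
    then have "\<ominus>\<^bsub>S\<lparr>carrier := R\<rparr>\<^esub> a = \<ominus>\<^bsub>S\<^esub> a"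
      using R.minus_equality[of "\<ominus>\<^bsub>S\<^esub> a" a] that subringE(5)[OF sub] by simp
    then show ?thesis by (simp add: a_minus_def)
  qed
  interpret comm_group G by (rule comm)
  interpret K: partial_kummer S G D \<alpha> l x y \<omega>
  proof
    show "x \<in> {1..l} \<rightarrow> carrier S" "y \<in> {1..l} \<rightarrow> carrier S" by (rule xy)+
    show "\<And>g. g \<in> carrier G \<Longrightarrow>
      (\<Oplus>\<^bsub>S\<^esub>i\<in>{1..l}. x i \<otimes>\<^bsub>S\<^esub> A.act g (y i)) = (if g = \<one>\<^bsub>G\<^esub> then \<one>\<^bsub>S\<^esub> else \<zero>\<^bsub>S\<^esub>)"
      using xy(3) by blast
    show "\<omega> \<in> A.invs" using \<omega>R R by simp
    show "\<omega> [^]\<^bsub>S\<^esub> order G = \<one>\<^bsub>S\<^esub>" using root(2) order pow by simp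
    fix i :: nat assume i: "0 < i" "i < order G"
    have "\<one>\<^bsub>S\<^esub> \<ominus>\<^bsub>S\<^esub> \<omega> [^]\<^bsub>S\<^esub> i \<in> Units (S\<lparr>carrier := R\<rparr>)"
      using root(3)[of i] i order minus[OF powR] by (simp add: pow)
    then show "\<one>\<^bsub>S\<^esub> \<ominus>\<^bsub>S\<^esub> \<omega> [^]\<^bsub>S\<^esub> i \<in> Units S"
      using subringE(1)[OF sub] unfolding Units_def by auto
  qed
  have Ghat: "Ghat = K.Ghat" by (simp add: Ghat_def R)
  have Q: "Q (\<mu>\<^sub>p \<chi>) = A.eigenmodule \<chi>" for \<chi>
    by (simp add: Q_def \<mu>\<^sub>p_def K.cocycle_module_par_char)
  have globalization: "(\<lambda>b. b \<otimes>\<^bsub>T\<^esub> \<iota> \<one>\<^bsub>S\<^esub>) ` lifted_char_module G S T \<beta> \<iota> \<chi> \<subseteq> \<iota> ` A.eigenmodule \<chi>"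
    if "globalization G S D \<alpha> T \<beta> \<iota>" "\<chi> \<in> K.chars" for T :: "('b, 'p) ring_scheme" and \<beta> \<iota> \<chi>
  proof -
    interpret T: globalized_partial_action S G D \<alpha> T \<beta> \<iota>
      by (unfold_locales) (rule that(1))
    show ?thesis
      using A.invariant_characterD(1)[OF K.char_character[OF that(2)]] by (rule T.lifted_char_module_times_u)
  qed
  have direct: "family_sum_direct S K.chars A.eigenmodule \<longleftrightarrow>
      partial_galois_extension k G S D \<alpha> A.invs \<and> global_partial_action G D \<alpha>"
    using K.direct_iff_global galois R by simp
  show ?thesis
    unfolding Q Ghat
    unfolding Ghat_par_def Ghat Z1_def \<mu>\<^sub>p_def Q_def galois_extension_def A.e_def[symmetric] R
    by (intro conjI allI ballI impI;
        (rule K.sum_over_characters K.\<mu>.img_is_subgroup K.par_char_epi K.kernel_par_char K.par_char_iso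
          K.cocycle_module_hom K.family_sum_eigenmodules direct globalization; assumption?))
qed

end
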